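(* Let $(M^8,g,\rho)$ be a $\mathrm{PSU}(3)$-structure of type $\mathcal{W}_1\oplus\dots\oplus\mathcal{W}_5$. The following are equivalent: i) The characteristic torsion $\mathcal{T}^c$ is $\nabla^c$-parallel. ii) The tensor field $\mathcal{A}^c$ is $\nabla^c$-parallel. iii) The characteristic forms $T^c,F^c$ are $\nabla^c$-parallel.
   Context: Algebraic setting. $\mathbb{R}^8$ is oriented Euclidean space, identified with its dual; $(e_1,\dots,e_8)$ is an oriented orthonormal basis, $e_{i_1\dots i_j}=e_{i_1}\wedge\dots\wedge e_{i_j}$, $\Lambda^k$ the space of $k$-forms. For $\alpha\in\Lambda^k,\beta\in\Lambda^l$ put $\sigma_0(\alpha,\beta)=\alpha\wedge\beta$ and $\sigma_j(\alpha,\beta)=\sum_{i_1<\dots<i_j}(e_{i_1}\lrcorner\cdots\lrcorner e_{i_j}\lrcorner\alpha)\wedge(e_{i_1}\lrcorner\cdots\lrcorner e_{i_j}\lrcorner\beta)$. For $k\le l$ the contraction is $\alpha\lrcorner\beta=\sigma_k(\alpha,\beta)$; $\ast$ is the Hodge operator. Let $$(\star)\quad\rho=e_{246}-e_{235}-e_{145}-e_{136}+(e_{12}+e_{34}-2e_{56})\wedge e_7+\sqrt3\,(e_{12}-e_{34})\wedge e_8 ,$$ $\mathrm{PSU}(3)\subset\mathrm{SO}(8)$ its isotropy group, $\sigma_+(\alpha)=\sigma_1(\rho,\alpha)$. Modules: $\Lambda^2_8=\sigma_+(\Lambda^1)$, $\Lambda^2_{20}=\{\omega\in\Lambda^2\mid\omega\wedge\ast\rho=0\}$,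 $\Lambda^3_8=\{\ast(\omega\wedge\rho)\mid\omega\in\Lambda^2_8\}$, $\Lambda^3_{20}=\sigma_+(\Lambda^2_{20})$, $\Lambda^3_{27}=\{T\in\Lambda^3\mid T\wedge\rho=0,\ T\wedge\ast\rho=0\}$, $\Lambda^4_8=\sigma_+(\Lambda^3_8)$, $\Lambda^4_{27}=\sigma_+(\Lambda^3_{27})$. With $\mathfrak{so}(8)=\Lambda^2$ one has $\mathfrak{psu}(3)=\Lambda^2_8$; let $\mathfrak m=\Lambda^2_{20}$ be its orthogonal complement and $\mathrm{pr}_{\mathfrak m}$ the projection. Maps: $\Phi_1(X\otimes\omega)=X\wedge\omega$ and $\Phi_2(X\otimes\omega)=(X\lrcorner\rho)\wedge\omega$ on $\mathbb{R}^8\otimes\mathfrak m$; $\Theta_1(T)=-\frac12\sum_i e_i\otimes\mathrm{pr}_{\mathfrak m}(e_i\lrcorner T)$ for $T\in\Lambda^3$; $\Theta_2(F)=-\sum_i e_i\otimes\mathrm{pr}_{\mathfrak m}((e_i\lrcorner\rho)\lrcorner F)$ for $F\in\Lambda^4$. Put $\mathcal{W}_1=\Theta_1(\Lambda^3_8)$, $\mathcal{W}_2=\Theta_1(\Lambda^3_{20})$, $\mathcal{W}_3=\Theta_1(\Lambda^3_{27})$, $\mathcal{W}_4=\Theta_2(\ast\Lambda^4_8)$, $\mathcal{W}_5=\Theta_2(\ast\Lambda^4_{27})$, $\mathcal{W}_6=\mathrm{Ker}(\Phi_1)\cap\mathrm{Ker}(\Phi_2)$; then $\mathbb{R}^8\otimes\mathfrak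 m=\mathcal{W}_1\oplus\dots\oplus\mathcal{W}_6$. Geometric setting. A $\mathrm{PSU}(3)$-structure $(M^8,g,\rho)$ is an (oriented) Riemannian 8-manifold with a 3-form $\rho$ such that at every point there is an oriented orthonormal frame (an adapted frame) realizing $(\star)$; the operators $\sigma_j,\sigma_+,\ast$, the modules $\Lambda^k_i$ and $\mathfrak m$, the maps $\Phi_1,\Phi_2,\Theta_1,\Theta_2$ and the spaces $\mathcal{W}_1,\dots,\mathcal{W}_6$ are applied pointwise in adapted frames. Let $\Omega^g=(\omega^g_{ij})$, $\omega^g_{ij}=g(\nabla^g e_i,e_j)$, in an adapted frame. The intrinsic torsion is $\Gamma=\mathrm{pr}_{\mathfrak m}(\Omega^g)=\Gamma_1+\dots+\Gamma_6$, $\Gamma_i\in\mathcal{W}_i$. The structure is of type $\mathcal{W}_{i_1}\oplus\dots\oplus\mathcal{W}_{i_j}$ if $\Gamma\in\mathcal{W}_{i_1}\oplus\dots\oplus\mathcal{W}_{i_j}$. The characteristic forms are $T^c\in\Lambda^3_8\oplus\Lambda^3_{20}\oplus\Lambda^3_{27}$ with $\Theta_1(T^c)=\Gamma_1+\Gamma_2+\Gamma_3$ and $F^c\in\ast\Lambda^4_8\oplus\ast\Lambda^4_{27}$ with $\Theta_2(F^c)=\Gamma_4+\Gamma_5$. For a structure of type $\mathcal{W}_1\oplus\dots\oplus\mathcal{W}_5$ the characteristic connection $\nabla^c$ is the metric connection $g(\nabla^c_XY,Z)=g(\nabla^g_XY,Z)+\frac12T^c(X,Y,Z)+((X\lrcorner\rho)\lrcorner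 F^c)(Y,Z)$ (it satisfies $\nabla^c\rho=0$). Its characteristic torsion is $\mathcal{T}^c(X,Y,Z)=g(\nabla^c_XY-\nabla^c_YX-[X,Y],Z)$, and $\mathcal{A}^c(X,Y,Z)=g(\nabla^c_XY,Z)-g(\nabla^g_XY,Z)=\frac12T^c(X,Y,Z)+((X\lrcorner\rho)\lrcorner F^c)(Y,Z)$. *)

theory Defs
  imports "HOL-Analysis.Analysis" "HOL-Library.Set_Algebras"
begin

section \<open>Exterior algebra of Euclidean 8-space\<close>

text \<open>
  The exterior algebra is the Euclidean space of coefficient vectors with respect to the
  orthonormal basis of the products \<open>e\<^sub>I\<close>, where \<open>I\<close> is a set of indices taken in increasing
  order. The index type \<open>8\<close> consists of \<open>0 < 1 < \<dots> < 7\<close> (the numeral \<open>8\<close> denotes \<open>0\<close> there),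
  so \<open>e\<^sub>n\<close> in the numbering \<open>e\<^sub>1, \<dots>, e\<^sub>8\<close> is the basis vector with index \<open>n - 1\<close>.
\<close>

type_synonym form = "(real, 8 set) vec"

definition Lam :: "nat \<Rightarrow> form set" where
  "Lam k = {\<alpha>. \<forall>I. \<alpha> $ I \<noteq> 0 \<longrightarrow> card I = k}"

definition eb :: "nat list \<Rightarrow> form" where
  "eb ns = axis (set (map (\<lambda>n. of_nat (n - 1)) ns)) 1"

definition shuffle_sign :: "8 set \<Rightarrow> 8 set \<Rightarrow> real" where
  "shuffle_sign I J = (- 1) ^ card {(i, j). i \<in> I \<and> j \<in> J \<and> j < i}"

definition wedge :: "form \<Rightarrow> form \<Rightarrow> form" where
  "wedge \<alpha> \<beta> = (\<chi> K. \<Sum>I\<in>Pow K. shuffle_sign I (K - I) * \<alpha> $ I * \<beta> $ (K - I))"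

text \<open>Interior product with the basis vector of index \<open>i\<close>, inserting it into the first slot.\<close>

definition hook :: "8 \<Rightarrow> form \<Rightarrow> form" where
  "hook i \<alpha> = (\<chi> K. if i \<in> K then 0 else shuffle_sign {i} K * \<alpha> $ insert i K)"

definition star :: "form \<Rightarrow> form" where
  "star \<alpha> = (\<chi> K. shuffle_sign (- K) K * \<alpha> $ (- K))"

definition hooks :: "8 set \<Rightarrow> form \<Rightarrow> form" where
  "hooks I \<alpha> = foldr hook (sorted_list_of_set I) \<alpha>"

definition sigma :: "nat \<Rightarrow> form \<Rightarrow> form \<Rightarrow> form" where
  "sigma j \<alpha> \<beta> = (\<Sum>I | card I = j. wedge (hooks I \<alpha>) (hooks I \<beta>))"

text \<open>The value of a 2-form on the basis vectors of index \<open>i\<close> and \<open>j\<close>.\<close>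

definition val2 :: "form \<Rightarrow> 8 \<Rightarrow> 8 \<Rightarrow> real" where
  "val2 \<omega> i j = hook j (hook i \<omega>) $ {}"

section \<open>The model 3-form and its modules\<close>

definition rho0 :: form where
  "rho0 = eb [2,4,6] - eb [2,3,5] - eb [1,4,5] - eb [1,3,6]
     + wedge (eb [1,2] + eb [3,4] - 2 *\<^sub>R eb [5,6]) (eb [7])
     + sqrt 3 *\<^sub>R wedge (eb [1,2] - eb [3,4]) (eb [8])"

definition sigma_plus :: "form \<Rightarrow> form" where
  "sigma_plus \<alpha> = sigma 1 rho0 \<alpha>"

definition Lam2_8 :: "form set" where
  "Lam2_8 = sigma_plus ` Lam 1"

definition Lam2_20 :: "form set" where
  "Lam2_20 = {\<omega> \<in> Lam 2. wedge \<omega> (star rho0) = 0}"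

definition Lam3_8 :: "form set" where
  "Lam3_8 = {star (wedge \<omega> rho0) | \<omega>. \<omega> \<in> Lam2_8}"

definition Lam3_20 :: "form set" where
  "Lam3_20 = sigma_plus ` Lam2_20"

definition Lam3_27 :: "form set" where
  "Lam3_27 = {T \<in> Lam 3. wedge T rho0 = 0 \<and> wedge T (star rho0) = 0}"

definition Lam4_8 :: "form set" where
  "Lam4_8 = sigma_plus ` Lam3_8"

definition Lam4_27 :: "form set" where
  "Lam4_27 = sigma_plus ` Lam3_27"

text \<open>Orthogonal projection onto \<open>\<mm> = \<Lambda>\<^sup>2\<^sub>2\<^sub>0\<close>.\<close>

definition pr_m :: "form \<Rightarrow> form" where
  "pr_m \<omega> = (THE \<eta>. \<eta> \<in> Lam2_20 \<and> (\<forall>\<zeta>\<in>Lam2_20. orthogonal (\<omega> - \<eta>) \<zeta>))"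

text \<open>An element \<open>\<Sum>\<^sub>i e\<^sub>i \<otimes> \<omega>\<^sub>i\<close> of \<open>\<real>\<^sup>8 \<otimes> \<Lambda>\<^sup>2\<close> is the vector with \<open>i\<close>-th entry \<open>\<omega>\<^sub>i\<close>.\<close>

type_synonym tform = "(form, 8) vec"

definition R8_m :: "tform set" where
  "R8_m = {\<Gamma>. \<forall>i. \<Gamma> $ i \<in> Lam2_20}"

definition Phi1 :: "tform \<Rightarrow> form" where
  "Phi1 \<Gamma> = (\<Sum>i\<in>UNIV. wedge (axis {i} 1) (\<Gamma> $ i))"

definition Phi2 :: "tform \<Rightarrow> form" where
  "Phi2 \<Gamma> = (\<Sum>i\<in>UNIV. wedge (hook i rho0) (\<Gamma> $ i))"

definition Theta1 :: "form \<Rightarrow> tform" where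
  "Theta1 T = (\<chi> i. - (1 / 2) *\<^sub>R pr_m (hook i T))"

definition Theta2 :: "form \<Rightarrow> tform" where
  "Theta2 F = (\<chi> i. - pr_m (sigma 2 (hook i rho0) F))"

definition W1 :: "tform set" where "W1 = Theta1 ` Lam3_8"
definition W2 :: "tform set" where "W2 = Theta1 ` Lam3_20"
definition W3 :: "tform set" where "W3 = Theta1 ` Lam3_27"
definition W4 :: "tform set" where "W4 = Theta2 ` star ` Lam4_8"
definition W5 :: "tform set" where "W5 = Theta2 ` star ` Lam4_27"
definition W6 :: "tform set" where "W6 = {\<Gamma> \<in> R8_m. Phi1 \<Gamma> = 0 \<and> Phi2 \<Gamma> = 0}"

section \<open>Oriented smooth 8-manifolds\<close>

text \<open>
  The manifold is the whole type \<open>'m\<close>. A chart is its domain together with its coordinate map,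
  whose values outside the domain are irrelevant.
\<close>

type_synonym 'm chart = "'m set \<times> ('m \<Rightarrow> real ^ 8)"

definition chart_inv :: "'m chart \<Rightarrow> real ^ 8 \<Rightarrow> 'm" where
  "chart_inv c = inv_into (fst c) (snd c)"

text \<open>Continuous differentiability of order \<open>k\<close> on an open set.\<close>

primrec Ck_on :: "nat \<Rightarrow> (real ^ 8 \<Rightarrow> 'b::real_normed_vector) \<Rightarrow> (real ^ 8) set \<Rightarrow> bool" where
  "Ck_on 0 f S \<longleftrightarrow> continuous_on S f"
| "Ck_on (Suc k) f S \<longleftrightarrow>
     f differentiable_on S \<and> (\<forall>v. Ck_on k (\<lambda>x. frechet_derivative f (at x) v) S)"

definition smooth_in ::
    "'m chart \<Rightarrow> 'm set \<Rightarrow> ('m \<Rightarrow> 'b::real_normed_vector) \<Rightarrow> bool" where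
  "smooth_in c V f \<longleftrightarrow> (\<forall>k. Ck_on k (\<lambda>x. f (chart_inv c x)) (snd c ` V))"

text \<open>The derivative of \<open>f\<close> at \<open>p\<close> along the tangent vector with \<open>c\<close>-components \<open>v\<close>.\<close>

definition deriv_in ::
    "'m chart \<Rightarrow> ('m \<Rightarrow> 'b::real_normed_vector) \<Rightarrow> 'm \<Rightarrow> real ^ 8 \<Rightarrow> 'b" where
  "deriv_in c f p v = frechet_derivative (\<lambda>x. f (chart_inv c x)) (at (snd c p)) v"

text \<open>\<open>jac c d p\<close> converts \<open>c\<close>-components of tangent vectors at \<open>p\<close> into \<open>d\<close>-components.\<close>

definition jac :: "'m chart \<Rightarrow> 'm chart \<Rightarrow> 'm \<Rightarrow> real ^ 8 \<Rightarrow> real ^ 8" where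
  "jac c d p v = deriv_in c (snd d) p v"

definition oriented_atlas :: "'m::{t2_space, second_countable_topology} chart set \<Rightarrow> bool" where
  "oriented_atlas A \<longleftrightarrow>
     (\<Union>c\<in>A. fst c) = UNIV \<and>
     (\<forall>c\<in>A. open (fst c) \<and> open (snd c ` fst c) \<and>
        homeomorphism (fst c) (snd c ` fst c) (snd c) (chart_inv c)) \<and>
     (\<forall>c\<in>A. \<forall>d\<in>A. smooth_in c (fst c \<inter> fst d) (snd d) \<and>
        (\<forall>p \<in> fst c \<inter> fst d. det (matrix (jac c d p)) > 0))"

section \<open>Tensor fields and connections\<close>

text \<open>
  A covariant tensor field of degree \<open>k\<close> assigns to every chart \<open>c\<close> and every point of its
  domain a multilinear form on \<open>k\<close>-tuples of tangent vectors, given by their \<open>c\<close>-components.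
\<close>

type_synonym 'm tensor = "'m chart \<Rightarrow> 'm \<Rightarrow> (real ^ 8) list \<Rightarrow> real"

definition tensor_field :: "'m chart set \<Rightarrow> nat \<Rightarrow> 'm tensor \<Rightarrow> bool" where
  "tensor_field A k T \<longleftrightarrow> (\<forall>c\<in>A. \<forall>Xs. length Xs = k \<longrightarrow>
     (\<forall>p\<in>fst c. \<forall>a<k. linear (\<lambda>v. T c p (Xs[a := v]))) \<and>
     smooth_in c (fst c) (\<lambda>p. T c p Xs) \<and>
     (\<forall>d\<in>A. \<forall>p \<in> fst c \<inter> fst d. T c p Xs = T d p (map (jac c d p) Xs)))"

definition differential_form :: "'m chart set \<Rightarrow> nat \<Rightarrow> 'm tensor \<Rightarrow> bool" where
  "differential_form A k T \<longleftrightarrow> tensor_field A k T \<and>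
     (\<forall>c\<in>A. \<forall>p\<in>fst c. \<forall>Xs a b. length Xs = k \<and> a < b \<and> b < k \<longrightarrow>
        T c p (Xs[a := Xs ! b, b := Xs ! a]) = - T c p Xs)"

definition riemannian_metric :: "'m chart set \<Rightarrow> 'm tensor \<Rightarrow> bool" where
  "riemannian_metric A g \<longleftrightarrow> tensor_field A 2 g \<and>
     (\<forall>c\<in>A. \<forall>p\<in>fst c. (\<forall>X Y. g c p [X, Y] = g c p [Y, X]) \<and>
        (\<forall>X. X \<noteq> 0 \<longrightarrow> g c p [X, X] > 0))"

text \<open>
  An affine connection is given by its Christoffel symbols: \<open>D c p X Y\<close> is the derivative at \<open>p\<close>,
  in direction \<open>X\<close>, of the vector field with constant \<open>c\<close>-components \<open>Y\<close>. In a second chart \<open>d\<close>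
  this vector field has the components \<open>jac c d q Y\<close> at \<open>q\<close>, hence the transformation law.
\<close>

type_synonym 'm conn = "'m chart \<Rightarrow> 'm \<Rightarrow> real ^ 8 \<Rightarrow> real ^ 8 \<Rightarrow> real ^ 8"

definition connection :: "'m chart set \<Rightarrow> 'm conn \<Rightarrow> bool" where
  "connection A D \<longleftrightarrow> (\<forall>c\<in>A.
     (\<forall>p\<in>fst c. bilinear (D c p)) \<and>
     (\<forall>X Y. smooth_in c (fst c) (\<lambda>p. D c p X Y)) \<and>
     (\<forall>d\<in>A. \<forall>p \<in> fst c \<inter> fst d. \<forall>X Y.
        jac c d p (D c p X Y) =
          deriv_in c (\<lambda>q. jac c d q Y) p X + D d p (jac c d p X) (jac c d p Y)))"

text \<open>Covariant derivative and Lie bracket of vector fields given by their \<open>c\<close>-components.\<close>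

definition cov :: "'m conn \<Rightarrow> 'm chart \<Rightarrow> ('m \<Rightarrow> real ^ 8) \<Rightarrow> ('m \<Rightarrow> real ^ 8) \<Rightarrow> 'm \<Rightarrow> real ^ 8" where
  "cov D c X Y p = deriv_in c Y p (X p) + D c p (X p) (Y p)"

definition bracket :: "'m chart \<Rightarrow> ('m \<Rightarrow> real ^ 8) \<Rightarrow> ('m \<Rightarrow> real ^ 8) \<Rightarrow> 'm \<Rightarrow> real ^ 8" where
  "bracket c X Y p = deriv_in c Y p (X p) - deriv_in c X p (Y p)"

text \<open>
  The following expressions are tensorial in their vector arguments and are evaluated by
  extending these with constant components in the chart.
\<close>

definition cov_tensor :: "'m conn \<Rightarrow> 'm tensor \<Rightarrow> 'm chart \<Rightarrow> 'm \<Rightarrow> real ^ 8 \<Rightarrow> (real ^ 8) list \<Rightarrow> real" where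
  "cov_tensor D T c p X Ys =
     deriv_in c (\<lambda>q. T c q Ys) p X
     - (\<Sum>a<length Ys. T c p (Ys[a := cov D c (\<lambda>_. X) (\<lambda>_. Ys ! a) p]))"

definition parallel :: "'m chart set \<Rightarrow> 'm conn \<Rightarrow> nat \<Rightarrow> 'm tensor \<Rightarrow> bool" where
  "parallel A D k T \<longleftrightarrow> (\<forall>c\<in>A. \<forall>p\<in>fst c. \<forall>X Ys. length Ys = k \<longrightarrow> cov_tensor D T c p X Ys = 0)"

definition torsion :: "'m conn \<Rightarrow> 'm chart \<Rightarrow> 'm \<Rightarrow> real ^ 8 \<Rightarrow> real ^ 8 \<Rightarrow> real ^ 8" where
  "torsion D c p X Y =
     cov D c (\<lambda>_. X) (\<lambda>_. Y) p - cov D c (\<lambda>_. Y) (\<lambda>_. X) p - bracket c (\<lambda>_. X) (\<lambda>_. Y) p"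

definition torsion_tensor :: "'m tensor \<Rightarrow> 'm conn \<Rightarrow> 'm tensor" where
  "torsion_tensor g D c p Xs = g c p [torsion D c p (Xs ! 0) (Xs ! 1), Xs ! 2]"

definition difference_tensor :: "'m tensor \<Rightarrow> 'm conn \<Rightarrow> 'm conn \<Rightarrow> 'm tensor" where
  "difference_tensor g D D' c p Xs =
     g c p [cov D c (\<lambda>_. Xs ! 0) (\<lambda>_. Xs ! 1) p, Xs ! 2]
     - g c p [cov D' c (\<lambda>_. Xs ! 0) (\<lambda>_. Xs ! 1) p, Xs ! 2]"

definition levi_civita :: "'m chart set \<Rightarrow> 'm tensor \<Rightarrow> 'm conn \<Rightarrow> bool" where
  "levi_civita A g D \<longleftrightarrow> connection A D \<and> parallel A D 2 g \<and>
     (\<forall>c\<in>A. \<forall>p\<in>fst c. \<forall>X Y. torsion D c p X Y = 0)"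

section \<open>\<open>PSU(3)\<close>-structures\<close>

text \<open>
  Components with respect to a frame: the form of the exterior algebra representing an
  alternating multilinear map, and the element of \<open>\<real>\<^sup>8 \<otimes> \<Lambda>\<^sup>2\<close> representing a trilinear map
  that is alternating in its last two arguments.
\<close>

definition frame_form :: "nat \<Rightarrow> (8 \<Rightarrow> real ^ 8) \<Rightarrow> ((real ^ 8) list \<Rightarrow> real) \<Rightarrow> form" where
  "frame_form k e \<alpha> = (\<chi> I. if card I = k then \<alpha> (map e (sorted_list_of_set I)) else 0)"

definition frame_tform :: "(8 \<Rightarrow> real ^ 8) \<Rightarrow> ((real ^ 8) list \<Rightarrow> real) \<Rightarrow> tform" where
  "frame_tform e \<Gamma> = (\<chi> i. frame_form 2 e (\<lambda>Ys. \<Gamma> (e i # Ys)))"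

definition adapted_frame ::
    "'m tensor \<Rightarrow> 'm tensor \<Rightarrow> 'm chart \<Rightarrow> 'm \<Rightarrow> (8 \<Rightarrow> real ^ 8) \<Rightarrow> bool" where
  "adapted_frame g \<rho> c p e \<longleftrightarrow>
     (\<forall>i j. g c p [e i, e j] = (if i = j then 1 else 0)) \<and>
     det (\<chi> r s. e s $ r) > 0 \<and>
     frame_form 3 e (\<rho> c p) = rho0"

definition psu3_structure ::
    "'m::{t2_space, second_countable_topology} chart set \<Rightarrow> 'm tensor \<Rightarrow> 'm tensor \<Rightarrow> bool" where
  "psu3_structure A g \<rho> \<longleftrightarrow>
     oriented_atlas A \<and> riemannian_metric A g \<and> differential_form A 3 \<rho> \<and>
     (\<forall>c\<in>A. \<forall>p\<in>fst c. \<exists>e. adapted_frame g \<rho> c p e)"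

definition adapted_frame_field :: "'m::topological_space tensor \<Rightarrow> 'm tensor \<Rightarrow> 'm chart \<Rightarrow>
    'm set \<Rightarrow> ('m \<Rightarrow> 8 \<Rightarrow> real ^ 8) \<Rightarrow> bool" where
  "adapted_frame_field g \<rho> c V e \<longleftrightarrow>
     open V \<and> V \<subseteq> fst c \<and> (\<forall>i. smooth_in c V (\<lambda>q. e q i)) \<and>
     (\<forall>q\<in>V. adapted_frame g \<rho> c q (e q))"

text \<open>
  The value of the connection form \<open>(\<omega>\<^sub>i\<^sub>j)\<close>, \<open>\<omega>\<^sub>i\<^sub>j = g(D e\<^sub>i, e\<^sub>j)\<close>, on \<open>e\<^sub>k\<close>, as a 2-form.
\<close>

definition connection_form ::
    "'m tensor \<Rightarrow> 'm conn \<Rightarrow> 'm chart \<Rightarrow> ('m \<Rightarrow> 8 \<Rightarrow> real ^ 8) \<Rightarrow> 'm \<Rightarrow> 8 \<Rightarrow> form" where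
  "connection_form g D c e p k =
     (\<Sum>i\<in>UNIV. \<Sum>j\<in>{i<..}. g c p [cov D c (\<lambda>q. e q k) (\<lambda>q. e q i) p, e p j] *\<^sub>R axis {i, j} 1)"

text \<open>
  The intrinsic torsion is regarded as the tensor field \<open>\<Gamma>(X; Y, Z)\<close> on the manifold. Since it
  does not depend on the choice of the adapted frame field near a point, one such frame field
  suffices to determine it there.
\<close>

definition intrinsic_torsion :: "'m::topological_space chart set \<Rightarrow> 'm tensor \<Rightarrow> 'm tensor \<Rightarrow>
    'm conn \<Rightarrow> 'm tensor \<Rightarrow> bool" where
  "intrinsic_torsion A g \<rho> Dg \<Gamma> \<longleftrightarrow> tensor_field A 3 \<Gamma> \<and>
     (\<forall>c\<in>A. \<forall>p\<in>fst c. \<exists>V e. p \<in> V \<and> adapted_frame_field g \<rho> c V e \<and>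
        (\<forall>k i j. \<Gamma> c p [e p k, e p i, e p j] = val2 (pr_m (connection_form g Dg c e p k)) i j))"

definition of_type :: "'m chart set \<Rightarrow> 'm tensor \<Rightarrow> 'm tensor \<Rightarrow> 'm tensor \<Rightarrow> tform set \<Rightarrow> bool" where
  "of_type A g \<rho> \<Gamma> W \<longleftrightarrow> (\<forall>c\<in>A. \<forall>p\<in>fst c. \<forall>e.
     adapted_frame g \<rho> c p e \<longrightarrow> frame_tform e (\<Gamma> c p) \<in> W)"

definition characteristic_forms :: "'m chart set \<Rightarrow> 'm tensor \<Rightarrow> 'm tensor \<Rightarrow> 'm tensor \<Rightarrow>
    'm tensor \<Rightarrow> 'm tensor \<Rightarrow> bool" where
  "characteristic_forms A g \<rho> \<Gamma> T F \<longleftrightarrow>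
     differential_form A 3 T \<and> differential_form A 4 F \<and>
     (\<forall>c\<in>A. \<forall>p\<in>fst c. \<forall>e. adapted_frame g \<rho> c p e \<longrightarrow>
        frame_form 3 e (T c p) \<in> Lam3_8 + Lam3_20 + Lam3_27 \<and>
        frame_form 4 e (F c p) \<in> star ` Lam4_8 + star ` Lam4_27 \<and>
        (\<exists>\<Gamma>1\<in>W1. \<exists>\<Gamma>2\<in>W2. \<exists>\<Gamma>3\<in>W3. \<exists>\<Gamma>4\<in>W4. \<exists>\<Gamma>5\<in>W5. \<exists>\<Gamma>6\<in>W6.
           frame_tform e (\<Gamma> c p) = \<Gamma>1 + \<Gamma>2 + \<Gamma>3 + \<Gamma>4 + \<Gamma>5 + \<Gamma>6 \<and>
           Theta1 (frame_form 3 e (T c p)) = \<Gamma>1 + \<Gamma>2 + \<Gamma>3 \<and>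
           Theta2 (frame_form 4 e (F c p)) = \<Gamma>4 + \<Gamma>5))"

text \<open>
  By trilinearity it is enough to prescribe \<open>g(D\<^sup>c\<^sub>X Y, Z) - g(D\<^sup>g\<^sub>X Y, Z)\<close> on adapted frames; as
  \<open>g\<close> is nondegenerate, this determines the connection.
\<close>

definition characteristic_connection :: "'m chart set \<Rightarrow> 'm tensor \<Rightarrow> 'm tensor \<Rightarrow> 'm conn \<Rightarrow>
    'm tensor \<Rightarrow> 'm tensor \<Rightarrow> 'm conn \<Rightarrow> bool" where
  "characteristic_connection A g \<rho> Dg T F Dc \<longleftrightarrow> connection A Dc \<and>
     (\<forall>c\<in>A. \<forall>p\<in>fst c. \<forall>e. adapted_frame g \<rho> c p e \<longrightarrow> (\<forall>i j k.
        difference_tensor g Dc Dg c p [e i, e j, e k] =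
          1 / 2 * T c p [e i, e j, e k]
          + val2 (sigma 2 (hook i rho0) (frame_form 4 e (F c p))) j k))"

end

theory Submission
  imports Defs
begin

text \<open>
  In an adapted frame \<open>rho0\<close> consists of the structure constants \<open>r\<^sub>i\<^sub>j\<^sub>k\<close> of \<open>su(3)\<close>, and the
  difference tensor is \<open>\<A>\<^sub>i\<^sub>j\<^sub>k = 1/2 T\<^sub>i\<^sub>j\<^sub>k + 1/2 \<Sum>\<^sub>a\<^sub>b r\<^sub>i\<^sub>a\<^sub>b F\<^sub>a\<^sub>b\<^sub>j\<^sub>k\<close>. It is skew in its last
  two slots and hence determined by the torsion. Up to a factor, \<open>sigma_plus\<close> is the
  Chevalley-Eilenberg differential; so \<open>F\<close>, which has values in the image of \<open>star \<circ> sigma_plus\<close>,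
  is coclosed, which says that its contraction with \<open>rho0\<close> has vanishing cyclic sum. Therefore \<open>T\<close>
  is \<open>2/3\<close> of the cyclic sum of \<open>\<A>\<close>. On the other hand \<open>W6\<close> is orthogonal to the other types,
  so the connection form of \<open>Dc\<close> has values in the orthogonal complement of \<open>\<mm>\<close>, which annihilates
  \<open>rho0\<close> by the Jacobi identity. Thus covariant differentiation commutes with contraction with
  \<open>rho0\<close>, and this contraction is injective even on 3-forms.
\<close>

section \<open>The exterior algebra\<close>

text \<open>A form has 256 coefficients, so identities of forms are not expanded: they are derived
  from the operators \<open>ext\<close> and \<open>hook\<close>, which satisfy the canonical
  anticommutation relations, and from the fact that 2-forms commute with everything. Large
  computations in coordinates are confined to the Jacobi identity and to the injectivity of the
  contraction. No group or Lie algebra is constructed; invariance of \<open>rho0\<close> enters only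
  infinitesimally, as an index sum.

  The analytic obstacle is that \<open>cov_tensor\<close> extends vectors with constant components
  in the chart, whereas the algebra is available only in adapted frames, whose components vary. The
  product rule for multilinear maps bridges the two. A frame field on a neighbourhood is required,
  since the formula for the difference tensor has to be differentiated, and in such a frame its
  coefficients are constant.

  The form F has degree 4 but injectivity concerns degree 3: the last argument of the covariant
  derivative of F is kept fixed, and only the remaining slots are contracted.\<close>

lemma shuffle_sign_empty [simp]: "shuffle_sign {} J = 1" "shuffle_sign I {} = 1"
  by (simp_all add: shuffle_sign_def)

lemma shuffle_sign_square [simp]: "shuffle_sign I J * shuffle_sign I J = 1"
  by (simp add: shuffle_sign_def flip: power_add mult_2)

lemma shuffle_sign_square_mult [simp]: "shuffle_sign I J * (shuffle_sign I J * x) = x"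
  by (simp flip: mult.assoc)

lemma shuffle_sign_Un_left:
  assumes "I \<inter> J = {}"
  shows "shuffle_sign (I \<union> J) K = shuffle_sign I K * shuffle_sign J K"
proof -
  have "{(i, j). i \<in> I \<union> J \<and> j \<in> K \<and> j < i}
      = {(i, j). i \<in> I \<and> j \<in> K \<and> j < i} \<union> {(i, j). i \<in> J \<and> j \<in> K \<and> j < i}"
    by auto
  then show ?thesis
    unfolding shuffle_sign_def power_add[symmetric]
    using assms by (subst card_Un_disjoint[symmetric]) auto
qed

lemma shuffle_sign_Un_right:
  assumes "J \<inter> K = {}"
  shows "shuffle_sign I (J \<union> K) = shuffle_sign I J * shuffle_sign I K"
proof -
  have "{(i, j). i \<in> I \<and> j \<in> J \<union> K \<and> j < i}
      = {(i, j). i \<in> I \<and> j \<in> J \<and> j < i} \<union> {(i, j). i \<in> I \<and> j \<in> K \<and> j < i}"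
    by auto
  then show ?thesis
    unfolding shuffle_sign_def power_add[symmetric]
    using assms by (subst card_Un_disjoint[symmetric]) auto
qed

lemma shuffle_sign_insert_left:
  "i \<notin> I \<Longrightarrow> shuffle_sign (insert i I) K = shuffle_sign {i} K * shuffle_sign I K"
  using shuffle_sign_Un_left[of "{i}" I K] by simp

lemma shuffle_sign_insert_right:
  "j \<notin> J \<Longrightarrow> shuffle_sign I (insert j J) = shuffle_sign I {j} * shuffle_sign I J"
  using shuffle_sign_Un_right[of "{j}" J I] by simp

lemma shuffle_sign_swap:
  assumes "i \<noteq> j"
  shows "shuffle_sign {j} {i} = - shuffle_sign {i} {j}"
proof -
  have "{(a, b). a \<in> {i} \<and> b \<in> {j} \<and> b < a} = (if j < i then {(i, j)} else {})" for i j :: 8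
    by auto
  then show ?thesis
    using assms by (auto simp: shuffle_sign_def)
qed

lemma wedge_add_left: "wedge (\<alpha> + \<beta>) \<gamma> = wedge \<alpha> \<gamma> + wedge \<beta> \<gamma>"
  by (simp add: wedge_def vec_eq_iff algebra_simps sum.distrib)

lemma wedge_add_right: "wedge \<gamma> (\<alpha> + \<beta>) = wedge \<gamma> \<alpha> + wedge \<gamma> \<beta>"
  by (simp add: wedge_def vec_eq_iff algebra_simps sum.distrib)

lemma wedge_scaleR_left: "wedge (c *\<^sub>R \<alpha>) \<gamma> = c *\<^sub>R wedge \<alpha> \<gamma>"
  by (simp add: wedge_def vec_eq_iff sum_distrib_left ac_simps)

lemma wedge_scaleR_right: "wedge \<gamma> (c *\<^sub>R \<alpha>) = c *\<^sub>R wedge \<gamma> \<alpha>"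
  by (simp add: wedge_def vec_eq_iff sum_distrib_left ac_simps)

lemma linear_wedge_left: "linear (\<lambda>\<alpha>. wedge \<alpha> \<beta>)"
  by (rule linearI) (simp_all add: wedge_add_left wedge_scaleR_left)

lemma linear_wedge_right: "linear (wedge \<alpha>)"
  by (rule linearI) (simp_all add: wedge_add_right wedge_scaleR_right)

lemma linear_hook: "linear (hook i)"
  by (rule linearI) (simp_all add: hook_def vec_eq_iff algebra_simps)

lemma linear_star: "linear star"
  by (rule linearI) (simp_all add: star_def vec_eq_iff algebra_simps)

lemmas wedge_left_simps =
  wedge_add_left wedge_scaleR_left linear_0[OF linear_wedge_left] linear_diff[OF linear_wedge_left]
  linear_neg[OF linear_wedge_left] linear_sum[OF linear_wedge_left]

lemmas wedge_right_simps =
  wedge_add_right wedge_scaleR_right linear_0[OF linear_wedge_right]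
      linear_diff[OF linear_wedge_right]
  linear_neg[OF linear_wedge_right] linear_sum[OF linear_wedge_right]

lemmas hook_simps =
  linear_add[OF linear_hook] linear_cmul[OF linear_hook] linear_0[OF linear_hook]
  linear_diff[OF linear_hook] linear_neg[OF linear_hook] linear_sum[OF linear_hook]

text \<open>Exterior multiplication by a basis vector, the adjoint of \<open>hook\<close>. These
  operators generate all forms from the unit, so wedge identities reduce to their commutation
  rules.\<close>

definition ext :: "8 \<Rightarrow> form \<Rightarrow> form" where
  "ext a = wedge (axis {a} 1)"

lemma linear_ext: "linear (ext a)"
  by (simp add: ext_def linear_wedge_right)

lemmas ext_simps =
  linear_add[OF linear_ext] linear_cmul[OF linear_ext] linear_0[OF linear_ext]
  linear_diff[OF linear_ext] linear_neg[OF linear_ext] linear_sum[OF linear_ext]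

lemma ext_nth:
  "ext a \<beta> $ K = (if a \<in> K then shuffle_sign {a} (K - {a}) * \<beta> $ (K - {a}) else 0)"
proof -
  have "ext a \<beta> $ K = (\<Sum>I\<in>Pow K. if I = {a} then shuffle_sign {a} (K - {a}) * \<beta> $ (K - {a}) else 0)"
    unfolding ext_def wedge_def vec_lambda_beta by (rule sum.cong) (auto simp: axis_def)
  then show ?thesis by simp
qed

lemma wedge_one_left [simp]: "wedge (axis {} 1) \<beta> = \<beta>"
proof (rule vec_eq_iff[THEN iffD2, rule_format])
  fix K
  have "wedge (axis {} 1) \<beta> $ K = (\<Sum>I\<in>Pow K. if I = {} then \<beta> $ K else 0)"
    unfolding wedge_def vec_lambda_beta by (rule sum.cong) (auto simp: axis_def)
  then show "wedge (axis {} 1) \<beta> $ K = \<beta> $ K" by simp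
qed

lemma ext_axis: "a \<notin> I \<Longrightarrow> ext a (axis I 1) = shuffle_sign {a} I *\<^sub>R axis (insert a I) 1"
  by (auto simp: vec_eq_iff ext_nth axis_def)

lemma form_expansion: "(\<Sum>I\<in>UNIV. \<alpha> $ I *\<^sub>R axis I 1) = (\<alpha> :: form)"
  using basis_expansion[of \<alpha>] by (simp add: scalar_mult_eq_scaleR)

text \<open>Each \<open>axis I 1\<close> arises, up to sign, from \<open>axis {} 1\<close> by
  inserting the indices of \<open>I\<close> one at a time with \<open>ext\<close>. Linear identities
  then need no sums over subsets.\<close>

lemma form_induct [case_names one ext add scaleR]:
  fixes \<alpha> :: form and P :: "form \<Rightarrow> bool"
  assumes one: "P (axis {} 1)" and ext: "\<And>a \<alpha>. P \<alpha> \<Longrightarrow> P (ext a \<alpha>)"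
    and add: "\<And>\<alpha> \<beta>. P \<alpha> \<Longrightarrow> P \<beta> \<Longrightarrow> P (\<alpha> + \<beta>)" and scaleR: "\<And>c \<alpha>. P \<alpha> \<Longrightarrow> P (c *\<^sub>R \<alpha>)"
  shows "P \<alpha>"
proof -
  have basis: "P (axis I 1)" for I :: "8 set"
    using finite[of I]
  proof (induction I rule: finite_induct)
    case (insert a I)
    then have "axis (insert a I) 1 = shuffle_sign {a} I *\<^sub>R ext a (axis I 1)"
      by (simp add: ext_axis)
    with insert show ?case by (metis ext scaleR)
  qed (simp_all add: one)
  have zero: "P 0" using scaleR[OF one, of 0] by simp
  have "P (\<Sum>I\<in>B. \<alpha> $ I *\<^sub>R axis I 1)" if "finite B" for B
    using that by induct (auto intro: add scaleR basis zero)
  then have "P (\<Sum>I\<in>UNIV. \<alpha> $ I *\<^sub>R axis I 1)" by simp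
  then show "P \<alpha>" by (simp add: form_expansion)
qed

text \<open>Removing \<open>a\<close> from the index set of the left factor matches the summands.
  This is associativity for a generator, and \<open>wedge_assoc\<close> follows from it by
  induction.\<close>

lemma ext_wedge: "wedge (ext a \<alpha>) \<beta> = ext a (wedge \<alpha> \<beta>)"
proof (rule vec_eq_iff[THEN iffD2, rule_format])
  fix K
  let ?f = "\<lambda>I. shuffle_sign I (K - I) * ext a \<alpha> $ I * \<beta> $ (K - I)"
  show "wedge (ext a \<alpha>) \<beta> $ K = ext a (wedge \<alpha> \<beta>) $ K"
  proof (cases "a \<in> K")
    case True
    have "wedge (ext a \<alpha>) \<beta> $ K = sum ?f {I \<in> Pow K. a \<in> I}"
      unfolding wedge_def vec_lambda_beta
      by (rule sum.mono_neutral_right) (auto simp: ext_nth)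
    also have "\<dots> = (\<Sum>I\<in>Pow (K - {a}). shuffle_sign {a} (K - {a}) *
        (shuffle_sign I (K - {a} - I) * \<alpha> $ I * \<beta> $ (K - {a} - I)))"
    proof (rule sum.reindex_bij_witness[of _ "insert a" "\<lambda>I. I - {a}"], goal_cases)
      case (4 I) then show ?case using True by auto
    next
      case (5 I)
      define J where "J = I - {a}"
      have I: "I = insert a J" "a \<notin> J" using 5 by (auto simp: J_def)
      \<comment> \<open>The inversions of \<open>a\<close> against \<open>K - {a}\<close> split into
        those with the rest \<open>J\<close> of the left factor and those with the right factor
        \<open>K - I\<close>.\<close>
      have s: "shuffle_sign {a} (K - {a}) = shuffle_sign {a} J * shuffle_sign {a} (K - I)"
      proof -
        have "K - {a} = J \<union> (K - I)" "J \<inter> (K - I) = {}" using 5 I by auto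
        then show ?thesis by (simp add: shuffle_sign_Un_right)
      qed
      have "K - {a} - J = K - I" using I by auto
      then show ?case
        unfolding J_def[symmetric] s
        using I by (simp add: ext_nth shuffle_sign_insert_left[of a J])
    qed auto
    also have "\<dots> = ext a (wedge \<alpha> \<beta>) $ K"
      using True by (simp add: ext_nth wedge_def sum_distrib_left)
    finally show ?thesis .
  next
    case False
    then have "?f I = 0" if "I \<in> Pow K" for I
      using that by (auto simp: ext_nth)
    then have "wedge (ext a \<alpha>) \<beta> $ K = 0"
      unfolding wedge_def vec_lambda_beta by (rule sum.neutral[OF ballI])
    then show ?thesis using False by (simp add: ext_nth)
  qed
qed

lemma wedge_assoc: "wedge (wedge \<alpha> \<beta>) \<gamma> = wedge \<alpha> (wedge \<beta> \<gamma>)"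
  by (induction \<alpha> rule: form_induct)
    (simp_all add: ext_wedge wedge_left_simps ext_simps)

lemma ext_ext: "ext a (ext b \<alpha>) = - ext b (ext a \<alpha>)"
proof (rule vec_eq_iff[THEN iffD2, rule_format])
  fix K
  show "ext a (ext b \<alpha>) $ K = (- ext b (ext a \<alpha>)) $ K"
  proof (cases "a \<noteq> b \<and> a \<in> K \<and> b \<in> K")
    case True
    define L where "L = K - {a} - {b}"
    have L: "K - {b} = insert a L" "K - {a} = insert b L" "K - {b} - {a} = L" "a \<notin> L" "b \<notin> L"
      using True by (auto simp: L_def)
    show ?thesis
      using True L by (simp add: ext_nth shuffle_sign_insert_right[of _ L]
          shuffle_sign_swap[of a b])
  qed (auto simp: ext_nth)
qed

text \<open>The anticommutation relation between contraction and multiplication; the product rule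
  \<open>hook_wedge\<close> and the evaluation of explicit products on basis vectors come from
  it.\<close>

lemma hook_ext: "hook i (ext a \<alpha>) = (if i = a then \<alpha> else 0) - ext a (hook i \<alpha>)"
proof (rule vec_eq_iff[THEN iffD2, rule_format])
  fix K
  show "hook i (ext a \<alpha>) $ K = ((if i = a then \<alpha> else 0) - ext a (hook i \<alpha>)) $ K"
  proof (cases "i = a")
    case True
    then show ?thesis by (auto simp: hook_def ext_nth insert_absorb)
  next
    case False
    show ?thesis
    proof (cases "a \<in> K \<and> i \<notin> K")
      case True
      define L where "L = K - {a}"
      have L: "insert i K - {a} = insert i L" "K = insert a L" "a \<notin> L" "i \<notin> L"
        using False True by (auto simp: L_def)
      then show ?thesis
        using False by (simp add: hook_def ext_nth shuffle_sign_insert_right[of _ L] insert_commute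
            shuffle_sign_swap[of i a])
    qed (use False in \<open>auto simp: hook_def ext_nth\<close>)
  qed
qed

text \<open>The parity automorphism. It replaces the factor (-1)^k in product rules, which thereby
  hold for inhomogeneous forms too.\<close>

definition involute :: "form \<Rightarrow> form" where
  "involute \<alpha> = (\<chi> I. (- 1) ^ card I * \<alpha> $ I)"

lemma linear_involute: "linear involute"
  by (rule linearI) (simp_all add: involute_def vec_eq_iff algebra_simps)

lemmas involute_simps = linear_add[OF linear_involute] linear_cmul[OF linear_involute]

lemma involute_one: "involute (axis {} 1) = axis {} 1"
  by (auto simp: involute_def vec_eq_iff axis_def)

lemma involute_ext: "involute (ext a \<alpha>) = - ext a (involute \<alpha>)"
proof (rule vec_eq_iff[THEN iffD2, rule_format])
  fix K
  show "involute (ext a \<alpha>) $ K = (- ext a (involute \<alpha>)) $ K"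
  proof (cases "a \<in> K")
    case True
    then have "(- 1 :: real) ^ card K = - ((- 1) ^ card (K - {a}))"
      using card_Suc_Diff1[OF finite, of a K] by (metis mult_minus1 power_Suc)
    with True show ?thesis by (simp add: involute_def ext_nth)
  qed (simp add: involute_def ext_nth)
qed

lemma hook_one [simp]: "hook i (axis {} 1) = 0"
  by (auto simp: hook_def vec_eq_iff axis_def)

lemma hook_wedge: "hook i (wedge \<alpha> \<beta>) = wedge (hook i \<alpha>) \<beta> + wedge (involute \<alpha>) (hook i \<beta>)"
proof (induction \<alpha> rule: form_induct)
  case (ext a \<alpha>)
  then show ?case
    by (simp add: ext_wedge hook_ext wedge_left_simps wedge_add_right involute_ext ext_simps)
qed (simp_all add: involute_one wedge_left_simps hook_simps involute_simps algebra_simps)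

lemma wedge_ext: "wedge \<alpha> (ext b \<gamma>) = ext b (wedge (involute \<alpha>) \<gamma>)"
proof (induction \<alpha> rule: form_induct)
  case (ext a \<alpha>)
  then show ?case
    using ext_ext[of a b] by (simp add: ext_wedge involute_ext wedge_left_simps ext_simps)
qed (simp_all add: involute_one ext_simps wedge_left_simps wedge_right_simps involute_simps)

lemma involute_involute [simp]: "involute (involute \<alpha>) = \<alpha>"
  by (simp add: involute_def vec_eq_iff flip: mult.assoc power_add mult_2)

text \<open>Passing two factors changes the parity sign twice; this is why 2-forms commute with all
  forms.\<close>

lemma wedge_ext_ext: "wedge \<alpha> (ext a (ext b \<gamma>)) = ext a (ext b (wedge \<alpha> \<gamma>))"
  by (simp only: wedge_ext involute_involute)

lemma eq_neg_self_imp_0: "x = - x \<Longrightarrow> x = 0" for x :: "'a::real_vector"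
  by (metis add.right_inverse scaleR_2 scaleR_eq_0_iff zero_neq_numeral)

lemma hook_hook: "hook i (hook j \<alpha>) = - hook j (hook i \<alpha>)"
proof (rule vec_eq_iff[THEN iffD2, rule_format])
  fix K
  show "hook i (hook j \<alpha>) $ K = (- hook j (hook i \<alpha>)) $ K"
  proof (cases "i \<noteq> j \<and> i \<notin> K \<and> j \<notin> K")
    case True
    then have "j \<noteq> i" by auto
    with True show ?thesis
      using shuffle_sign_swap[of i j]
      by (simp add: hook_def shuffle_sign_insert_right[of _ K] insert_commute)
  qed (auto simp: hook_def insert_absorb)
qed

lemma hook_hook_same [simp]: "hook i (hook i \<alpha>) = 0"
  by (rule eq_neg_self_imp_0[OF hook_hook])

lemma inner_form: "\<alpha> \<bullet> \<beta> = (\<Sum>K\<in>UNIV. \<alpha> $ K * (\<beta> :: form) $ K)"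
  by (simp add: inner_vec_def)

text \<open>\<open>hook\<close> and \<open>ext\<close> carry the same sign, so the bijection
  \<open>insert i\<close> from index sets without \<open>i\<close> to those with \<open>i\<close>
  matches the two sums.\<close>

lemma hook_inner: "hook i \<alpha> \<bullet> \<beta> = \<alpha> \<bullet> ext i \<beta>"
proof -
  have "hook i \<alpha> \<bullet> \<beta> = (\<Sum>K\<in>{K. i \<notin> K}. shuffle_sign {i} K * \<alpha> $ insert i K * \<beta> $ K)"
    unfolding inner_form by (rule sum.mono_neutral_cong_right) (auto simp: hook_def)
  also have "\<dots> = (\<Sum>L\<in>{L. i \<in> L}. \<alpha> $ L * ext i \<beta> $ L)"
    by (rule sum.reindex_bij_witness[of _ "\<lambda>L. L - {i}" "insert i"])
      (auto simp: ext_nth insert_absorb)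
  also have "\<dots> = \<alpha> \<bullet> ext i \<beta>"
    unfolding inner_form by (rule sum.mono_neutral_left) (auto simp: ext_nth)
  finally show ?thesis .
qed

lemma star_inner: "star \<alpha> \<bullet> \<beta> = wedge \<alpha> \<beta> $ UNIV"
proof -
  have "star \<alpha> \<bullet> \<beta> = (\<Sum>K\<in>UNIV. shuffle_sign (- K) K * \<alpha> $ (- K) * \<beta> $ K)"
    by (simp add: inner_form star_def)
  also have "\<dots> = (\<Sum>K\<in>UNIV. shuffle_sign K (- K) * \<alpha> $ K * \<beta> $ (- K))"
    by (rule sum.reindex_bij_witness[of _ uminus uminus]) auto
  finally show ?thesis by (simp add: wedge_def Compl_eq_Diff_UNIV)
qed

section \<open>The model 3-form\<close>

lemma UNIV_8: "(UNIV :: 8 set) = {0, 1, 2, 3, 4, 5, 6, 7}"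
proof -
  have "card {0, 1, 2, 3, 4, 5, 6, 7 :: 8} = CARD(8)" by simp
  then show ?thesis by (rule card_subset_eq[OF finite subset_UNIV, symmetric])
qed

lemma sum_8: "(\<Sum>i\<in>UNIV. f i) = f (0 :: 8) + f 1 + f 2 + f 3 + f 4 + f 5 + f 6 + f 7"
  unfolding UNIV_8 by (simp add: add.assoc)

text \<open>Comparisons of numerals of type \<open>8\<close> become comparisons of integers modulo
  8, which the simplifier decides.\<close>

lemma less_8:
  "(numeral v :: 8) < numeral w \<longleftrightarrow> (numeral v mod 8 :: int) < numeral w mod 8"
  "(0 :: 8) < numeral w \<longleftrightarrow> 0 < (numeral w mod 8 :: int)"
  "(1 :: 8) < numeral w \<longleftrightarrow> 1 < (numeral w mod 8 :: int)"
  "(0 :: 8) < 1"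
  by (simp_all add: less_bit0_def bit0.Rep_numeral bit0.Rep_0 bit0.Rep_1)

text \<open>The value of the product of the basis vectors with indices \<open>a\<close>,
  \<open>b\<close>, \<open>c\<close> on three coordinate vectors.\<close>

definition det3 :: "8 \<Rightarrow> 8 \<Rightarrow> 8 \<Rightarrow> (8 \<Rightarrow> real) \<Rightarrow> (8 \<Rightarrow> real) \<Rightarrow> (8 \<Rightarrow> real) \<Rightarrow> real" where
  "det3 a b c x y z = x a * (y b * z c - y c * z b) - x b * (y a * z c - y c * z a)
     + x c * (y a * z b - y b * z a)"

text \<open>The model 3-form as a function of coordinate vectors, with indices starting at 0.
  Arbitrary arguments make the Jacobi identity one polynomial identity instead of a check over all
  basis quadruples.\<close>

definition rho_tri :: "(8 \<Rightarrow> real) \<Rightarrow> (8 \<Rightarrow> real) \<Rightarrow> (8 \<Rightarrow> real) \<Rightarrow> real" where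
  "rho_tri x y z = det3 1 3 5 x y z - det3 1 2 4 x y z - det3 0 3 4 x y z - det3 0 2 5 x y z
     + det3 0 1 6 x y z + det3 2 3 6 x y z - 2 * det3 4 5 6 x y z
     + sqrt 3 * (det3 0 1 7 x y z - det3 2 3 7 x y z)"

definition delta :: "8 \<Rightarrow> 8 \<Rightarrow> real" where
  "delta i a = of_bool (a = i)"

lemma delta_id: "delta i i = 1" "i \<noteq> j \<Longrightarrow> delta j i = 0" by (auto simp: delta_def)


lemma rho_tri_jacobi:
  "(\<Sum>m\<in>UNIV. rho_tri x y (delta m) * rho_tri z w (delta m)
     + rho_tri y z (delta m) * rho_tri x w (delta m)
     + rho_tri z x (delta m) * rho_tri y w (delta m)) = 0"
proof -
  \<comment> \<open>In the coordinates \<open>x 0, \<dots>, x 6, u x\<close> the identity has rational coefficients.\<close>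
  define u where "u x = sqrt 3 * x 7" for x :: "8 \<Rightarrow> real"
  have rho_tri_delta:
    "rho_tri x y (delta 0) = - (x 3 * y 4 - x 4 * y 3) - (x 2 * y 5 - x 5 * y 2) +
        (x 1 * y 6 - x 6 * y 1) + (x 1 * u y - u x * y 1)"
    "rho_tri x y (delta 1) = (x 3 * y 5 - x 5 * y 3) - (x 2 * y 4 - x 4 * y 2) +
        (x 6 * y 0 - x 0 * y 6) + (u x * y 0 - x 0 * u y)"
    "rho_tri x y (delta 2) = - (x 4 * y 1 - x 1 * y 4) - (x 5 * y 0 - x 0 * y 5) +
        (x 3 * y 6 - x 6 * y 3) - (x 3 * u y - u x * y 3)"
    "rho_tri x y (delta 3) = (x 5 * y 1 - x 1 * y 5) - (x 4 * y 0 - x 0 * y 4) +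
        (x 6 * y 2 - x 2 * y 6) - (u x * y 2 - x 2 * u y)"
    "rho_tri x y (delta 4) = - (x 1 * y 2 - x 2 * y 1) - (x 0 * y 3 - x 3 * y 0) - 2 *
        (x 5 * y 6 - x 6 * y 5)"
    "rho_tri x y (delta 5) = (x 1 * y 3 - x 3 * y 1) - (x 0 * y 2 - x 2 * y 0) - 2 *
        (x 6 * y 4 - x 4 * y 6)"
    "rho_tri x y (delta 6) = (x 0 * y 1 - x 1 * y 0) + (x 2 * y 3 - x 3 * y 2) - 2 *
        (x 4 * y 5 - x 5 * y 4)"
    "rho_tri x y (delta 7) = sqrt 3 * (x 0 * y 1 - x 1 * y 0 - (x 2 * y 3 - x 3 * y 2))"
    for x y
    by (simp_all add: rho_tri_def det3_def delta_id u_def algebra_simps)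
  \<comment> \<open>Only the component along index 7 keeps a factor \<open>sqrt 3\<close>, and the
    sum contains products of two such components.\<close>
  have sqrt3_mult: "(sqrt 3 * a) * (sqrt 3 * b) = 3 * (a * b)" for a b
    by (simp add: mult.left_commute flip: mult.assoc)
  show ?thesis
    unfolding sum_8 rho_tri_delta sqrt3_mult by algebra
qed

lemma ext_nth_empty [simp]: "ext a \<alpha> $ {} = 0"
  by (simp add: ext_nth)

lemma axis_empty_nth [simp]: "axis {} 1 $ {} = (1 :: real)"
  by (simp add: axis_def)

lemma hook_ext_delta: "hook i (ext a \<alpha>) = delta i a *\<^sub>R \<alpha> - ext a (hook i \<alpha>)"
  by (simp add: hook_ext delta_def)

lemma val3_ext3:
  "hook k (hook j (hook i (ext a (ext b (ext c (axis {} 1)))))) $ {}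
     = det3 a b c (delta i) (delta j) (delta k)"
  by (simp add: hook_ext_delta hook_simps ext_simps det3_def algebra_simps)

lemma shuffle_sign_increasing: "(\<And>i j. i \<in> I \<Longrightarrow> j \<in> J \<Longrightarrow> i \<le> j) \<Longrightarrow> shuffle_sign I J = 1"
proof -
  assume "\<And>i j. i \<in> I \<Longrightarrow> j \<in> J \<Longrightarrow> i \<le> j"
  then have "{(i, j). i \<in> I \<and> j \<in> J \<and> j < i} = {}" by (force simp: not_less[symmetric])
  then show "shuffle_sign I J = 1" by (simp only: shuffle_sign_def card.empty power_0)
qed

lemma axis_ext:
  assumes "a < b" "b < c"
  shows "axis {a} 1 = ext a (axis {} 1)" "axis {a, b} 1 = ext a (ext b (axis {} 1))"
    "axis {a, b, c} 1 = ext a (ext b (ext c (axis {} 1)))"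
proof -
  have "shuffle_sign {a} {b} = 1" "shuffle_sign {b} {c} = 1" "shuffle_sign {a} {b, c} = 1"
    using assms by (auto intro!: shuffle_sign_increasing)
  moreover have "a \<noteq> b" "b \<noteq> c" "a \<noteq> c" using assms by (auto dest: less_asym)
  ultimately show "axis {a} 1 = ext a (axis {} 1)" "axis {a, b} 1 = ext a (ext b (axis {} 1))"
    "axis {a, b, c} 1 = ext a (ext b (ext c (axis {} 1)))"
    by (auto simp: ext_axis)
qed

lemma rho0_ext:
  defines "e \<equiv> \<lambda>a b c. ext a (ext b (ext c (axis {} 1)))"
  shows "rho0 = e 1 3 5 - e 1 2 4 - e 0 3 4 - e 0 2 5 + (e 0 1 6 + e 2 3 6 - 2 *\<^sub>R e 4 5 6)
    + sqrt 3 *\<^sub>R (e 0 1 7 - e 2 3 7)"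
proof -
  have eb2: "eb [1, 2] = ext 0 (ext 1 (axis {} 1))" "eb [3, 4] = ext 2 (ext 3 (axis {} 1))"
    "eb [5, 6] = ext 4 (ext 5 (axis {} 1))"
    using axis_ext(2)[of 0 1 2] axis_ext(2)[of 2 3 4] axis_ext(2)[of 4 5 6]
    by (simp_all add: eb_def less_8)
  have eb1: "eb [7] = ext 6 (axis {} 1)" "eb [8] = ext 7 (axis {} 1)"
    by (simp_all add: eb_def ext_axis)
  have eb3: "eb [2, 4, 6] = e 1 3 5" "eb [2, 3, 5] = e 1 2 4" "eb [1, 4, 5] = e 0 3 4" "eb
      [1, 3, 6] = e 0 2 5"
    using axis_ext(3)[of 1 3 5] axis_ext(3)[of 1 2 4] axis_ext(3)[of 0 3 4] axis_ext(3)[of 0 2 5]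
    by (simp_all add: eb_def e_def less_8)
  show ?thesis
    unfolding rho0_def eb1 eb2 eb3
    by (simp add: e_def wedge_left_simps ext_wedge)
qed

text \<open>Since \<open>hook\<close> fills the first free slot, the innermost one supplies the
  first argument: this is the value of \<open>rho0\<close> on the basis vectors \<open>i\<close>,
  \<open>j\<close>, \<open>k\<close> in this order.\<close>

definition rc :: "8 \<Rightarrow> 8 \<Rightarrow> 8 \<Rightarrow> real" where
  "rc i j k = hook k (hook j (hook i rho0)) $ {}"

lemma rc_eq: "rc i j k = rho_tri (delta i) (delta j) (delta k)"
  unfolding rc_def rho0_ext
  by (simp add: hook_simps val3_ext3 rho_tri_def)

lemma rc_antisym: "rc j i k = - rc i j k" "rc i k j = - rc i j k"
  by (simp_all add: rc_eq rho_tri_def det3_def algebra_simps)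

lemma rc_rotate: "rc j k i = rc i j k"
  using rc_antisym by metis

lemma rc_jacobi:
  "(\<Sum>m\<in>UNIV. rc i j m * rc k l m + rc j k m * rc i l m + rc k i m * rc j l m) = 0"
  unfolding rc_eq by (rule rho_tri_jacobi)

section \<open>Forms of fixed degree and their values on basis vectors\<close>

lemma subspace_Lam: "subspace (Lam k)"
  by (auto simp: subspace_def Lam_def) (metis add.right_neutral)

lemma hook_Lam: "\<alpha> \<in> Lam (Suc k) \<Longrightarrow> hook i \<alpha> \<in> Lam k"
proof -
  assume a: "\<alpha> \<in> Lam (Suc k)"
  have "card K = k" if "hook i \<alpha> $ K \<noteq> 0" for K
  proof -
    from that have "i \<notin> K" "\<alpha> $ insert i K \<noteq> 0" by (auto simp: hook_def split: if_splits)
    with a have "card (insert i K) = Suc k" by (simp add: Lam_def)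
    with \<open>i \<notin> K\<close> show ?thesis by simp
  qed
  then show ?thesis by (simp add: Lam_def)
qed

lemma wedge_Lam: "\<alpha> \<in> Lam k \<Longrightarrow> \<beta> \<in> Lam l \<Longrightarrow> wedge \<alpha> \<beta> \<in> Lam (k + l)"
proof -
  assume a: "\<alpha> \<in> Lam k" "\<beta> \<in> Lam l"
  have "card K = k + l" if K: "wedge \<alpha> \<beta> $ K \<noteq> 0" for K
  proof -
    obtain I where I: "I \<subseteq> K" "\<alpha> $ I \<noteq> 0" "\<beta> $ (K - I) \<noteq> 0"
    proof -
      obtain I where "I \<in> Pow K" "shuffle_sign I (K - I) * \<alpha> $ I * \<beta> $ (K - I) \<noteq> 0"
        using K unfolding wedge_def vec_lambda_beta by (rule sum.not_neutral_contains_not_neutral)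
      then show thesis by (intro that) auto
    qed
    with a have "card I = k" "card (K - I) = l" by (auto simp: Lam_def)
    with I(1) show ?thesis by (metis add.commute card_Diff_subset card_mono finite
        le_add_diff_inverse2)
  qed
  then show ?thesis by (simp add: Lam_def)
qed

lemma axis_Lam: "axis I 1 \<in> Lam (card I)"
  by (auto simp: Lam_def axis_def)

lemma ext_Lam: "\<alpha> \<in> Lam k \<Longrightarrow> ext a \<alpha> \<in> Lam (Suc k)"
  using wedge_Lam[OF axis_Lam[of "{a}"]] by (simp add: ext_def)

lemma rho0_Lam: "rho0 \<in> Lam 3"
proof -
  have "ext a (ext b (ext c (axis {} 1))) \<in> Lam 3" for a b c
    using ext_Lam[OF ext_Lam[OF ext_Lam[OF axis_Lam[of "{}"]]]] by (simp add: numeral_3_eq_3)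
  then show ?thesis
    unfolding rho0_ext
    by (intro subspace_add[OF subspace_Lam] subspace_diff[OF subspace_Lam]
        subspace_scale[OF subspace_Lam])
qed

lemma hook_rho0_Lam: "hook i rho0 \<in> Lam 2"
  using hook_Lam[of rho0 2] rho0_Lam by (simp add: numeral_3_eq_3 numeral_2_eq_2)

lemma Lam_0_eq: "\<alpha> \<in> Lam 0 \<Longrightarrow> \<alpha> = \<alpha> $ {} *\<^sub>R axis {} 1"
  by (auto simp: vec_eq_iff Lam_def axis_def)

lemma wedge_Lam_0: "\<alpha> \<in> Lam 0 \<Longrightarrow> wedge \<alpha> \<beta> = \<alpha> $ {} *\<^sub>R \<beta>"
  by (subst Lam_0_eq) (auto simp: wedge_scaleR_left)

lemma hook_Lam_0: "\<alpha> \<in> Lam 0 \<Longrightarrow> hook i \<alpha> = 0"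
  by (auto simp: hook_def Lam_def vec_eq_iff)

text \<open>A coefficient with nonempty index set \<open>K\<close> is visible, up to sign, in
  \<open>hook i\<close> for any \<open>i\<close> in \<open>K\<close>; positive degree excludes the
  empty set.\<close>

lemma Lam_eq_0I:
  assumes "\<alpha> \<in> Lam (Suc k)" "\<And>i. hook i \<alpha> = 0"
  shows "\<alpha> = 0"
proof (rule vec_eq_iff[THEN iffD2, rule_format])
  fix K
  show "\<alpha> $ K = 0 $ K"
  proof (cases "K = {}")
    case False
    then obtain i where i: "i \<in> K" by auto
    have "hook i \<alpha> $ (K - {i}) = 0" by (simp add: assms)
    with i show ?thesis by (simp add: hook_def insert_absorb shuffle_sign_def)
  qed (use assms(1) in \<open>auto simp: Lam_def\<close>)
qed

lemma val2_nth: "val2 \<alpha> a b = (if a = b then 0 else shuffle_sign {a} {b} * \<alpha> $ {a, b})"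
  by (auto simp: val2_def hook_def)

lemma val2_swap: "val2 \<alpha> b a = - val2 \<alpha> a b"
  by (simp add: val2_def hook_hook[of a b])

lemma linear_val2: "linear (\<lambda>\<alpha>. val2 \<alpha> a b)"
  by (rule linearI) (simp_all add: val2_def hook_simps)

lemma val2_hook_rho0: "val2 (hook i rho0) a b = rc i a b"
  by (simp add: val2_def rc_def)

text \<open>Every two-element set comes from two ordered pairs, hence the factor 1/2. Later
  arguments rename and swap indices, which needs independent summation indices.\<close>

lemma sum_card_2:
  fixes f :: "8 set \<Rightarrow> 'a::real_vector"
  shows "(\<Sum>I | card I = 2. f I) = (1 / 2) *\<^sub>R (\<Sum>a\<in>UNIV. \<Sum>b\<in>UNIV. if a = b then 0 else f {a, b})"
proof -
  let ?g = "\<lambda>p :: 8 \<times> 8. {fst p, snd p}"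
  let ?L = "{p :: 8 \<times> 8. fst p < snd p}" and ?G = "{p :: 8 \<times> 8. snd p < fst p}"
  have "bij_betw ?g ?L {I. card I = 2}"
  proof (rule bij_betw_imageI)
    show "inj_on ?g ?L"
      by (auto simp: inj_on_def doubleton_eq_iff)
    show "?g ` ?L = {I. card I = 2}"
    proof (intro equalityI subsetI)
      fix I :: "8 set" assume "I \<in> {I. card I = 2}"
      then obtain x y where xy: "I = {x, y}" "x \<noteq> y" by (auto simp: card_2_iff)
      show "I \<in> ?g ` ?L"
      proof (cases "x < y")
        case True
        with xy show ?thesis by (intro image_eqI[of _ _ "(x, y)"]) auto
      next
        case False
        with xy show ?thesis by (intro image_eqI[of _ _ "(y, x)"]) auto
      qed
    qed (auto simp: card_insert_if)
  qed
  then have less: "(\<Sum>I | card I = 2. f I) = (\<Sum>p\<in>?L. f (?g p))"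
    by (rule sum.reindex_bij_betw[symmetric])
  also have "\<dots> = (\<Sum>p\<in>?G. f (?g p))"
    by (rule sum.reindex_bij_witness[of _ prod.swap prod.swap]) (auto simp: insert_commute)
  finally have greater: "(\<Sum>I | card I = 2. f I) = (\<Sum>p\<in>?G. f (?g p))" .
  have "(\<Sum>a\<in>UNIV. \<Sum>b\<in>UNIV. if a = b then 0 else f {a, b})
      = (\<Sum>p\<in>UNIV. if fst p = snd p then 0 else f (?g p))"
    by (simp add: sum.cartesian_product case_prod_beta)
  also have "\<dots> = (\<Sum>p\<in>?L \<union> ?G. f (?g p))"
    by (rule sum.mono_neutral_cong_right) auto
  also have "\<dots> = (\<Sum>p\<in>?L. f (?g p)) + (\<Sum>p\<in>?G. f (?g p))"
    by (rule sum.union_disjoint) auto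
  finally show ?thesis
    unfolding less[symmetric] greater[symmetric] by (simp flip: scaleR_2)
qed

lemma form2_expansion:
  assumes "\<alpha> \<in> Lam 2"
  shows "\<alpha> = (1 / 2) *\<^sub>R (\<Sum>a\<in>UNIV. \<Sum>b\<in>UNIV. val2 \<alpha> a b *\<^sub>R ext a (ext b (axis {} 1)))"
proof -
  have "\<alpha> = (\<Sum>I | card I = 2. \<alpha> $ I *\<^sub>R axis I 1)"
    using assms by (subst form_expansion[symmetric], intro sum.mono_neutral_right)
        (auto simp: Lam_def)
  also have "\<dots> = (1 / 2) *\<^sub>R (\<Sum>a\<in>UNIV. \<Sum>b\<in>UNIV. val2 \<alpha> a b *\<^sub>R ext a (ext b (axis {} 1)))"
    unfolding sum_card_2
    by (intro arg_cong[of _ _ "scaleR _"] sum.cong)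
      (auto simp: val2_nth ext_axis ext_simps)
  finally show ?thesis .
qed

lemma wedge_Lam_2:
  assumes "\<alpha> \<in> Lam 2"
  shows "wedge \<alpha> \<beta> = (1 / 2) *\<^sub>R (\<Sum>a\<in>UNIV. \<Sum>b\<in>UNIV. val2 \<alpha> a b *\<^sub>R ext a (ext b \<beta>))"
  by (subst form2_expansion[OF assms]) (simp add: wedge_left_simps ext_wedge)

lemma wedge_one_right [simp]: "wedge \<beta> (axis {} 1) = \<beta>"
  by (induction \<beta> rule: form_induct) (simp_all add: ext_wedge wedge_left_simps)

lemma wedge_commute_Lam_2:
  assumes "\<alpha> \<in> Lam 2"
  shows "wedge \<beta> \<alpha> = wedge \<alpha> \<beta>"
  by (subst form2_expansion[OF assms])
    (simp add: wedge_Lam_2[OF assms] wedge_right_simps wedge_ext_ext)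

lemma involute_Lam_2: "\<alpha> \<in> Lam 2 \<Longrightarrow> involute \<alpha> = \<alpha>"
  by (auto simp: involute_def Lam_def vec_eq_iff)

lemma sigma_2_eq:
  assumes "\<alpha> \<in> Lam 2"
  shows "sigma 2 \<alpha> \<beta> = (1 / 2) *\<^sub>R (\<Sum>a\<in>UNIV. \<Sum>b\<in>UNIV. val2 \<alpha> a b *\<^sub>R hook b (hook a \<beta>))"
proof -
  \<comment> \<open>Reversing the two hooks changes the sign of both factors, so the product is
    independent of the order in which \<open>hooks\<close> applies them.\<close>
  have *: "wedge (hook a (hook b \<alpha>)) (hook a (hook b \<beta>)) = val2 \<alpha> a b *\<^sub>R hook b (hook a \<beta>)" for a b
  proof -
    have "hook a (hook b \<alpha>) \<in> Lam 0"
      using assms by (intro hook_Lam) (simp add: numeral_2_eq_2)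
    then have "wedge (hook a (hook b \<alpha>)) (hook a (hook b \<beta>))
        = hook a (hook b \<alpha>) $ {} *\<^sub>R hook a (hook b \<beta>)"
      by (rule wedge_Lam_0)
    then show ?thesis
      by (simp add: hook_hook[of a b] val2_def)
  qed
  have "wedge (hooks {a, b} \<alpha>) (hooks {a, b} \<beta>) = val2 \<alpha> a b *\<^sub>R hook b (hook a \<beta>)" if "a \<noteq> b" for a
      b
  proof (cases "a < b")
    case True
    then have "sorted_list_of_set {a, b} = [a, b]" by (simp add: less_imp_le less_imp_neq)
    then show ?thesis by (simp add: hooks_def *)
  next
    case False
    with that have "sorted_list_of_set {a, b} = [b, a]" by (auto simp: not_less)
    then show ?thesis by (simp add: hooks_def * hook_hook[of a b] val2_swap[of _ b a])
  qed
  then show ?thesis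
    unfolding sigma_def sum_card_2
    by (intro arg_cong[of _ _ "scaleR _"] sum.cong) (auto simp: val2_nth)
qed

lemma sigma_1_eq: "sigma 1 \<alpha> \<beta> = (\<Sum>i\<in>UNIV. wedge (hook i \<alpha>) (hook i \<beta>))"
proof -
  have "{I :: 8 set. card I = 1} = (\<lambda>i. {i}) ` UNIV" by (auto simp: card_1_singleton_iff)
  then show ?thesis
    by (simp add: sigma_def sum.reindex inj_on_def hooks_def)
qed

lemma sigma_plus_eq: "sigma_plus \<alpha> = (\<Sum>i\<in>UNIV. wedge (hook i rho0) (hook i \<alpha>))"
  by (simp only: sigma_plus_def sigma_1_eq)

lemma linear_sigma_plus: "linear sigma_plus"
  by (rule linearI) (simp_all add: sigma_plus_eq hook_simps wedge_right_simps sum.distrib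
      scaleR_sum_right)

text \<open>Termwise adjointness of \<open>hook\<close> and \<open>ext\<close>. It shifts
  \<open>rho0\<close> from F to the test form, where \<open>sigma_plus\<close> appears.\<close>

lemma sigma_2_inner:
  assumes "\<alpha> \<in> Lam 2"
  shows "sigma 2 \<alpha> \<beta> \<bullet> \<gamma> = \<beta> \<bullet> wedge \<alpha> \<gamma>"
  by (simp add: sigma_2_eq[OF assms] wedge_Lam_2[OF assms] inner_sum_left inner_sum_right
      hook_inner)

lemma val2_inner: "val2 \<alpha> a b = \<alpha> \<bullet> ext a (ext b (axis {} 1))"
proof -
  have "val2 \<alpha> a b = hook b (hook a \<alpha>) \<bullet> axis {} 1" by (simp add: val2_def inner_axis)
  then show ?thesis by (simp add: hook_inner)
qed

section \<open>The differential of \<open>su(3)\<close> and the module \<open>\<mm>\<close>\<close>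

lemma involute_hook: "involute (hook i \<alpha>) = - hook i (involute \<alpha>)"
  by (auto simp: involute_def hook_def vec_eq_iff)

lemma wedge_nth_empty [simp]: "wedge \<alpha> \<beta> $ {} = \<alpha> $ {} * \<beta> $ {}"
  by (simp add: wedge_def)

text \<open>By degree, three hooks kill \<alpha> and two kill \<beta>; what
  \<open>hook_wedge\<close> leaves are the three choices of the argument that goes to
  \<beta>.\<close>

lemma val3_wedge_2_1:
  assumes "\<alpha> \<in> Lam 2" "\<beta> \<in> Lam 1"
  shows "hook c (hook b (hook a (wedge \<alpha> \<beta>))) $ {}
    = val2 \<alpha> a b * hook c \<beta> $ {} - val2 \<alpha> a c * hook b \<beta> $ {} + val2 \<alpha> b c * hook a \<beta> $ {}"
proof -
  have "hook i (hook j \<alpha>) \<in> Lam 0" for i j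
    using assms(1) by (intro hook_Lam) (simp add: numeral_2_eq_2)
  then have \<alpha>: "hook k (hook i (hook j \<alpha>)) = 0" for i j k
    by (rule hook_Lam_0)
  have "hook i \<beta> \<in> Lam 0" for i
    using assms(2) by (intro hook_Lam) simp
  then have \<beta>: "hook j (hook i \<beta>) = 0" for i j
    by (rule hook_Lam_0)
  show ?thesis
    using assms(1)
    by (simp add: hook_wedge involute_hook involute_Lam_2 \<alpha> \<beta> hook_simps wedge_left_simps
        wedge_right_simps val2_def)
qed

text \<open>Up to a factor, \<open>sigma_plus\<close> is the Chevalley-Eilenberg differential of \<open>su(3)\<close>, whose
  square vanishes by the Jacobi identity.\<close>

lemma sigma_plus_hook_rho0: "sigma_plus (hook j rho0) = 0"
proof -
  have 1: "hook m (hook j rho0) \<in> Lam 1" for m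
    using hook_Lam[of _ 1] hook_rho0_Lam by (simp add: numeral_2_eq_2)
  \<comment> \<open>As \<open>hook j rho0\<close> is \<open>sigma_plus\<close> of the basis vector
    \<open>j\<close>, this is the square of the differential on a generator; its values on basis
    triples are Jacobi sums.\<close>
  have val3: "hook c (hook b (hook a (sigma_plus (hook j rho0)))) $ {} = 0" for a b c
  proof -
    have "hook c (hook b (hook a (sigma_plus (hook j rho0)))) $ {}
        = (\<Sum>m\<in>UNIV. rc m a b * rc j m c - rc m a c * rc j m b + rc m b c * rc j m a)"
      by (simp add: sigma_plus_eq hook_simps val3_wedge_2_1[OF hook_rho0_Lam 1] val2_hook_rho0
          flip: rc_def)
    also have "\<dots> = (\<Sum>m\<in>UNIV. rc a b m * rc c j m + rc b c m * rc a j m + rc c a m * rc b j m)"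
    proof (intro sum.cong refl)
      fix m
      show "rc m a b * rc j m c - rc m a c * rc j m b + rc m b c * rc j m a
          = rc a b m * rc c j m + rc b c m * rc a j m + rc c a m * rc b j m"
        using rc_rotate[of a b m] rc_rotate[of b c m] rc_rotate[of c a m] rc_antisym(2)[of m c a]
          rc_rotate[of c j m] rc_rotate[of a j m] rc_rotate[of b j m]
          rc_rotate[of m c j] rc_rotate[of m a j] rc_rotate[of m b j] by simp
    qed
    finally show ?thesis by (simp add: rc_jacobi)
  qed
  have 3: "sigma_plus (hook j rho0) \<in> Lam 3"
    unfolding sigma_plus_eq
    using wedge_Lam[OF hook_rho0_Lam 1] by (intro subspace_sum[OF subspace_Lam]) simp
  \<comment> \<open>From the values back to the form: \<open>Lam_eq_0I\<close> removes one hook at a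
    time.\<close>
  have "hook b (hook a (sigma_plus (hook j rho0))) = 0" for a b
  proof (rule Lam_eq_0I)
    show "hook b (hook a (sigma_plus (hook j rho0))) \<in> Lam (Suc 0)"
      using 3 by (intro hook_Lam) (simp add: numeral_3_eq_3)
    then show "hook c (hook b (hook a (sigma_plus (hook j rho0)))) = 0" for c
      using Lam_0_eq hook_Lam val3 by (metis scaleR_zero_left)
  qed
  moreover have "hook a (sigma_plus (hook j rho0)) \<in> Lam (Suc 1)" for a
    using 3 by (intro hook_Lam) (simp add: numeral_3_eq_3)
  ultimately have "hook a (sigma_plus (hook j rho0)) = 0" for a
    by (rule Lam_eq_0I[rotated])
  with 3 show ?thesis
    by (intro Lam_eq_0I[of "sigma_plus _" 2]) (simp_all add: numeral_3_eq_3 numeral_2_eq_2)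
qed

text \<open>The outer contraction hits either the coefficient 2-form or the inner contraction of
  \<alpha>. The first terms combine to \<open>sigma_plus (hook j rho0)\<close>; the second are
  antisymmetric in the two indices, because hooks anticommute while 2-forms commute.\<close>

lemma sigma_plus_sigma_plus: "sigma_plus (sigma_plus \<alpha>) = 0"
proof -
  let ?h = "\<lambda>i. hook i rho0"
  have "sigma_plus (sigma_plus \<alpha>)
      = (\<Sum>i\<in>UNIV. \<Sum>j\<in>UNIV. wedge (?h i) (wedge (hook i (?h j)) (hook j \<alpha>))
          + wedge (?h i) (wedge (?h j) (hook i (hook j \<alpha>))))"
    by (simp add: sigma_plus_eq hook_simps hook_wedge involute_Lam_2[OF hook_rho0_Lam]
        wedge_right_simps sum.distrib)
  also have "\<dots> = (\<Sum>j\<in>UNIV. wedge (sigma_plus (?h j)) (hook j \<alpha>))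
      + (\<Sum>i\<in>UNIV. \<Sum>j\<in>UNIV. wedge (?h i) (wedge (?h j) (hook i (hook j \<alpha>))))"
    unfolding sum.distrib
    by (subst sum.swap) (simp add: sigma_plus_eq[of "?h _"] wedge_left_simps wedge_assoc)
  also have "(\<Sum>i\<in>UNIV. \<Sum>j\<in>UNIV. wedge (?h i) (wedge (?h j) (hook i (hook j \<alpha>)))) = 0"
    (is "?S = 0")
  proof (rule eq_neg_self_imp_0)
    have "?S = (\<Sum>i\<in>UNIV. \<Sum>j\<in>UNIV. wedge (?h j) (wedge (?h i) (hook j (hook i \<alpha>))))"
      by (rule sum.swap)
    also have "\<dots> = (\<Sum>i\<in>UNIV. \<Sum>j\<in>UNIV. - wedge (?h i) (wedge (?h j) (hook i (hook j \<alpha>))))"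
    proof (intro sum.cong refl)
      fix i j
      show "wedge (?h j) (wedge (?h i) (hook j (hook i \<alpha>)))
          = - wedge (?h i) (wedge (?h j) (hook i (hook j \<alpha>)))"
        unfolding hook_hook[of j i \<alpha>] wedge_right_simps wedge_assoc[symmetric]
          wedge_commute_Lam_2[OF hook_rho0_Lam, of "?h j"] ..
    qed
    finally show "?S = - ?S" by (simp add: sum_negf)
  qed
  finally show ?thesis by (simp add: sigma_plus_hook_rho0 wedge_left_simps)
qed

text \<open>Since \<open>hook i\<close> squares to zero, each summand is itself
  \<open>hook i\<close> of a form and has no top-degree coefficient. In Lie algebra terms this is
  unimodularity.\<close>

lemma sigma_plus_nth_UNIV: "sigma_plus \<alpha> $ UNIV = 0"
proof -
  have "wedge (hook i rho0) (hook i \<alpha>) = hook i (wedge (hook i rho0) \<alpha>)" for i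
    by (simp add: hook_wedge involute_Lam_2[OF hook_rho0_Lam] wedge_left_simps)
  then show ?thesis by (simp add: sigma_plus_eq hook_def)
qed

text \<open>Each \<open>hook i\<close> is an antiderivation, and the 2-form in front of it can be
  moved past \<alpha> without a sign.\<close>

lemma sigma_plus_wedge:
  "sigma_plus (wedge \<alpha> \<beta>) = wedge (sigma_plus \<alpha>) \<beta> + wedge (involute \<alpha>) (sigma_plus \<beta>)"
proof -
  have "wedge (hook i rho0) (wedge (involute \<alpha>) (hook i \<beta>))
      = wedge (involute \<alpha>) (wedge (hook i rho0) (hook i \<beta>))" for i
    unfolding wedge_assoc[symmetric] wedge_commute_Lam_2[OF hook_rho0_Lam, where \<beta> = "involute \<alpha>"]
        ..
  then show ?thesis
    by (simp add: sigma_plus_eq hook_wedge wedge_left_simps wedge_right_simps sum.distrib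
        wedge_assoc)
qed

text \<open>The image of \<open>star \<circ> sigma_plus\<close> consists of coclosed forms.\<close>

lemma star_sigma_plus_inner: "star (sigma_plus \<alpha>) \<bullet> sigma_plus \<beta> = 0"
proof -
  \<comment> \<open>An algebraic Stokes theorem: a product of exact forms is exact, and exact forms
    have no top-degree coefficient.\<close>
  have "wedge (sigma_plus \<alpha>) (sigma_plus \<beta>) = sigma_plus (wedge \<alpha> (sigma_plus \<beta>))"
    by (simp add: sigma_plus_wedge sigma_plus_sigma_plus wedge_right_simps)
  then show ?thesis by (simp add: star_inner sigma_plus_nth_UNIV)
qed

text \<open>The product rule on a decomposable form. Writing the middle term with \<open>k\<close>
  before \<open>i\<close> absorbs its sign and yields the cyclic sum used in
  \<open>cyclic_contraction\<close>.\<close>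

lemma sigma_plus_ext3:
  "sigma_plus (ext i (ext j (ext k (axis {} 1)))) = wedge (hook i rho0) (ext j (ext k (axis {} 1)))
     + wedge (hook j rho0) (ext k (ext i (axis {} 1))) + wedge (hook k rho0)
         (ext i (ext j (axis {} 1)))"
proof -
  have *: "(\<Sum>m\<in>UNIV. wedge (hook m rho0) (delta m i *\<^sub>R \<beta>)) = wedge (hook i rho0) \<beta>" for i \<beta>
  proof -
    have "wedge (hook m rho0) (delta m i *\<^sub>R \<beta>) = (if m = i then wedge (hook i rho0) \<beta> else 0)" for m
      by (auto simp: delta_def wedge_right_simps)
    then show ?thesis by simp
  qed
  show ?thesis
    by (simp add: sigma_plus_eq hook_ext_delta ext_simps wedge_right_simps sum.distrib sum_subtractf
        flip: wedge_right_simps(2))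
      (simp add: * ext_simps ext_ext[of i k] linear_neg[OF linear_wedge_right] sum_negf flip:
          wedge_right_simps(2))
qed

text \<open>By adjointness each summand pairs \<phi> with a wedge product of
  \<open>hook _ rho0\<close> and two basis vectors. Together these form the differential of a
  decomposable 3-form, to which \<phi> is orthogonal.\<close>

lemma cyclic_contraction:
  assumes "\<phi> = star (sigma_plus \<tau>)"
  shows "val2 (sigma 2 (hook i rho0) \<phi>) j k + val2 (sigma 2 (hook j rho0) \<phi>) k i
    + val2 (sigma 2 (hook k rho0) \<phi>) i j = 0"
proof -
  have "val2 (sigma 2 (hook i rho0) \<phi>) j k + val2 (sigma 2 (hook j rho0) \<phi>) k i
    + val2 (sigma 2 (hook k rho0) \<phi>) i j = \<phi> \<bullet> sigma_plus (ext i (ext j (ext k (axis {} 1))))"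
    by (simp add: val2_inner sigma_2_inner[OF hook_rho0_Lam] sigma_plus_ext3 inner_add_right)
  then show ?thesis by (simp add: assms star_sigma_plus_inner)
qed

text \<open>Up to sign, the coefficient of the 7-form at \<open>- {i}\<close> is the inner product
  of \<open>v\<close> with \<open>hook i rho0\<close>. This translates the equation that defines
  \<open>Lam2_20\<close> into orthogonality.\<close>

lemma wedge_star_rho0:
  assumes v: "v \<in> Lam 2" and orth: "\<And>i. v \<bullet> hook i rho0 = 0"
  shows "wedge v (star rho0) = 0"
proof (rule vec_eq_iff[THEN iffD2, rule_format])
  fix K
  show "wedge v (star rho0) $ K = 0 $ K"
  proof (cases "\<exists>i. K = - {i}")
    case True
    then obtain i where K: "K = - {i}" by blast
    have "shuffle_sign I (K - I) * v $ I * star rho0 $ (K - I)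
        = shuffle_sign {i} K * (v $ I * hook i rho0 $ I)" if "I \<in> Pow K" for I
    proof -
      have i: "i \<notin> I" and *: "- (K - I) = insert i I" and J: "K = I \<union> (K - I)" "I \<inter> (K - I) = {}"
        using that K by auto
      have "shuffle_sign {i} K = shuffle_sign {i} I * shuffle_sign {i} (K - I)"
        by (subst J(1), rule shuffle_sign_Un_right[OF J(2)])
      moreover have "star rho0 $ (K - I) = shuffle_sign (insert i I) (K - I) * rho0 $ insert i I"
        by (simp only: star_def vec_lambda_beta *)
      ultimately show ?thesis
        using i by (simp add: hook_def shuffle_sign_insert_left[of i I])
    qed
    then have "wedge v (star rho0) $ K = (\<Sum>I\<in>Pow K. shuffle_sign {i} K * (v $ I * hook i rho0 $ I))"
      unfolding wedge_def vec_lambda_beta by (rule sum.cong[OF refl])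
    also have "\<dots> = (\<Sum>I\<in>UNIV. shuffle_sign {i} K * (v $ I * hook i rho0 $ I))"
      by (rule sum.mono_neutral_left) (auto simp: K hook_def)
    also have "\<dots> = shuffle_sign {i} K * (v \<bullet> hook i rho0)"
      by (simp only: inner_form sum_distrib_left)
    finally show ?thesis by (simp add: orth)
  next
    case False
    have "shuffle_sign I (K - I) * v $ I * star rho0 $ (K - I) = 0" if "I \<in> Pow K" for I
    proof (rule ccontr)
      assume "\<not> ?thesis"
      then have "v $ I \<noteq> 0" "rho0 $ (- (K - I)) \<noteq> 0" by (auto simp: star_def)
      \<comment> \<open>A nonzero summand would have factors of degrees 2 and 3, which forces
        \<open>K\<close> to miss exactly one index.\<close>
      with v rho0_Lam have "card I = 2" "card (- (K - I)) = 3" by (auto simp: Lam_def)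
      moreover have "- (K - I) = - K \<union> I" "- K \<inter> I = {}" using that by auto
      ultimately have "card (- K) = 1" by (simp add: card_Un_disjoint)
      then obtain i where "- K = {i}" by (auto simp: card_1_singleton_iff)
      then have "K = - {i}" by auto
      with False show False by blast
    qed
    then show ?thesis
      unfolding wedge_def vec_lambda_beta zero_index by (rule sum.neutral[OF ballI])
  qed
qed

lemma subspace_Lam2_20: "subspace Lam2_20"
  using subspace_Lam[of 2] by (auto simp: subspace_def Lam2_20_def wedge_left_simps)

text \<open>The component \<open>v\<close> of \<open>W\<close> orthogonal to the span lies in
  \<open>Lam2_20\<close>, hence is orthogonal to \<open>W\<close> and to \<open>u\<close>, and so to
  itself. No dimension count is involved.\<close>

lemma orthogonal_Lam2_20:
  assumes W: "W \<in> Lam 2" and orth: "\<And>\<zeta>. \<zeta> \<in> Lam2_20 \<Longrightarrow> orthogonal W \<zeta>"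
  shows "W \<in> span (range (\<lambda>i. hook i rho0))" (is "_ \<in> span ?U")
proof -
  obtain u v where uv: "u \<in> span ?U" "\<And>w. w \<in> span ?U \<Longrightarrow> orthogonal v w" "W = u + v"
    using orthogonal_subspace_decomp_exists[of ?U W] by blast
  have "span ?U \<subseteq> Lam 2"
    using hook_rho0_Lam by (intro span_minimal subspace_Lam) auto
  with uv(1) have "u \<in> Lam 2" by blast
  moreover have "v = W - u" using uv(3) by simp
  ultimately have "v \<in> Lam 2"
    using W subspace_diff[OF subspace_Lam] by blast
  moreover have "v \<bullet> hook i rho0 = 0" for i
    using uv(2)[of "hook i rho0"] by (simp add: span_base orthogonal_def)
  ultimately have "v \<in> Lam2_20"
    by (simp add: Lam2_20_def wedge_star_rho0)
  then have "W \<bullet> v = 0" using orth by (simp add: orthogonal_def)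
  with uv(2)[OF uv(1)] have "v \<bullet> v = 0"
    by (simp add: uv(3) inner_add_left inner_add_right orthogonal_def inner_commute)
  with uv show ?thesis by simp
qed

text \<open>The sum is the derivation action of \<open>W\<close> on the three slots of
  \<open>rho0\<close>. It is linear in \<open>W\<close>, and on a generator
  \<open>hook n rho0\<close>, an inner derivation of the bracket, it is a Jacobi sum.\<close>

lemma rho0_invariant:
  assumes "W \<in> span (range (\<lambda>i. hook i rho0))"
  shows "(\<Sum>m\<in>UNIV. val2 W i m * rc m a b + val2 W a m * rc i m b + val2 W b m * rc i a m) = 0"
    (is "?f W = 0")
proof (rule linear_eq_0_on_span[OF _ _ assms, of ?f])
  show "linear ?f"
    by (rule linearI) (simp_all add: linear_add[OF linear_val2] linear_cmul[OF linear_val2]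
        sum.distrib sum_distrib_left algebra_simps)
next
  fix W assume "W \<in> range (\<lambda>i. hook i rho0)"
  then obtain n where W: "W = hook n rho0" by blast
  have "?f W = (\<Sum>m\<in>UNIV. - (rc i a m * rc b n m + rc a b m * rc i n m + rc b i m * rc a n m))"
    unfolding W val2_hook_rho0
    by (intro sum.cong refl) (simp add: rc_antisym(1)[of n] rc_rotate[of b i] rc_rotate[of a b]
        rc_rotate[of _ b i])
  then show "?f W = 0" by (simp only: sum_negf rc_jacobi minus_zero)
qed

text \<open>The description in \<open>pr_m\<close> is definite because two candidates differ by an
  element of \<open>Lam2_20\<close> that is orthogonal to \<open>Lam2_20\<close>.\<close>

lemma pr_m_eqI:
  assumes "\<eta> \<in> Lam2_20" "\<And>\<zeta>. \<zeta> \<in> Lam2_20 \<Longrightarrow> (\<omega> - \<eta>) \<bullet> \<zeta> = 0"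
  shows "pr_m \<omega> = \<eta>"
  unfolding pr_m_def
proof (rule the_equality)
  show "\<eta> \<in> Lam2_20 \<and> (\<forall>\<zeta>\<in>Lam2_20. orthogonal (\<omega> - \<eta>) \<zeta>)"
    using assms by (simp add: orthogonal_def)
next
  fix \<theta> assume \<theta>: "\<theta> \<in> Lam2_20 \<and> (\<forall>\<zeta>\<in>Lam2_20. orthogonal (\<omega> - \<theta>) \<zeta>)"
  then have d: "\<theta> - \<eta> \<in> Lam2_20" using assms(1) subspace_diff[OF subspace_Lam2_20] by blast
  have "(\<theta> - \<eta>) \<bullet> (\<theta> - \<eta>) = (\<omega> - \<eta>) \<bullet> (\<theta> - \<eta>) - (\<omega> - \<theta>) \<bullet> (\<theta> - \<eta>)"
    by (simp add: inner_diff_left)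
  also have "\<dots> = 0" using d \<theta> assms(2) by (simp add: orthogonal_def)
  finally show "\<theta> = \<eta>" by simp
qed

lemma pr_m:
  shows pr_m_Lam2_20: "pr_m \<omega> \<in> Lam2_20"
    and pr_m_inner: "\<zeta> \<in> Lam2_20 \<Longrightarrow> pr_m \<omega> \<bullet> \<zeta> = \<omega> \<bullet> \<zeta>"
proof -
  obtain y z where "y \<in> span Lam2_20" "\<And>w. w \<in> span Lam2_20 \<Longrightarrow> orthogonal z w" "\<omega> = y + z"
    using orthogonal_subspace_decomp_exists[of Lam2_20 \<omega>] by blast
  then have *: "y \<in> Lam2_20" "\<zeta> \<in> Lam2_20 \<Longrightarrow> (\<omega> - y) \<bullet> \<zeta> = 0" for \<zeta>
    by (simp_all add: span_eq_iff[THEN iffD2, OF subspace_Lam2_20] orthogonal_def)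
  then have "pr_m \<omega> = y" by (rule pr_m_eqI)
  with * show "pr_m \<omega> \<in> Lam2_20" "\<zeta> \<in> Lam2_20 \<Longrightarrow> pr_m \<omega> \<bullet> \<zeta> = \<omega> \<bullet> \<zeta>"
    by (auto simp: inner_diff_left)
qed

lemma linear_pr_m: "linear pr_m"
proof (rule linearI)
  show "pr_m (\<alpha> + \<beta>) = pr_m \<alpha> + pr_m \<beta>" for \<alpha> \<beta>
    by (rule pr_m_eqI)
      (simp_all add: subspace_add[OF subspace_Lam2_20] pr_m_Lam2_20 pr_m_inner inner_add_left
          inner_diff_left)
  show "pr_m (c *\<^sub>R \<alpha>) = c *\<^sub>R pr_m \<alpha>" for c \<alpha>
    by (rule pr_m_eqI)
      (simp_all add: subspace_scale[OF subspace_Lam2_20] pr_m_Lam2_20 pr_m_inner inner_diff_left)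
qed

section \<open>The maps \<open>Theta1\<close> and \<open>Theta2\<close> and the vanishing of the
  \<open>W6\<close>-component\<close>

lemma linear_sigma_2: "\<alpha> \<in> Lam 2 \<Longrightarrow> linear (sigma 2 \<alpha>)"
  by (rule linearI)
    (simp_all add: sigma_2_eq hook_simps scaleR_add_right sum.distrib scaleR_sum_right ac_simps)

text \<open>The entries of \<Gamma> lie in \<open>Lam2_20\<close>, so the projection drops out of
  the inner product; the rest is adjointness of \<open>hook\<close> and \<open>ext\<close>.\<close>

lemma Theta1_inner:
  assumes "\<Gamma> \<in> R8_m"
  shows "Theta1 T \<bullet> \<Gamma> = - (1 / 2) * (T \<bullet> Phi1 \<Gamma>)"
  using assms unfolding inner_vec_def[of "Theta1 T"]
  by (simp add: Theta1_def Phi1_def R8_m_def pr_m_inner hook_inner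
      inner_sum_right sum_distrib_left ext_def sum_negf sum_divide_distrib)

lemma Theta2_inner:
  assumes "\<Gamma> \<in> R8_m"
  shows "Theta2 F \<bullet> \<Gamma> = - (F \<bullet> Phi2 \<Gamma>)"
  using assms unfolding inner_vec_def[of "Theta2 F"]
  by (simp add: Theta2_def Phi2_def R8_m_def pr_m_inner
      sigma_2_inner[OF hook_rho0_Lam] inner_sum_right sum_negf)

lemma linear_Theta1: "linear Theta1"
  by (rule linearI)
    (simp_all add: Theta1_def vec_eq_iff hook_simps linear_add[OF linear_pr_m]
        linear_cmul[OF linear_pr_m]
      scaleR_add_right)

lemma linear_Theta2: "linear Theta2"
  by (rule linearI)
    (simp_all add: Theta2_def vec_eq_iff linear_add[OF linear_sigma_2[OF hook_rho0_Lam]]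
      linear_cmul[OF linear_sigma_2[OF hook_rho0_Lam]] linear_add[OF linear_pr_m]
          linear_cmul[OF linear_pr_m])

text \<open>\<open>W6\<close> is orthogonal to the images of \<open>Theta1\<close> and \<open>Theta2\<close>, the adjoints of \<open>Phi1\<close> and
  \<open>Phi2\<close> up to a factor; hence the \<open>W6\<close>-component vanishes.\<close>

lemma torsion_eq_Theta:
  assumes "\<Gamma> \<in> W1 + W2 + W3 + W4 + W5"
    and "\<Gamma> = \<Gamma>1 + \<Gamma>2 + \<Gamma>3 + \<Gamma>4 + \<Gamma>5 + \<Gamma>6" "\<Gamma>6 \<in> W6"
    and "Theta1 T = \<Gamma>1 + \<Gamma>2 + \<Gamma>3" "Theta2 F = \<Gamma>4 + \<Gamma>5"
  shows "\<Gamma> = Theta1 T + Theta2 F"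
proof -
  have \<Gamma>6: "\<Gamma>6 \<in> R8_m" "Phi1 \<Gamma>6 = 0" "Phi2 \<Gamma>6 = 0" using assms(3) by (auto simp: W6_def)
  obtain T' F' where "\<Gamma> = Theta1 T' + Theta2 F'"
  proof -
    obtain a1 a2 a3 a4 a5 where "\<Gamma> = Theta1 a1 + Theta1 a2 + Theta1 a3 + Theta2 a4 + Theta2 a5"
      using assms(1) by (auto simp: set_plus_def W1_def W2_def W3_def W4_def W5_def)
    then show thesis
      by (intro that[of "a1 + a2 + a3" "a4 + a5"])
        (simp add: linear_add[OF linear_Theta1] linear_add[OF linear_Theta2])
  qed
  \<comment> \<open>The representation of \<Gamma> given by its type pairs to 0 with \<Gamma>6; the
    one given by the characteristic forms pairs to the squared norm of \<Gamma>6.\<close>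
  then have "\<Gamma> \<bullet> \<Gamma>6 = 0"
    by (simp add: inner_add_left Theta1_inner Theta2_inner \<Gamma>6)
  moreover have \<Gamma>: "\<Gamma> = Theta1 T + Theta2 F + \<Gamma>6"
    using assms(2,4,5) by (simp add: ac_simps)
  ultimately have "\<Gamma>6 \<bullet> \<Gamma>6 = 0"
    by (simp add: inner_add_left Theta1_inner Theta2_inner \<Gamma>6)
  with \<Gamma> show ?thesis by simp
qed

section \<open>Injectivity of the contraction with \<open>rho0\<close> on 3-forms\<close>

lemma sum_delta: "(\<Sum>a\<in>UNIV. delta a q * f a) = (f q :: real)"
proof -
  have "delta a q * f a = (if q = a then f q else 0)" for a
    by (auto simp: delta_def)
  then show ?thesis by simp
qed

text \<open>Expansion along the first row: by skewness of \<open>f\<close> the two terms of each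
  minor coincide, hence the factor 2, and the cyclic order of the indices absorbs the signs.\<close>

lemma sum_det3:
  fixes f :: "8 \<Rightarrow> 8 \<Rightarrow> real"
  assumes "\<And>a b. f b a = - f a b"
  shows "(\<Sum>a\<in>UNIV. \<Sum>b\<in>UNIV. det3 p q s (delta i) (delta a) (delta b) * f a b)
    = 2 * (delta i p * f q s + delta i q * f s p + delta i s * f p q)"
proof -
  have det: "det3 p q s (delta i) (delta a) (delta b) * f a b
      = delta i p * (delta a q * (delta b s * f a b)) - delta i p *
          (delta a s * (delta b q * f a b))
        - delta i q * (delta a p * (delta b s * f a b)) + delta i q *
            (delta a s * (delta b p * f a b))
        + delta i s * (delta a p * (delta b q * f a b)) - delta i s *
            (delta a q * (delta b p * f a b))"
    for a b
    by (simp add: det3_def algebra_simps)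
  have "(\<Sum>a\<in>UNIV. \<Sum>b\<in>UNIV. det3 p q s (delta i) (delta a) (delta b) * f a b)
      = delta i p * f q s - delta i p * f s q - delta i q * f p s + delta i q * f s p
        + delta i s * f p q - delta i s * f q p"
    unfolding det by (simp add: sum.distrib sum_subtractf sum_delta flip: sum_distrib_left)
  also have "\<dots> = 2 * (delta i p * f q s + delta i q * f s p + delta i s * f p q)"
    by (simp add: assms[of q s] assms[of s p] assms[of p q] algebra_simps)
  finally show ?thesis .
qed

lemma sum_rc:
  assumes "\<And>a b. f b a = - f a b"
  defines "L \<equiv> \<lambda>i p q s. delta i p * f q s + delta i q * f s p + delta i s * f p q"
  shows "(\<Sum>a\<in>UNIV. \<Sum>b\<in>UNIV. rc i a b * f a b)
    = 2 * (L i 1 3 5 - L i 1 2 4 - L i 0 3 4 - L i 0 2 5 + L i 0 1 6 + L i 2 3 6 - 2 * L i 4 5 6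
        + sqrt 3 * (L i 0 1 7 - L i 2 3 7))"
  by (simp add: rc_eq rho_tri_def left_diff_distrib distrib_right sum.distrib sum_subtractf
      mult.assoc
      sum_det3[OF assms(1)] L_def flip: sum_distrib_left)

text \<open>The factors \<open>sqrt 3\<close> disappear when the last basis vector is rescaled by \<open>sqrt 3\<close>.\<close>

lemma contraction_rc_injective:
  fixes G :: "8 \<Rightarrow> 8 \<Rightarrow> 8 \<Rightarrow> real"
  assumes anti: "\<And>i j k. G j i k = - G i j k" "\<And>i j k. G i k j = - G i j k"
    and contr: "\<And>i c. (\<Sum>a\<in>UNIV. \<Sum>b\<in>UNIV. rc i a b * G a b c) = 0"
  shows "G i j k = 0"
proof -
  define w where "w a = (if a = 7 then sqrt 3 else 1)" for a :: 8
  define H where "H a b c = w a * w b * w c * G a b c" for a b c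
  have w: "w 7 = sqrt 3" "w 0 = 1" "w 1 = 1" "w 2 = 1" "w 3 = 1" "w 4 = 1" "w 5 = 1" "w 6 = 1"
    and w_pos: "w a > 0" for a
    by (simp_all add: w_def)
  \<comment> \<open>The order conditions orient the skew symmetries: rewriting sorts the indices and
    terminates.\<close>
  have H_sort: "b < a \<Longrightarrow> H a b c = - H b a c" "c < b \<Longrightarrow> H a b c = - H a c b"
    "H a a c = 0" "H a b b = 0" for a b c
    using anti(1)[of a b c] anti(2)[of a b c] anti(1)[of a a c] anti(2)[of a b b]
    by (simp_all add: H_def)
  have anti_w: "w c * G b a c = - (w c * G a b c)" for a b c
    by (simp add: anti(1)[of b a])
  have contr': "(\<Sum>a\<in>UNIV. \<Sum>b\<in>UNIV. rc i a b * (w c * G a b c)) = 0" for i c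
    using contr[of i c] by (simp add: mult.left_commute[of _ "w c"] flip: sum_distrib_left)
  \<comment> \<open>Row \<open>i\<close> of the contraction for an arbitrary last index, divided by
    2 and, in row 7, also by \<open>sqrt 3\<close>.\<close>
  have e0: "- H 3 4 c - H 2 5 c + H 1 6 c + H 1 7 c = 0"
    and e1: "H 3 5 c - H 2 4 c + H 6 0 c + H 7 0 c = 0"
    and e2: "- H 4 1 c - H 5 0 c + H 3 6 c - H 3 7 c = 0"
    and e3: "H 5 1 c - H 4 0 c + H 6 2 c - H 7 2 c = 0"
    and e4: "- H 1 2 c - H 0 3 c - 2 * H 5 6 c = 0"
    and e5: "H 1 3 c - H 0 2 c - 2 * H 6 4 c = 0"
    and e6: "H 0 1 c + H 2 3 c - 2 * H 4 5 c = 0"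
    and e7: "H 0 1 c - H 2 3 c = 0" for c
    using contr'[of 0 c] contr'[of 1 c] contr'[of 2 c] contr'[of 3 c]
      contr'[of 4 c] contr'[of 5 c] contr'[of 6 c] contr'[of 7 c]
    unfolding sum_rc[OF anti_w] by (simp_all add: delta_id H_def w algebra_simps)
  \<comment> \<open>The terms of \<open>rho0\<close> have total degree 0 for a grading by the group
    of order 8 and exponent 2: the indices 0 to 5 have distinct nonzero degrees, while 6 and 7 share
    the seventh. So the system splits into eight blocks by total degree, solved in \<open>z0\<close>
    to \<open>z7\<close>.\<close>
  have z0: "H 0 2 4 = 0" "H 0 3 5 = 0" "H 1 2 5 = 0" "H 1 3 4 = 0"
    using e1[of 0] e0[of 1] e2[of 3] e3[of 2] e4[of 5] e5[of 4]
    by (simp_all add: H_sort less_8)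
  have z1: "H 0 2 3 = 0" "H 0 4 5 = 0" "H 1 6 7 = 0" "H 2 5 6 = 0" "H 2 5 7 = 0" "H 3 4 6 = 0"
    "H 3 4 7 = 0"
    using e0[of 6] e0[of 7] e2[of 4] e3[of 5] e4[of 2] e5[of 3] e6[of 0] e7[of 0]
    by (simp_all add: H_sort less_8)
  have z2: "H 0 6 7 = 0" "H 1 2 3 = 0" "H 1 4 5 = 0" "H 2 4 6 = 0" "H 2 4 7 = 0" "H 3 5 6 = 0"
    "H 3 5 7 = 0"
    using e1[of 6] e1[of 7] e2[of 5] e3[of 4] e4[of 3] e5[of 2] e6[of 1] e7[of 1]
    by (simp_all add: H_sort less_8)
  have z3: "H 0 1 2 = 0" "H 0 5 6 = 0" "H 0 5 7 = 0" "H 1 4 6 = 0" "H 1 4 7 = 0" "H 2 4 5 = 0"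
    "H 3 6 7 = 0"
    using e0[of 4] e1[of 5] e2[of 6] e2[of 7] e4[of 0] e5[of 1] e6[of 2] e7[of 2]
    by (simp_all add: H_sort less_8)
  have z4: "H 0 1 3 = 0" "H 0 4 6 = 0" "H 0 4 7 = 0" "H 1 5 6 = 0" "H 1 5 7 = 0" "H 2 6 7 = 0"
    "H 3 4 5 = 0"
    using e0[of 5] e1[of 4] e3[of 6] e3[of 7] e4[of 1] e5[of 0] e6[of 3] e7[of 3]
    by (simp_all add: H_sort less_8)
  have z5: "H 0 1 4 = 0" "H 0 3 6 = 0" "H 0 3 7 = 0" "H 1 2 6 = 0" "H 1 2 7 = 0" "H 2 3 4 = 0"
    "H 5 6 7 = 0"
    using e0[of 2] e1[of 3] e2[of 0] e3[of 1] e4[of 6] e4[of 7] e6[of 4] e7[of 4]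
    by (simp_all add: H_sort less_8)
  have z6: "H 0 1 5 = 0" "H 0 2 6 = 0" "H 0 2 7 = 0" "H 1 3 6 = 0" "H 1 3 7 = 0" "H 2 3 5 = 0"
    "H 4 6 7 = 0"
    using e0[of 3] e1[of 2] e2[of 1] e3[of 0] e5[of 6] e5[of 7] e6[of 5] e7[of 5]
    by (simp_all add: H_sort less_8)
  have z7: "H 0 1 6 = 0" "H 0 1 7 = 0" "H 0 2 5 = 0" "H 0 3 4 = 0" "H 1 2 4 = 0" "H 1 3 5 = 0"
    "H 2 3 6 = 0" "H 2 3 7 = 0" "H 4 5 6 = 0" "H 4 5 7 = 0"
    using e0[of 0] e1[of 1] e2[of 2] e3[of 3] e4[of 4] e5[of 5] e6[of 6] e6[of 7] e7[of 6] e7[of 7]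
    by (simp_all add: H_sort less_8)
  note z = z0 z1 z2 z3 z4 z5 z6 z7
  have "\<forall>i\<in>UNIV. \<forall>j\<in>UNIV. \<forall>k\<in>UNIV. H i j k = 0"
    unfolding UNIV_8 by (simp add: H_sort less_8 z)
  then have "H i j k = 0" by simp
  then show ?thesis using w_pos[of i] w_pos[of j] w_pos[of k] by (simp add: H_def)
qed

section \<open>Multilinear maps and frames\<close>

definition multilinear :: "nat \<Rightarrow> ((real ^ 8) list \<Rightarrow> real) \<Rightarrow> bool" where
  "multilinear k f \<longleftrightarrow> (\<forall>Xs. length Xs = k \<longrightarrow> (\<forall>a<k. linear (\<lambda>v. f (Xs[a := v]))))"

lemma multilinear_slot: "multilinear k f \<Longrightarrow> length Xs = k \<Longrightarrow> a < k \<Longrightarrow> linear (\<lambda>v. f (Xs[a := v]))"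
  by (simp add: multilinear_def)

lemma multilinear_hd: "multilinear (Suc k) f \<Longrightarrow> length Ys = k \<Longrightarrow> linear (\<lambda>v. f (v # Ys))"
  using multilinear_slot[of "Suc k" f "0 # Ys" 0] by simp

lemma multilinear_tl: "multilinear (Suc k) f \<Longrightarrow> multilinear k (\<lambda>Ys. f (v # Ys))"
  using multilinear_slot[of "Suc k" f "v # _" "Suc _"] by (simp add: multilinear_def)

lemma multilinear_eqI:
  assumes "multilinear k f" "multilinear k h" and e: "span (range e) = UNIV"
    and "\<And>ns. length ns = k \<Longrightarrow> f (map e ns) = h (map e ns)"
    and "length Xs = k"
  shows "f Xs = h Xs"
  using assms(1,2,4,5)
proof (induction k arbitrary: f h Xs)
  case (Suc k)
  then obtain v Ys where Xs: "Xs = v # Ys" "length Ys = k" by (auto simp: length_Suc_conv)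
  have "f (e n # Ys) = h (e n # Ys)" for n
    using Suc.IH[of "\<lambda>Ys. f (e n # Ys)" "\<lambda>Ys. h (e n # Ys)" Ys] Suc.prems(3)[of "n # _"] Xs(2)
      multilinear_tl[OF Suc.prems(1)] multilinear_tl[OF Suc.prems(2)] by simp
  then have "f (v # Ys) = h (v # Ys)"
    using linear_eq_on_span[of "\<lambda>v. f (v # Ys)" "\<lambda>v. h (v # Ys)" "range e" v] e
      multilinear_hd[OF Suc.prems(1) Xs(2)] multilinear_hd[OF Suc.prems(2) Xs(2)] by auto
  with Xs show ?case by simp
qed simp

lemma vec8_expansion: "(\<Sum>i\<in>UNIV. v $ i *\<^sub>R axis i 1) = (v :: real ^ 8)"
  using basis_expansion[of v] by (simp add: scalar_mult_eq_scaleR)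

text \<open>A product rule in which \<open>S\<close> is known to be differentiable only for fixed
  arguments. Expanding the first argument in the standard basis gives products of scalar functions,
  and induction treats the others.\<close>

lemma multilinear_has_derivative:
  fixes S :: "real ^ 8 \<Rightarrow> (real ^ 8) list \<Rightarrow> real" and Ys :: "(real ^ 8 \<Rightarrow> real ^ 8) list"
  assumes U: "open U" "x0 \<in> U"
    and "\<And>x. x \<in> U \<Longrightarrow> multilinear (length Ys) (S x)"
    and "\<And>Xs. length Xs = length Ys \<Longrightarrow> (\<lambda>x. S x Xs) differentiable (at x0)"
    and "\<And>Y. Y \<in> set Ys \<Longrightarrow> Y differentiable (at x0)"
  shows "((\<lambda>x. S x (map (\<lambda>Y. Y x) Ys)) has_derivative
    (\<lambda>h. frechet_derivative (\<lambda>x. S x (map (\<lambda>Y. Y x0) Ys)) (at x0) h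
      + (\<Sum>a<length Ys. S x0 ((map (\<lambda>Y. Y x0) Ys)[a := frechet_derivative (Ys ! a) (at x0) h]))))
    (at x0)"
  using assms(3-5)
proof (induction Ys arbitrary: S)
  case Nil
  then show ?case using frechet_derivative_works[of "\<lambda>x. S x []" "at x0"] by simp
next
  case (Cons Y Ys)
  let ?b = "\<lambda>r. axis r 1 :: real ^ 8"
  let ?Ys = "\<lambda>x. map (\<lambda>Y. Y x) Ys"
  let ?D = "\<lambda>f. frechet_derivative f (at x0)"
  \<comment> \<open>Required on the whole neighbourhood \<open>U\<close>, since this expansion is
    differentiated.\<close>
  have hd: "S x (v # Zs) = (\<Sum>r\<in>UNIV. v $ r * S x (?b r # Zs))"
    if "x \<in> U" "length Zs = length Ys" for x v Zs
  proof -
    have lin: "linear (\<lambda>v. S x (v # Zs))"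
      using that Cons.prems(1) by (intro multilinear_hd[of "length Ys"]) auto
    have "S x (v # Zs) = S x ((\<Sum>r\<in>UNIV. v $ r *\<^sub>R ?b r) # Zs)" by (simp only: vec8_expansion)
    also have "\<dots> = (\<Sum>r\<in>UNIV. v $ r * S x (?b r # Zs))"
      by (simp add: linear_sum[OF lin] linear_cmul[OF lin])
    finally show ?thesis .
  qed
  have der_Y: "((\<lambda>x. Y x $ r) has_derivative (\<lambda>h. ?D Y h $ r)) (at x0)" for r
    using Cons.prems(3)[of Y] frechet_derivative_works[of Y "at x0"]
    by (auto intro: bounded_linear.has_derivative[OF bounded_linear_vec_nth])
  have IH: "((\<lambda>x. S x (?b r # ?Ys x)) has_derivative
      (\<lambda>h. ?D (\<lambda>x. S x (?b r # ?Ys x0)) h + (\<Sum>a<length Ys. S x0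
          (?b r # (?Ys x0)[a := ?D (Ys ! a) h]))))
      (at x0)" for r
    using Cons.prems multilinear_tl by (intro Cons.IH[of "\<lambda>x Zs. S x (?b r # Zs)"]) auto
  have "((\<lambda>x. \<Sum>r\<in>UNIV. Y x $ r * S x (?b r # ?Ys x)) has_derivative
      (\<lambda>h. \<Sum>r\<in>UNIV. Y x0 $ r * (?D (\<lambda>x. S x (?b r # ?Ys x0)) h
          + (\<Sum>a<length Ys. S x0 (?b r # (?Ys x0)[a := ?D (Ys ! a) h])))
        + ?D Y h $ r * S x0 (?b r # ?Ys x0))) (at x0)"
    by (intro has_derivative_sum has_derivative_mult der_Y IH)
  moreover have "?D (\<lambda>x. S x (Y x0 # ?Ys x0)) h =
      (\<Sum>r\<in>UNIV. Y x0 $ r * ?D (\<lambda>x. S x (?b r # ?Ys x0)) h)"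
    for h
  proof -
    have "((\<lambda>x. S x (?b r # ?Ys x0)) has_derivative ?D (\<lambda>x. S x (?b r # ?Ys x0))) (at x0)" for r
      using Cons.prems(2)[of "?b r # ?Ys x0"] by (simp add: frechet_derivative_works)
    then have "((\<lambda>x. \<Sum>r\<in>UNIV. Y x0 $ r * S x (?b r # ?Ys x0)) has_derivative
        (\<lambda>h. \<Sum>r\<in>UNIV. Y x0 $ r * ?D (\<lambda>x. S x (?b r # ?Ys x0)) h)) (at x0)"
      by (intro has_derivative_sum has_derivative_mult_right)
    then have "((\<lambda>x. S x (Y x0 # ?Ys x0)) has_derivative
        (\<lambda>h. \<Sum>r\<in>UNIV. Y x0 $ r * ?D (\<lambda>x. S x (?b r # ?Ys x0)) h)) (at x0)"
      by (rule has_derivative_transform_within_open[OF _ U]) (erule hd[symmetric], simp)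
    from frechet_derivative_at[OF this, symmetric] show ?thesis by (rule fun_cong)
  qed
  moreover have "S x0 (?D Y h # ?Ys x0) = (\<Sum>r\<in>UNIV. ?D Y h $ r * S x0 (?b r # ?Ys x0))" for h
    using U(2) by (intro hd) simp_all
  moreover have "(\<Sum>a<length Ys. S x0 (Y x0 # (?Ys x0)[a := ?D (Ys ! a) h]))
      = (\<Sum>r\<in>UNIV. Y x0 $ r * (\<Sum>a<length Ys. S x0 (?b r # (?Ys x0)[a := ?D (Ys ! a) h])))" for h
  proof -
    have "(\<Sum>a<length Ys. S x0 (Y x0 # (?Ys x0)[a := ?D (Ys ! a) h]))
        = (\<Sum>a<length Ys. \<Sum>r\<in>UNIV. Y x0 $ r * S x0 (?b r # (?Ys x0)[a := ?D (Ys ! a) h]))"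
      by (intro sum.cong refl hd[OF U(2)]) simp
    also have "\<dots> = (\<Sum>r\<in>UNIV. \<Sum>a<length Ys. Y x0 $ r * S x0 (?b r # (?Ys x0)[a := ?D (Ys ! a) h]))"
      by (rule sum.swap)
    finally show ?thesis by (simp only: sum_distrib_left)
  qed
  ultimately have "((\<lambda>x. \<Sum>r\<in>UNIV. Y x $ r * S x (?b r # ?Ys x)) has_derivative
      (\<lambda>h. ?D (\<lambda>x. S x (Y x0 # ?Ys x0)) h + (S x0 (?D Y h # ?Ys x0)
        + (\<Sum>a<length Ys. S x0 (Y x0 # (?Ys x0)[a := ?D (Ys ! a) h]))))) (at x0)"
    by (simp add: sum.distrib algebra_simps)
  then have "((\<lambda>x. S x (Y x # ?Ys x)) has_derivative
      (\<lambda>h. ?D (\<lambda>x. S x (Y x0 # ?Ys x0)) h + (S x0 (?D Y h # ?Ys x0)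
        + (\<Sum>a<length Ys. S x0 (Y x0 # (?Ys x0)[a := ?D (Ys ! a) h]))))) (at x0)"
    by (rule has_derivative_transform_within_open[OF _ U]) (erule hd[symmetric], simp)
  then show ?case
    by (simp add: sum.lessThan_Suc_shift del: sum.lessThan_Suc)
qed

section \<open>Alternating maps and their components in a frame\<close>

definition alternating :: "nat \<Rightarrow> ((real ^ 8) list \<Rightarrow> real) \<Rightarrow> bool" where
  "alternating k f \<longleftrightarrow>
     (\<forall>Xs a b. length Xs = k \<and> a < b \<and> b < k \<longrightarrow> f (Xs[a := Xs ! b, b := Xs ! a]) = - f Xs)"

lemma alternating_tl: "alternating (Suc k) f \<Longrightarrow> alternating k (\<lambda>Ys. f (v # Ys))"
  unfolding alternating_def
proof (intro allI impI)
  fix Xs :: "(real ^ 8) list" and a b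
  assume alt: "\<forall>Xs a b. length Xs = Suc k \<and> a < b \<and> b < Suc k \<longrightarrow> f (Xs[a := Xs ! b, b := Xs ! a]) =
      - f Xs"
    and "length Xs = k \<and> a < b \<and> b < k"
  then show "f (v # Xs[a := Xs ! b, b := Xs ! a]) = - f (v # Xs)"
    using alt[rule_format, of "v # Xs" "Suc a" "Suc b"] by simp
qed

lemma alternating_swap:
  assumes "alternating (length ys + 2 + length zs) f"
  shows "f (ys @ u # v # zs) = - f (ys @ v # u # zs)"
proof -
  have "f ((ys @ v # u # zs)[length ys := u, Suc (length ys) := v]) = - f (ys @ v # u # zs)"
    using assms[unfolded alternating_def, rule_format, of "ys @ v # u # zs" "length ys" "Suc
        (length ys)"]
    by (simp add: nth_append)
  then show ?thesis by (simp add: list_update_append)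
qed

text \<open>Insertion sort: \<open>e i\<close> moves past the entries with smaller index, each
  exchange costing a sign. The prefix \<open>ys\<close> collects the entries already passed.\<close>

lemma alternating_insort:
  assumes "alternating (length ys + Suc (length xs)) f" "sorted xs" "distinct xs" "i \<notin> set xs"
  shows "f (ys @ e i # map e xs) = (- 1) ^ card {j \<in> set xs. j < i} * f (ys @ map e (insort i xs))"
  using assms
proof (induction xs arbitrary: ys)
  case (Cons x xs)
  show ?case
  proof (cases "i < x")
    case True
    with Cons.prems(2) have none: "{j \<in> set (x # xs). j < i} = {}" by auto
    show ?thesis unfolding none using True by (simp add: less_imp_le)
  next
    case False
    with Cons.prems(4) have "x < i" by auto
    then have "{j \<in> set (x # xs). j < i} = insert x {j \<in> set xs. j < i}" by auto
    moreover have "x \<notin> {j \<in> set xs. j < i}" using Cons.prems(3) by simp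
    ultimately have card: "card {j \<in> set (x # xs). j < i} = Suc (card {j \<in> set xs. j < i})" by simp
    have "f (ys @ e i # map e (x # xs)) = - f ((ys @ [e x]) @ e i # map e xs)"
      using Cons.prems(1) alternating_swap[of ys "map e xs" f "e i" "e x"] by simp
    also have "\<dots> = - ((- 1) ^ card {j \<in> set xs. j < i} * f ((ys @ [e x]) @ map e (insort i xs)))"
      using Cons.prems by (subst Cons.IH) auto
    finally show ?thesis unfolding card using \<open>x < i\<close> by (simp add: not_le)
  qed
qed simp

lemma shuffle_sign_singleton: "shuffle_sign {i} K = (- 1) ^ card {j \<in> K. j < i}"
proof -
  have "{(i', j). i' \<in> {i} \<and> j \<in> K \<and> j < i'} = Pair i ` {j \<in> K. j < i}" by auto
  then show ?thesis by (simp add: shuffle_sign_def card_image inj_on_def)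
qed

lemma hook_frame_form:
  assumes "alternating (Suc k) f"
  shows "hook i (frame_form (Suc k) e f) = frame_form k e (\<lambda>Ys. f (e i # Ys))"
proof (rule vec_eq_iff[THEN iffD2, rule_format])
  fix K :: "8 set"
  show "hook i (frame_form (Suc k) e f) $ K = frame_form k e (\<lambda>Ys. f (e i # Ys)) $ K"
  proof (cases "card K = k")
    case False
    then show ?thesis by (auto simp: hook_def frame_form_def)
  next
    case True
    let ?xs = "sorted_list_of_set K"
    have len: "length ?xs = k" using True by simp
    show ?thesis
    proof (cases "i \<in> K")
      case True
      then obtain a where a: "a < k" "?xs ! a = i"
        using len by (metis finite in_set_conv_nth set_sorted_list_of_set)
      let ?Xs = "e i # map e ?xs"
      \<comment> \<open>Here \<open>e i\<close> occurs twice; exchanging the equal entries changes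
        nothing but the sign, so the value is 0.\<close>
      have "?Xs[0 := ?Xs ! Suc a, Suc a := ?Xs ! 0] = ?Xs"
        using a len by (simp add: list_update_same_conv)
      then have "f ?Xs = - f ?Xs"
        using assms[unfolded alternating_def, rule_format, of ?Xs 0 "Suc a"] a len by simp
      then show ?thesis
        using True \<open>card K = k\<close> by (simp add: hook_def frame_form_def)
    next
      case False
      then have "f (e i # map e ?xs) = shuffle_sign {i} K * f
          (map e (sorted_list_of_set (insert i K)))"
        using alternating_insort[of "[]" ?xs f i e] assms len by (simp add: shuffle_sign_singleton)
      then show ?thesis
        using False \<open>card K = k\<close> by (simp add: hook_def frame_form_def)
    qed
  qed
qed

lemma frame_form_0: "frame_form 0 e f $ {} = f []"
  by (simp add: frame_form_def)

lemma val2_hook_frame_form: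
  assumes "alternating 3 f"
  shows "val2 (hook i (frame_form 3 e f)) j k = f [e i, e j, e k]"
  using assms alternating_tl[of 2 f] alternating_tl[of 1 "\<lambda>Ys. f (_ # Ys)"]
    alternating_tl[of 0 "\<lambda>Ys. f (_ # _ # Ys)"]
    hook_frame_form[of 2 f i e] hook_frame_form[of 1 "\<lambda>Ys. f (e i # Ys)" j e]
    hook_frame_form[of 0 "\<lambda>Ys. f (e i # e j # Ys)" k e]
  by (simp add: val2_def numeral_2_eq_2 numeral_3_eq_3 frame_form_0)

lemma val2_hook_hook_frame_form:
  assumes "alternating 4 f"
  shows "val2 (hook b (hook a (frame_form 4 e f))) j k = f [e a, e b, e j, e k]"
  using assms alternating_tl[of 3 f "e a"] hook_frame_form[of 3 f a e]
    val2_hook_frame_form[of "\<lambda>Ys. f (e a # Ys)" b e j k]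
  by simp

lemma val2_sigma_2_frame_form:
  assumes "alternating 4 f"
  shows "val2 (sigma 2 (hook i rho0) (frame_form 4 e f)) j k
    = 1 / 2 * (\<Sum>a\<in>UNIV. \<Sum>b\<in>UNIV. rc i a b * f [e a, e b, e j, e k])"
  by (simp add: sigma_2_eq[OF hook_rho0_Lam] linear_cmul[OF linear_val2] linear_sum[OF linear_val2]
      val2_hook_rho0 val2_hook_hook_frame_form[OF assms])

lemma frame_form_Lam: "frame_form k e f \<in> Lam k"
  by (simp add: Lam_def frame_form_def)

lemma frame_form_2_eqI:
  assumes "\<alpha> \<in> Lam 2" "\<And>i j. f [e i, e j] = val2 \<alpha> i j"
  shows "frame_form 2 e f = \<alpha>"
proof (rule vec_eq_iff[THEN iffD2, rule_format])
  fix K :: "8 set"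
  show "frame_form 2 e f $ K = \<alpha> $ K"
  proof (cases "card K = 2")
    case True
    let ?xs = "sorted_list_of_set K"
    have "\<exists>i j. xs = [i, j]" if "length xs = 2" for xs :: "8 list"
      using that by (auto simp: length_Suc_conv numeral_2_eq_2)
    then obtain i j where xs: "?xs = [i, j]" using True by force
    moreover have "set ?xs = K" by simp
    ultimately have K: "K = {i, j}" by simp
    have "i < j" using strict_sorted_list_of_set[of K] xs by simp
    then have "shuffle_sign {i} {j} = 1" by (intro shuffle_sign_increasing) auto
    then show ?thesis
      using True xs K \<open>i < j\<close> assms(2) by (auto simp: frame_form_def val2_nth)
  next
    case False
    then show ?thesis using assms(1) by (auto simp: frame_form_def Lam_def)
  qed
qed

section \<open>Covariant derivatives in a chart\<close>

definition diff_in :: "'m chart \<Rightarrow> ('m \<Rightarrow> 'b::real_normed_vector) \<Rightarrow> 'm \<Rightarrow> bool" where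
  "diff_in c f p \<longleftrightarrow> (\<lambda>x. f (chart_inv c x)) differentiable (at (snd c p))"

lemma deriv_in_has_derivative:
  "diff_in c f p \<Longrightarrow> ((\<lambda>x. f (chart_inv c x)) has_derivative deriv_in c f p) (at (snd c p))"
  by (simp add: diff_in_def deriv_in_def[abs_def] frechet_derivative_works)

lemma deriv_inI:
  "((\<lambda>x. f (chart_inv c x)) has_derivative f') (at (snd c p)) \<Longrightarrow> deriv_in c f p = f'"
  using frechet_derivative_at by (force simp: deriv_in_def[abs_def])

lemma diff_inI: "((\<lambda>x. f (chart_inv c x)) has_derivative f') (at (snd c p)) \<Longrightarrow> diff_in c f p"
  by (auto simp: diff_in_def differentiable_def)

lemma diff_in_const: "diff_in c (\<lambda>q. a) p" and deriv_in_const: "deriv_in c (\<lambda>q. a) p = (\<lambda>X. 0)"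
  by (rule diff_inI, rule has_derivative_const) (rule deriv_inI, rule has_derivative_const)

lemma deriv_in_add:
  assumes "diff_in c f p" "diff_in c h p"
  shows "deriv_in c (\<lambda>q. f q + h q) p X = deriv_in c f p X + deriv_in c h p X"
  by (rule fun_cong[OF deriv_inI])
    (intro has_derivative_add deriv_in_has_derivative assms)

lemma diff_in_add: "diff_in c f p \<Longrightarrow> diff_in c h p \<Longrightarrow> diff_in c (\<lambda>q. f q + h q) p"
  by (simp add: diff_in_def)

lemma deriv_in_mult:
  fixes f :: "'m \<Rightarrow> real"
  assumes "diff_in c f p"
  shows "deriv_in c (\<lambda>q. r * f q) p X = r * deriv_in c f p X"
  by (rule fun_cong[OF deriv_inI])
    (intro has_derivative_mult_right deriv_in_has_derivative assms)

lemma diff_in_mult: "diff_in c f p \<Longrightarrow> diff_in c (\<lambda>q. r * f q) p" for f :: "'m \<Rightarrow> real"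
  by (simp add: diff_in_def)

lemma deriv_in_sum:
  assumes "\<And>i. i \<in> I \<Longrightarrow> diff_in c (f i) p"
  shows "deriv_in c (\<lambda>q. \<Sum>i\<in>I. f i q) p X = (\<Sum>i\<in>I. deriv_in c (f i) p X)"
  by (rule fun_cong[OF deriv_inI])
    (intro has_derivative_sum deriv_in_has_derivative assms)

lemma diff_in_sum: "(\<And>i. i \<in> I \<Longrightarrow> diff_in c (f i) p) \<Longrightarrow> diff_in c (\<lambda>q. \<Sum>i\<in>I. f i q) p"
  by (rule diff_inI, rule has_derivative_sum, rule deriv_in_has_derivative) blast

lemma linear_deriv_in: "diff_in c f p \<Longrightarrow> linear (deriv_in c f p)"
  by (rule has_derivative_linear[OF deriv_in_has_derivative])

lemma cov_const: "cov D c (\<lambda>_. X) (\<lambda>_. Y) p = D c p X Y"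
  by (simp add: cov_def deriv_in_const)

text \<open>The part of \<open>tensor_field\<close> that concerns a single chart, with first-order
  differentiability in place of smoothness. It can be verified for Christoffel terms, which do not
  transform as tensors.\<close>

definition tensorial :: "'m chart \<Rightarrow> nat \<Rightarrow> 'm tensor \<Rightarrow> bool" where
  "tensorial c k S \<longleftrightarrow> (\<forall>q\<in>fst c. multilinear k (S c q)) \<and>
     (\<forall>q\<in>fst c. \<forall>Xs. length Xs = k \<longrightarrow> diff_in c (\<lambda>q. S c q Xs) q)"

locale atlas_chart =
  fixes A :: "'m::{t2_space, second_countable_topology} chart set" and c :: "'m chart"
  assumes atlas: "oriented_atlas A" and c: "c \<in> A"
begin

lemma chart_homeomorphism: "homeomorphism (fst c) (snd c ` fst c) (snd c) (chart_inv c)"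
  and chart_open: "open (fst c)" "open (snd c ` fst c)"
  using atlas c by (auto simp: oriented_atlas_def)

lemma chart_inv_chart: "q \<in> fst c \<Longrightarrow> chart_inv c (snd c q) = q"
  using chart_homeomorphism by (auto simp: homeomorphism_def)

lemma open_chart_image:
  assumes "open V" "V \<subseteq> fst c"
  shows "open (snd c ` V)"
proof -
  have "openin (top_of_set (snd c ` fst c)) (snd c ` V)"
    using assms by (intro homeomorphism_imp_open_map[OF chart_homeomorphism])
        (auto simp: openin_open)
  then show ?thesis using chart_open(2) openin_open_trans by blast
qed

lemma smooth_in_diff_in:
  assumes "smooth_in c V f" "open V" "V \<subseteq> fst c" "p \<in> V"
  shows "diff_in c f p"
proof -
  have "Ck_on (Suc 0) (\<lambda>x. f (chart_inv c x)) (snd c ` V)"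
    using assms(1) unfolding smooth_in_def by blast
  then have "(\<lambda>x. f (chart_inv c x)) differentiable_on (snd c ` V)" by simp
  moreover have x: "snd c p \<in> snd c ` V" using assms(4) by (rule imageI)
  ultimately show ?thesis
    unfolding diff_in_def differentiable_on_def
    using at_within_open[OF x open_chart_image[OF assms(2,3)]] by metis
qed

lemma has_derivative_cong_open:
  assumes "open V" "V \<subseteq> fst c" "p \<in> V" "\<And>q. q \<in> V \<Longrightarrow> f q = h q"
    and "((\<lambda>x. f (chart_inv c x)) has_derivative f') (at (snd c p))"
  shows "((\<lambda>x. h (chart_inv c x)) has_derivative f') (at (snd c p))"
proof (rule has_derivative_transform_within_open[OF assms(5) open_chart_image[OF assms(1,2)]])
  show "snd c p \<in> snd c ` V" using assms(3) by blast
  show "f (chart_inv c x) = h (chart_inv c x)" if "x \<in> snd c ` V" for x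
    using that assms(2,4) chart_inv_chart by auto
qed

lemma diff_in_cong:
  assumes "open V" "V \<subseteq> fst c" "p \<in> V" "\<And>q. q \<in> V \<Longrightarrow> f q = h q" "diff_in c f p"
  shows "diff_in c h p"
  by (rule diff_inI, rule has_derivative_cong_open[OF assms(1-3), where f = f])
    (rule assms(4), assumption, rule deriv_in_has_derivative[OF assms(5)])

lemma deriv_in_cong:
  assumes "open V" "V \<subseteq> fst c" "p \<in> V" "\<And>q. q \<in> V \<Longrightarrow> f q = h q" "diff_in c f p"
  shows "deriv_in c h p = deriv_in c f p"
  by (rule deriv_inI, rule has_derivative_cong_open[OF assms(1-3), where f = f])
    (rule assms(4), assumption, rule deriv_in_has_derivative[OF assms(5)])

lemma tensor_field_tensorial:
  assumes "tensor_field A k S"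
  shows "tensorial c k S"
  unfolding tensorial_def multilinear_def
proof (intro conjI ballI allI impI)
  fix q and Xs :: "(real ^ 8) list" assume q: "q \<in> fst c" and Xs: "length Xs = k"
  show "linear (\<lambda>v. S c q (Xs[a := v]))" if "a < k" for a
    using assms c q Xs that unfolding tensor_field_def by blast
  have "smooth_in c (fst c) (\<lambda>p. S c p Xs)"
    using assms c Xs unfolding tensor_field_def by blast
  then show "diff_in c (\<lambda>q. S c q Xs) q"
    using q by (rule smooth_in_diff_in[OF _ chart_open(1) subset_refl])
qed

lemma has_derivative_tensor_fields:
  assumes p: "p \<in> fst c" and S: "tensorial c (length Ys) S" and Ys: "\<And>Y. Y \<in> set Ys \<Longrightarrow> diff_in c Y p"
  shows "((\<lambda>x. S c (chart_inv c x) (map (\<lambda>Y. Y (chart_inv c x)) Ys)) has_derivative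
    (\<lambda>X. deriv_in c (\<lambda>q. S c q (map (\<lambda>Y. Y p) Ys)) p X
      + (\<Sum>a<length Ys. S c p ((map (\<lambda>Y. Y p) Ys)[a := deriv_in c (Ys ! a) p X])))) (at (snd c p))"
proof -
  let ?Ys = "map (\<lambda>Y x. Y (chart_inv c x)) Ys"
  have "((\<lambda>x. S c (chart_inv c x) (map (\<lambda>Y. Y x) ?Ys)) has_derivative
    (\<lambda>h. frechet_derivative (\<lambda>x. S c (chart_inv c x) (map (\<lambda>Y. Y (snd c p)) ?Ys)) (at (snd c p)) h
      + (\<Sum>a<length ?Ys. S c (chart_inv c (snd c p)) ((map (\<lambda>Y. Y (snd c p)) ?Ys)
          [a := frechet_derivative (?Ys ! a) (at (snd c p)) h]))))
    (at (snd c p))"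
  proof (rule multilinear_has_derivative[OF chart_open(2)])
    show "multilinear (length ?Ys) (S c (chart_inv c x))" if "x \<in> snd c ` fst c" for x
      using that S by (auto simp: tensorial_def chart_inv_chart)
    show "(\<lambda>x. S c (chart_inv c x) Xs) differentiable at (snd c p)" if "length Xs = length ?Ys" for
        Xs
      using that S p by (auto simp: tensorial_def diff_in_def)
    show "Y differentiable at (snd c p)" if "Y \<in> set ?Ys" for Y
      using that Ys by (auto simp: diff_in_def)
  qed (use p in blast)
  then show ?thesis
    using p by (simp add: chart_inv_chart deriv_in_def comp_def cong: sum.cong_simp)
qed

lemma diff_in_tensor_fields:
  assumes "p \<in> fst c" "tensorial c (length Ys) S" "\<And>Y. Y \<in> set Ys \<Longrightarrow> diff_in c Y p"
  shows "diff_in c (\<lambda>q. S c q (map (\<lambda>Y. Y q) Ys)) p"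
  using has_derivative_tensor_fields[OF assms] by (rule diff_inI)

text \<open>The terms that differentiate the fields \<open>Ys\<close> occur both in the product rule
  and in \<open>cov\<close>, and cancel. Hence the extension of the vectors is immaterial and
  adapted frame fields may serve as arguments.\<close>

lemma cov_tensor_fields:
  assumes p: "p \<in> fst c" and S: "tensorial c (length Ys) S" and Ys: "\<And>Y. Y \<in> set Ys \<Longrightarrow> diff_in c Y p"
  shows "cov_tensor D S c p X (map (\<lambda>Y. Y p) Ys)
    = deriv_in c (\<lambda>q. S c q (map (\<lambda>Y. Y q) Ys)) p X
      - (\<Sum>a<length Ys. S c p ((map (\<lambda>Y. Y p) Ys)[a := cov D c (\<lambda>_. X) (Ys ! a) p]))"
proof -
  let ?Y = "map (\<lambda>Y. Y p) Ys"
  have "S c p (?Y[a := cov D c (\<lambda>_. X) (Ys ! a) p])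
      = S c p (?Y[a := deriv_in c (Ys ! a) p X]) + S c p (?Y[a := D c p X (?Y ! a)])" if "a <
          length Ys" for a
  proof -
    have lin: "linear (\<lambda>v. S c p (?Y[a := v]))"
      using S p that by (intro multilinear_slot[of "length Ys"]) (auto simp: tensorial_def)
    show ?thesis using that by (simp add: cov_def linear_add[OF lin])
  qed
  then show ?thesis
    using deriv_inI[OF has_derivative_tensor_fields[OF assms]]
    by (simp add: cov_tensor_def cov_const sum.distrib)
qed

text \<open>This makes it enough to check the vanishing of a covariant derivative on a
  frame.\<close>

lemma multilinear_cov_tensor:
  assumes p: "p \<in> fst c" and S: "tensorial c k S" and D: "bilinear (D c p)"
  shows "multilinear k (cov_tensor D S c p X)"
  unfolding multilinear_def
proof (intro allI impI)
  fix Ys :: "(real ^ 8) list" and b assume len: "length Ys = k" and b: "b < k"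
  have slot: "linear (\<lambda>v. S c q (Zs[a := v]))" if "q \<in> fst c" "length Zs = k" "a < k" for q Zs a
    using S that by (intro multilinear_slot) (auto simp: tensorial_def)
  have diff: "diff_in c (\<lambda>q. S c q Zs) p" if "length Zs = k" for Zs
    using S p that by (auto simp: tensorial_def)
  have lin1: "linear (\<lambda>v. deriv_in c (\<lambda>q. S c q (Ys[b := v])) p X)"
  proof (rule linearI)
    fix u v
    have "deriv_in c (\<lambda>q. S c q (Ys[b := u + v])) p
        = deriv_in c (\<lambda>q. S c q (Ys[b := u]) + S c q (Ys[b := v])) p"
      using chart_open(1) p len b
      by (intro deriv_in_cong[of "fst c"] diff_in_add diff) (auto simp: linear_add[OF slot])
    then show "deriv_in c (\<lambda>q. S c q (Ys[b := u + v])) p X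
        = deriv_in c (\<lambda>q. S c q (Ys[b := u])) p X + deriv_in c (\<lambda>q. S c q (Ys[b := v])) p X"
      using len by (simp add: deriv_in_add diff)
  next
    fix r v
    have "deriv_in c (\<lambda>q. S c q (Ys[b := r *\<^sub>R v])) p = deriv_in c (\<lambda>q. r * S c q (Ys[b := v])) p"
      using chart_open(1) p len b
      by (intro deriv_in_cong[of "fst c"] diff_in_mult diff) (auto simp: linear_cmul[OF slot])
    then show "deriv_in c (\<lambda>q. S c q (Ys[b := r *\<^sub>R v])) p X
        = r *\<^sub>R deriv_in c (\<lambda>q. S c q (Ys[b := v])) p X"
      using len by (simp add: deriv_in_mult diff)
  qed
  have lin2: "linear (\<lambda>v. S c p (Ys[b := v, a := D c p X (Ys[b := v] ! a)]))" if a: "a < k" for a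
  proof (cases "a = b")
    case True
    have "linear (D c p X)" using D by (simp add: bilinear_def)
    from linear_compose[OF this slot[OF p len b]] show ?thesis
      using True b len by (simp add: comp_def)
  next
    case False
    have "linear (\<lambda>v. S c p (Ys[a := D c p X (Ys ! a), b := v]))"
      using p len b by (intro slot) simp_all
    with False show ?thesis using a len by (simp add: list_update_swap)
  qed
  have "linear (\<lambda>v. \<Sum>a<k. S c p (Ys[b := v, a := D c p X (Ys[b := v] ! a)]))"
    by (rule linear_compose_sum) (use lin2 in auto)
  with lin1 show "linear (\<lambda>v. cov_tensor D S c p X (Ys[b := v]))"
    using len by (simp add: cov_tensor_def cov_const linear_compose_sub)
qed

lemma cov_tensor_3:
  "cov_tensor D S c p X [x, y, z] = deriv_in c (\<lambda>q. S c q [x, y, z]) p X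
    - (S c p [D c p X x, y, z] + S c p [x, D c p X y, z] + S c p [x, y, D c p X z])"
  by (simp add: cov_tensor_def cov_const eval_nat_numeral)

text \<open>Covariant differentiation commutes with permuting slots and with constant coefficients.
  The four permutations are those relating the difference tensor, the torsion and T.\<close>

lemma cov_tensor_lincomb:
  fixes S P :: "'m tensor"
  assumes p: "p \<in> fst c"
    and P: "\<And>x y z. diff_in c (\<lambda>q. P c q [x, y, z]) p"
    and S: "\<And>q x y z. q \<in> fst c \<Longrightarrow> S c q [x, y, z] = k1 * P c q [x, y, z] + k2 * P c q [y, z, x]
      + k3 * P c q [z, x, y] + k4 * P c q [y, x, z]"
  shows "cov_tensor D S c p X [x, y, z] = k1 * cov_tensor D P c p X [x, y, z] + k2 * cov_tensor D P
      c p X [y, z, x]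
      + k3 * cov_tensor D P c p X [z, x, y] + k4 * cov_tensor D P c p X [y, x, z]"
proof -
  have "deriv_in c (\<lambda>q. S c q [x, y, z]) p = deriv_in c
      (\<lambda>q. k1 * P c q [x, y, z] + k2 * P c q [y, z, x]
      + k3 * P c q [z, x, y] + k4 * P c q [y, x, z]) p"
    by (rule deriv_in_cong[of "fst c"])
      (use p chart_open(1) S in \<open>auto intro!: diff_in_add diff_in_mult P\<close>)
  then show ?thesis
    unfolding cov_tensor_3 S[OF p]
    by (simp add: deriv_in_add deriv_in_mult diff_in_add diff_in_mult P algebra_simps)
qed

end

lemma length_3_conv: "length Xs = 3 \<longleftrightarrow> (\<exists>x y z. Xs = [x, y, z])"
  by (auto simp: numeral_3_eq_3 length_Suc_conv)

section \<open>The characteristic connection\<close>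

lemma span_frame:
  assumes "det (\<chi> r s. e s $ r) > 0"
  shows "span (range e) = (UNIV :: (real ^ 8) set)"
proof -
  let ?M = "\<chi> r s. e s $ r"
  have "invertible ?M" using assms by (simp add: invertible_det_nz)
  then have "vec.span (columns ?M) = UNIV"
    unfolding matrix_right_invertible_span_columns[symmetric] invertible_def by blast
  moreover have "columns ?M = range e"
    by (auto simp: columns_def column_def vec_eq_iff)
  ultimately show ?thesis by (simp add: span_vec_eq)
qed

lemma form_of_matrix:
  fixes M :: "8 \<Rightarrow> 8 \<Rightarrow> real"
  assumes "\<And>i j. M j i = - M i j"
  defines "\<alpha> \<equiv> \<Sum>i\<in>UNIV. \<Sum>j\<in>{i<..}. M i j *\<^sub>R axis {i, j} 1"
  shows form_of_matrix_Lam: "\<alpha> \<in> Lam 2" and val2_form_of_matrix: "val2 \<alpha> a b = M a b"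
proof -
  have "axis {i, j} 1 \<in> Lam 2" if "i < j" for i j :: 8
    using axis_Lam[of "{i, j}"] card_2_iff[of "{i, j}"] that by (metis less_irrefl)
  then show "\<alpha> \<in> Lam 2"
    unfolding \<alpha>_def by (intro subspace_sum subspace_scale subspace_Lam) auto
  have val: "val2 (axis {i, j} 1) a b = delta a i * delta b j - delta a j * delta b i"
    if "i < j" for i j :: 8
  proof -
    have "shuffle_sign {i} {j} = 1" using that by (intro shuffle_sign_increasing) auto
    then have "axis {i, j} 1 = ext i (ext j (axis {} 1))"
      using that by (auto simp: ext_axis)
    then show ?thesis
      by (simp add: val2_def hook_ext_delta hook_simps ext_simps)
  qed
  \<comment> \<open>The strict upper triangle of \<open>M\<close>, so that both sums run over all
    indices and collapse; \<open>N a b - N b a\<close> recovers \<open>M\<close> by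
    skewness.\<close>
  define N where "N i j = (if i < j then M i j else 0)" for i j
  have "val2 \<alpha> a b = (\<Sum>i\<in>UNIV. \<Sum>j\<in>{i<..}. M i j * val2 (axis {i, j} 1) a b)"
    by (simp add: \<alpha>_def linear_sum[OF linear_val2] linear_cmul[OF linear_val2])
  also have "\<dots> = (\<Sum>i\<in>UNIV. \<Sum>j\<in>UNIV. delta i a * (delta j b * N i j) - delta j a *
      (delta i b * N i j))"
  proof (rule sum.cong[OF refl])
    fix i
    show "(\<Sum>j\<in>{i<..}. M i j * val2 (axis {i, j} 1) a b)
        = (\<Sum>j\<in>UNIV. delta i a * (delta j b * N i j) - delta j a * (delta i b * N i j))"
      by (rule sum.mono_neutral_cong_left) (auto simp: val delta_def N_def)
  qed
  also have "\<dots> = (\<Sum>i\<in>UNIV. delta i a * (\<Sum>j\<in>UNIV. delta j b * N i j) -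
      (\<Sum>j\<in>UNIV. delta j a * (delta i b * N i j)))"
    by (simp only: sum_subtractf sum_distrib_left)
  also have "\<dots> = N a b - N b a"
    by (simp only: sum_delta sum_subtractf)
  also have "\<dots> = M a b"
    unfolding N_def
    using assms(1)[of a b] assms(1)[of a a] by (cases a b rule: linorder_cases) auto
  finally show "val2 \<alpha> a b = M a b" .
qed

text \<open>An index version of integration by parts: renaming indices and skewness of
  \<open>w\<close> move its action from \<open>f\<close> to \<open>r\<close>, with a sign. The
  difference of the two sides is then the action of \<open>w\<close> on all three slots of
  \<open>r\<close>, which is 0.\<close>

lemma contraction_derivation:
  fixes r :: "8 \<Rightarrow> 8 \<Rightarrow> 8 \<Rightarrow> real" and w f :: "8 \<Rightarrow> 8 \<Rightarrow> real"
  assumes w: "\<And>a b. w b a = - w a b"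
    and inv: "\<And>i a b. (\<Sum>m\<in>UNIV. w i m * r m a b + w a m * r i m b + w b m * r i a m) = 0"
  shows "(\<Sum>m\<in>UNIV. w i m * (\<Sum>a\<in>UNIV. \<Sum>b\<in>UNIV. r m a b * f a b))
    = (\<Sum>a\<in>UNIV. \<Sum>b\<in>UNIV. r i a b * (\<Sum>m\<in>UNIV. w a m * f m b + w b m * f a m))"
proof -
  let ?S = "\<lambda>t :: 8 \<Rightarrow> 8 \<Rightarrow> 8 \<Rightarrow> real. \<Sum>a\<in>UNIV. \<Sum>b\<in>UNIV. \<Sum>m\<in>UNIV. t a b m"
  have L: "(\<Sum>m\<in>UNIV. w i m * (\<Sum>a\<in>UNIV. \<Sum>b\<in>UNIV. r m a b * f a b)) = ?S
      (\<lambda>a b m. w i m * r m a b * f a b)"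
  proof -
    have "(\<Sum>m\<in>UNIV. w i m * (\<Sum>a\<in>UNIV. \<Sum>b\<in>UNIV. r m a b * f a b))
        = (\<Sum>m\<in>UNIV. \<Sum>a\<in>UNIV. \<Sum>b\<in>UNIV. w i m * r m a b * f a b)"
      by (simp add: sum_distrib_left mult.assoc)
    also have "\<dots> = (\<Sum>a\<in>UNIV. \<Sum>m\<in>UNIV. \<Sum>b\<in>UNIV. w i m * r m a b * f a b)"
      by (rule sum.swap)
    also have "\<dots> = ?S (\<lambda>a b m. w i m * r m a b * f a b)"
      by (intro sum.cong refl sum.swap)
    finally show ?thesis .
  qed
  have flip: "u * (w m a * v) = - (w a m * u * v)" for u v a m
    by (simp add: w[of a m])
  have R1: "?S (\<lambda>a b m. r i a b * (w a m * f m b)) = ?S (\<lambda>a b m. - (w a m * r i m b * f a b))"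
  proof -
    have "?S (\<lambda>a b m. r i a b * (w a m * f m b)) =
        (\<Sum>a\<in>UNIV. \<Sum>m\<in>UNIV. \<Sum>b\<in>UNIV. r i a b * (w a m * f m b))"
      by (intro sum.cong refl sum.swap)
    also have "\<dots> = (\<Sum>m\<in>UNIV. \<Sum>a\<in>UNIV. \<Sum>b\<in>UNIV. r i a b * (w a m * f m b))"
      by (rule sum.swap)
    also have "\<dots> = (\<Sum>m\<in>UNIV. \<Sum>b\<in>UNIV. \<Sum>a\<in>UNIV. r i a b * (w a m * f m b))"
      by (intro sum.cong refl sum.swap)
    also have "\<dots> = ?S (\<lambda>a b m. - (w a m * r i m b * f a b))"
      by (intro sum.cong refl flip)
    finally show ?thesis .
  qed
  have R2: "?S (\<lambda>a b m. r i a b * (w b m * f a m)) = ?S (\<lambda>a b m. - (w b m * r i a m * f a b))"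
  proof -
    have "?S (\<lambda>a b m. r i a b * (w b m * f a m)) =
        (\<Sum>a\<in>UNIV. \<Sum>m\<in>UNIV. \<Sum>b\<in>UNIV. r i a b * (w b m * f a m))"
      by (intro sum.cong refl sum.swap)
    also have "\<dots> = ?S (\<lambda>a b m. - (w b m * r i a m * f a b))"
      by (intro sum.cong refl flip)
    finally show ?thesis .
  qed
  have "?S (\<lambda>a b m. w i m * r m a b * f a b) - ?S (\<lambda>a b m. - (w a m * r i m b * f a b))
      - ?S (\<lambda>a b m. - (w b m * r i a m * f a b))
    = (\<Sum>a\<in>UNIV. \<Sum>b\<in>UNIV. (\<Sum>m\<in>UNIV. w i m * r m a b + w a m * r i m b + w b m * r i a m) * f a b)"
    unfolding sum_subtractf[symmetric] sum_distrib_right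
    by (intro sum.cong refl) (simp add: algebra_simps)
  then have "?S (\<lambda>a b m. w i m * r m a b * f a b) - ?S (\<lambda>a b m. - (w a m * r i m b * f a b))
      - ?S (\<lambda>a b m. - (w b m * r i a m * f a b)) = 0"
    by (simp add: inv)
  then show ?thesis
    unfolding L R1[symmetric] R2[symmetric] by (simp add: sum_distrib_left distrib_left sum.distrib)
qed

lemma multilinear_3_iff:
  "multilinear 3 f \<longleftrightarrow> (\<forall>y z. linear (\<lambda>v. f [v, y, z]) \<and> linear (\<lambda>v. f [y, v, z]) \<and> linear
      (\<lambda>v. f [y, z, v]))"
proof
  assume f: "multilinear 3 f"
  show "\<forall>y z. linear (\<lambda>v. f [v, y, z]) \<and> linear (\<lambda>v. f [y, v, z]) \<and> linear (\<lambda>v. f [y, z, v])"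
    using multilinear_slot[OF f, of "[y, y, z]" 0 for y z]
        multilinear_slot[OF f, of "[y, y, z]" 1 for y z]
      multilinear_slot[OF f, of "[y, z, z]" 2 for y z] by simp
next
  assume lin: "\<forall>y z. linear (\<lambda>v. f [v, y, z]) \<and> linear (\<lambda>v. f [y, v, z]) \<and> linear (\<lambda>v. f [y, z, v])"
  show "multilinear 3 f"
    unfolding multilinear_def
  proof (intro allI impI)
    fix Xs :: "(real ^ 8) list" and a :: nat assume "length Xs = 3" "a < 3"
    then obtain x y z where "Xs = [x, y, z]" by (auto simp: length_3_conv)
    moreover have "a = 0 \<or> a = 1 \<or> a = 2" using \<open>a < 3\<close> by auto
    ultimately show "linear (\<lambda>v. f (Xs[a := v]))" using lin by auto
  qed
qed

lemma multilinear_3_permute: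
  assumes "multilinear 3 f"
  shows "multilinear 3 (\<lambda>Xs. f [Xs ! 1, Xs ! 2, Xs ! 0])" "multilinear 3
      (\<lambda>Xs. f [Xs ! 2, Xs ! 0, Xs ! 1])"
    "multilinear 3 (\<lambda>Xs. f [Xs ! 0, Xs ! 2, Xs ! 1])"
  using assms by (simp_all add: multilinear_3_iff)

lemma alternating_3:
  assumes "alternating 3 f"
  shows "f [y, x, z] = - f [x, y, z]" "f [x, z, y] = - f [x, y, z]"
  using alternating_swap[of "[]" "[z]" f y x] alternating_swap[of "[x]" "[]" f z y] assms
  by (simp_all add: numeral_3_eq_3)

lemma alternating_3_rotate:
  assumes "alternating 3 f"
  shows "f [y, z, x] = f [x, y, z]"
  using alternating_3(2)[OF assms, of y x z] alternating_3(1)[OF assms, of x y z] by simp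

section \<open>Difference tensor, torsion and T in one chart\<close>

locale psu3_connection =
  fixes A :: "'m::{t2_space, second_countable_topology} chart set"
    and g \<rho> \<Gamma> T F :: "'m tensor"
    and Dg Dc :: "'m conn"
  assumes psu3: "psu3_structure A g \<rho>"
    and Dg: "levi_civita A g Dg"
    and \<Gamma>: "intrinsic_torsion A g \<rho> Dg \<Gamma>"
    and \<Gamma>_type: "of_type A g \<rho> \<Gamma> (W1 + W2 + W3 + W4 + W5)"
    and TF: "characteristic_forms A g \<rho> \<Gamma> T F"
    and Dc: "characteristic_connection A g \<rho> Dg T F Dc"

locale psu3_chart = psu3_connection A g \<rho> \<Gamma> T F Dg Dc
  for A :: "'m::{t2_space, second_countable_topology} chart set"
    and g \<rho> \<Gamma> T F :: "'m tensor" and Dg Dc :: "'m conn" +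
  fixes c :: "'m chart"
  assumes c_atlas: "c \<in> A"
begin

sublocale atlas_chart A c
  using psu3 c_atlas by unfold_locales (auto simp: psu3_structure_def)

lemma g_tensorial: "tensorial c 2 g"
  using psu3 by (intro tensor_field_tensorial) (auto simp: psu3_structure_def riemannian_metric_def)

lemma T_tensorial: "tensorial c 3 T" and F_tensorial: "tensorial c 4 F"
  using TF by (auto intro!: tensor_field_tensorial simp: characteristic_forms_def
      differential_form_def)

lemma T_alternating: "q \<in> fst c \<Longrightarrow> alternating 3 (T c q)"
  and F_alternating: "q \<in> fst c \<Longrightarrow> alternating 4 (F c q)"
  using TF c by (auto simp: characteristic_forms_def differential_form_def alternating_def)

lemma connections: "connection A Dc" "connection A Dg"
  using Dc Dg by (auto simp: characteristic_connection_def levi_civita_def)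

lemma bilinear_D: "q \<in> fst c \<Longrightarrow> bilinear (Dc c q)" "q \<in> fst c \<Longrightarrow> bilinear (Dg c q)"
  using connections c by (auto simp: connection_def)

lemma g_linear:
  assumes "q \<in> fst c"
  shows g_linear_1: "linear (\<lambda>v. g c q [v, w])" and g_linear_2: "linear (\<lambda>v. g c q [w, v])"
  using multilinear_slot[of 2 "g c q" "[w, w]" 0] multilinear_slot[of 2 "g c q" "[w, w]" 1]
    g_tensorial assms
  by (simp_all add: tensorial_def)

lemma difference_eq: "difference_tensor g Dc Dg c q [X, Y, Z] = g c q [Dc c q X Y, Z] - g c q
    [Dg c q X Y, Z]"
  by (simp add: difference_tensor_def cov_const)

text \<open>Within one chart the Christoffel term is bilinear in its vectors and differentiable in
  the point; the difference tensor inherits both properties from its two terms.\<close>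

lemma connection_term_tensorial:
  assumes D: "connection A D"
  shows "tensorial c 3 (\<lambda>c q Xs. g c q [D c q (Xs ! 0) (Xs ! 1), Xs ! 2])"
  unfolding tensorial_def multilinear_def
proof (intro conjI ballI allI impI)
  fix q and Xs :: "(real ^ 8) list" assume q: "q \<in> fst c" and len: "length Xs = 3"
  then obtain x y z where Xs: "Xs = [x, y, z]" by (auto simp: length_3_conv)
  have lin: "linear (\<lambda>v. D c q v y)" "linear (D c q x)"
    using D c q by (auto simp: connection_def bilinear_def)
  show "linear (\<lambda>v. g c q [D c q (Xs[a := v] ! 0) (Xs[a := v] ! 1), Xs[a := v] ! 2])" if "a < 3"
      for a
  proof -
    have "a = 0 \<or> a = 1 \<or> a = 2" using that by auto
    then show ?thesis
      using linear_compose[OF lin(1) g_linear_1[OF q, of z]]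
          linear_compose[OF lin(2) g_linear_1[OF q, of z]]
        g_linear_2[OF q]
      by (auto simp: Xs comp_def)
  qed
  have "smooth_in c (fst c) (\<lambda>q. D c q x y)"
    using D c by (simp add: connection_def)
  then have "diff_in c (\<lambda>q. D c q x y) q"
    by (rule smooth_in_diff_in[OF _ chart_open(1) subset_refl q])
  then have "diff_in c (\<lambda>q'. g c q' (map (\<lambda>Y. Y q') [\<lambda>q. D c q x y, \<lambda>_. z])) q"
    using g_tensorial by (intro diff_in_tensor_fields q) (auto simp: diff_in_const numeral_2_eq_2)
  then show "diff_in c (\<lambda>q. g c q [D c q (Xs ! 0) (Xs ! 1), Xs ! 2]) q"
    by (simp add: Xs)
qed

lemma difference_tensorial: "tensorial c 3 (difference_tensor g Dc Dg)"
proof -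
  have *: "diff_in c (\<lambda>q. f q - h q) q" if "diff_in c f q" "diff_in c h q"
    for f h :: "'m \<Rightarrow> real" and q
    using that by (simp add: diff_in_def)
  show ?thesis
    using connection_term_tensorial[OF connections(1)] connection_term_tensorial[OF connections(2)]
    by (auto simp: tensorial_def multilinear_def difference_tensor_def cov_const linear_compose_sub
        intro!: *)
qed

lemma adapted_frame_exists: "q \<in> fst c \<Longrightarrow> \<exists>e. adapted_frame g \<rho> c q e"
  using psu3 c by (simp add: psu3_structure_def)

lemma adapted_frame_span: "adapted_frame g \<rho> c q e \<Longrightarrow> span (range e) = UNIV"
  by (rule span_frame) (simp add: adapted_frame_def)

lemma difference_frame:
  assumes "q \<in> fst c" "adapted_frame g \<rho> c q e"
  shows "difference_tensor g Dc Dg c q [e i, e j, e k] = 1 / 2 * T c q [e i, e j, e k]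
      + val2 (sigma 2 (hook i rho0) (frame_form 4 e (F c q))) j k"
  using Dc c assms by (simp add: characteristic_connection_def)

lemma eq_on_frames:
  assumes "q \<in> fst c" "multilinear 3 f" "multilinear 3 h"
    and "\<And>e i j k. adapted_frame g \<rho> c q e \<Longrightarrow> f [e i, e j, e k] = h [e i, e j, e k]"
  shows "f [x, y, z] = h [x, y, z]"
proof -
  obtain e where e: "adapted_frame g \<rho> c q e" using adapted_frame_exists[OF assms(1)] by blast
  show ?thesis
    by (rule multilinear_eqI[OF assms(2,3) adapted_frame_span[OF e]])
      (use assms(4)[OF e] in \<open>auto simp: length_3_conv\<close>)
qed

text \<open>Both the T-term and the F-term are skew in the last two slots on adapted frames. As the
  Levi-Civita connection is metric, so is \<open>Dc\<close>.\<close>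

lemma difference_skew:
  assumes q: "q \<in> fst c"
  shows "difference_tensor g Dc Dg c q [x, z, y] = - difference_tensor g Dc Dg c q [x, y, z]"
proof -
  let ?d = "difference_tensor g Dc Dg c q"
  have d: "multilinear 3 ?d" using difference_tensorial q by (simp add: tensorial_def)
  have "(\<lambda>Xs. ?d [Xs ! 0, Xs ! 2, Xs ! 1]) [x, y, z] = (\<lambda>Xs. - ?d Xs) [x, y, z]"
  proof (rule eq_on_frames[OF q multilinear_3_permute(3)[OF d]])
    show "multilinear 3 (\<lambda>Xs. - ?d Xs)"
      using d by (auto simp: multilinear_def linear_compose_neg)
    fix e i j k assume "adapted_frame g \<rho> c q e"
    from difference_frame[OF q this]
    have "?d [e i, e k, e j] = - ?d [e i, e j, e k]"
      by (simp add: val2_swap[of _ k j] alternating_3(2)[OF T_alternating[OF q], of "e i" "e k" "e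
          j"])
    then show "?d [[e i, e j, e k] ! 0, [e i, e j, e k] ! 2, [e i, e j, e k] ! 1] = - ?d
        [e i, e j, e k]"
      by simp
  qed
  then show ?thesis by simp
qed

lemma T_eq_difference:
  assumes q: "q \<in> fst c"
  shows "T c q [x, y, z] = 2 / 3 * difference_tensor g Dc Dg c q [x, y, z]
    + 2 / 3 * difference_tensor g Dc Dg c q [y, z, x] + 2 / 3 * difference_tensor g Dc Dg c q
        [z, x, y]"
proof -
  let ?d = "difference_tensor g Dc Dg c q"
  have d: "multilinear 3 ?d" using difference_tensorial q by (simp add: tensorial_def)
  let ?h = "\<lambda>Xs. 2 / 3 * ?d Xs + 2 / 3 * ?d [Xs ! 1, Xs ! 2, Xs ! 0] + 2 / 3 * ?d
      [Xs ! 2, Xs ! 0, Xs ! 1]"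
  have h: "multilinear 3 ?h"
  proof -
    have "linear (\<lambda>v. 2 * f v / 3)" if "linear f" for f :: "real ^ 8 \<Rightarrow> real"
      using linear_compose_scale_right[OF that, of "2 / 3"] by simp
    with d show ?thesis by (simp add: multilinear_3_iff linear_compose_add)
  qed
  have cyc: "T c q [e i, e j, e k] = ?h [e i, e j, e k]" if e: "adapted_frame g \<rho> c q e" for e i j k
  proof -
    have "frame_form 4 e (F c q) \<in> star ` Lam4_8 + star ` Lam4_27"
      using TF c q e by (simp add: characteristic_forms_def)
    then obtain \<tau>1 \<tau>2 where "frame_form 4 e (F c q) = star (sigma_plus \<tau>1) + star (sigma_plus \<tau>2)"
      by (auto simp: set_plus_def Lam4_8_def Lam4_27_def)
    then have "frame_form 4 e (F c q) = star (sigma_plus (\<tau>1 + \<tau>2))"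
      by (simp add: linear_add[OF linear_star] linear_add[OF linear_sigma_plus])
    note cyclic = cyclic_contraction[OF this, of i j k]
    note rotate = alternating_3_rotate[OF T_alternating[OF q]]
    \<comment> \<open>T is invariant under rotation of its arguments, so the cyclic sum of the terms
      \<open>1 / 2 * t\<close> is 3/2 of T; \<open>u\<close>, \<open>v\<close>, \<open>w\<close> are
      the F-terms, which cancel. This is the origin of 2/3.\<close>
    have combine: "t = 2 / 3 * (1 / 2 * t + u) + 2 / 3 * (1 / 2 * t + v) + 2 / 3 * (1 / 2 * t + w)"
      if "u + v + w = 0" for t u v w :: real
      using that by (simp add: field_simps)
    show ?thesis
      using combine[OF cyclic, of "T c q [e i, e j, e k]"] rotate[of "e j" "e k" "e i"]
          rotate[of "e k" "e i" "e j"]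
      by (simp only: difference_frame[OF q e] nth_Cons_0 nth_Cons_Suc One_nat_def numeral_2_eq_2)
  qed
  have "multilinear 3 (T c q)" using T_tensorial q by (simp add: tensorial_def)
  from eq_on_frames[OF q this h cyc] show ?thesis by simp
qed

lemma torsion_eq_difference:
  assumes q: "q \<in> fst c"
  shows "torsion_tensor g Dc c q [x, y, z]
    = difference_tensor g Dc Dg c q [x, y, z] - difference_tensor g Dc Dg c q [y, x, z]"
proof -
  have "torsion Dg c q x y = 0" using Dg c q by (simp add: levi_civita_def)
  then have "Dg c q x y = Dg c q y x" by (simp add: torsion_def cov_const bracket_def
      deriv_in_const)
  then show ?thesis
    by (simp add: torsion_tensor_def torsion_def cov_const bracket_def deriv_in_const difference_eq
        linear_diff[OF g_linear_1[OF q]])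
qed

text \<open>Koszul's argument: in the signed cyclic sum of the torsion, skewness in the last two
  slots cancels all values of the difference tensor except the two that equal the left side.\<close>

lemma difference_eq_torsion:
  assumes q: "q \<in> fst c"
  shows "difference_tensor g Dc Dg c q [x, y, z] = 1 / 2 * torsion_tensor g Dc c q [x, y, z]
    - 1 / 2 * torsion_tensor g Dc c q [y, z, x] + 1 / 2 * torsion_tensor g Dc c q [z, x, y]"
proof -
  have "a = 1 / 2 * (a - b) - 1 / 2 * (b' - d) + 1 / 2 * (d' - a')"
    if "a' = - a" "b' = - b" "d' = - d" for a b d a' b' d' :: real
    using that by (simp add: field_simps)
  then show ?thesis
    unfolding torsion_eq_difference[OF q] by this (rule difference_skew[OF q])+
qed

end

lemma sum_swap_contraction:
  fixes v :: "8 \<Rightarrow> real"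
  shows "(\<Sum>m\<in>UNIV. v m * (\<Sum>a\<in>UNIV. \<Sum>b\<in>UNIV. r a b * f m a b))
    = (\<Sum>a\<in>UNIV. \<Sum>b\<in>UNIV. r a b * (\<Sum>m\<in>UNIV. v m * f m a b))"
proof -
  have "(\<Sum>m\<in>UNIV. v m * (\<Sum>a\<in>UNIV. \<Sum>b\<in>UNIV. r a b * f m a b))
      = (\<Sum>m\<in>UNIV. \<Sum>a\<in>UNIV. \<Sum>b\<in>UNIV. r a b * (v m * f m a b))"
    by (simp add: sum_distrib_left mult.left_commute)
  also have "\<dots> = (\<Sum>a\<in>UNIV. \<Sum>m\<in>UNIV. \<Sum>b\<in>UNIV. r a b * (v m * f m a b))"
    by (rule sum.swap)
  also have "\<dots> = (\<Sum>a\<in>UNIV. \<Sum>b\<in>UNIV. \<Sum>m\<in>UNIV. r a b * (v m * f m a b))"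
    by (intro sum.cong refl sum.swap)
  finally show ?thesis by (simp only: sum_distrib_left)
qed

section \<open>Components in an adapted frame field near a point\<close>

locale psu3_frame = psu3_chart A g \<rho> \<Gamma> T F Dg Dc c
  for A :: "'m::{t2_space, second_countable_topology} chart set"
    and g \<rho> \<Gamma> T F :: "'m tensor" and Dg Dc :: "'m conn" and c :: "'m chart" +
  fixes p :: 'm and V :: "'m set" and e :: "'m \<Rightarrow> 8 \<Rightarrow> real ^ 8"
  assumes p_V: "p \<in> V" and frame: "adapted_frame_field g \<rho> c V e"
    and \<Gamma>_frame: "\<And>k i j. \<Gamma> c p [e p k, e p i, e p j] = val2 (pr_m (connection_form g Dg c e p k))
        i j"
begin

lemma V: "open V" "V \<subseteq> fst c" and adapted: "q \<in> V \<Longrightarrow> adapted_frame g \<rho> c q (e q)"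
  using frame by (auto simp: adapted_frame_field_def)

lemma p: "p \<in> fst c"
  using p_V V by blast

lemma diff_e: "diff_in c (\<lambda>q. e q i) p"
  using frame p_V V by (intro smooth_in_diff_in[of V]) (auto simp: adapted_frame_field_def)

lemma orthonormal: "q \<in> V \<Longrightarrow> g c q [e q i, e q j] = (if i = j then 1 else 0)"
  using adapted by (simp add: adapted_frame_def)

lemma frame_expansion: "v = (\<Sum>m\<in>UNIV. g c p [v, e p m] *\<^sub>R e p m)"
proof -
  have "linear (\<lambda>v. \<Sum>m\<in>UNIV. g c p [v, e p m] *\<^sub>R e p m)"
    by (rule linearI) (simp_all add: linear_add[OF g_linear_1[OF p]]
        linear_cmul[OF g_linear_1[OF p]]
        scaleR_add_left sum.distrib scaleR_sum_right)
  then have "id v = (\<Sum>m\<in>UNIV. g c p [v, e p m] *\<^sub>R e p m)"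
  proof (rule linear_eq_on_span[OF linear_id, of _ "range (e p)"])
    show "v \<in> span (range (e p))"
      using adapted_frame_span[OF adapted[OF p_V]] by simp
    fix x assume "x \<in> range (e p)"
    then show "id x = (\<Sum>m\<in>UNIV. g c p [x, e p m] *\<^sub>R e p m)"
      by (auto simp: orthonormal[OF p_V] if_distrib[of "\<lambda>r. r *\<^sub>R _"] cong: if_cong)
  qed
  then show ?thesis by simp
qed

text \<open>The connection form of \<open>D\<close> in the frame, as in
  \<open>connection_form\<close> but for an arbitrary direction \<open>X\<close> in place of a frame
  vector.\<close>

definition w :: "'m conn \<Rightarrow> real ^ 8 \<Rightarrow> 8 \<Rightarrow> 8 \<Rightarrow> real" where
  "w D X i m = g c p [cov D c (\<lambda>_. X) (\<lambda>q. e q i) p, e p m]"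

lemma cov_e: "cov D c (\<lambda>_. X) (\<lambda>q. e q i) p = (\<Sum>m\<in>UNIV. w D X i m *\<^sub>R e p m)"
  unfolding w_def by (rule frame_expansion)

lemma linear_w:
  assumes "bilinear (D c p)"
  shows "linear (\<lambda>X. w D X i m)"
proof -
  have "linear (\<lambda>X. D c p X (e p i))" using assms by (simp add: bilinear_def)
  from linear_compose_add[OF linear_deriv_in[OF diff_e] this]
  have "linear (\<lambda>X. cov D c (\<lambda>_. X) (\<lambda>q. e q i) p)" by (simp add: cov_def)
  from linear_compose[OF this g_linear_1[OF p]] show ?thesis by (simp add: w_def comp_def)
qed

lemma w_frame_expansion:
  assumes "bilinear (D c p)"
  shows "w D X i m = (\<Sum>k\<in>UNIV. g c p [X, e p k] * w D (e p k) i m)"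
proof -
  have "w D X i m = w D (\<Sum>k\<in>UNIV. g c p [X, e p k] *\<^sub>R e p k) i m"
    using frame_expansion[of X] by simp
  then show ?thesis
    by (simp add: linear_sum[OF linear_w[of D, OF assms]] linear_cmul[OF linear_w[of D, OF assms]])
qed

lemma slot_cov_e:
  assumes "tensorial c k S" "length Ys = k" "a < k"
  shows "S c p (Ys[a := cov D c (\<lambda>_. X) (\<lambda>q. e q i) p]) =
      (\<Sum>m\<in>UNIV. w D X i m * S c p (Ys[a := e p m]))"
proof -
  have lin: "linear (\<lambda>v. S c p (Ys[a := v]))"
    using assms p by (intro multilinear_slot[of k]) (auto simp: tensorial_def)
  show ?thesis
    unfolding cov_e by (simp add: linear_sum[OF lin] linear_cmul[OF lin])
qed

lemma diff_frame_components:
  assumes "tensorial c (length ns) S"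
  shows "diff_in c (\<lambda>q. S c q (map (e q) ns)) p"
  using diff_in_tensor_fields[OF p, of "map (\<lambda>n q. e q n) ns" S] assms diff_e
  by (auto simp: comp_def)

lemma cov_tensor_frame:
  assumes "tensorial c (length ns) S"
  shows "cov_tensor D S c p X (map (e p) ns) = deriv_in c (\<lambda>q. S c q (map (e q) ns)) p X
    - (\<Sum>a<length ns. \<Sum>m\<in>UNIV. w D X (ns ! a) m * S c p ((map (e p) ns)[a := e p m]))"
proof -
  have "cov_tensor D S c p X (map (\<lambda>Y. Y p) (map (\<lambda>n q. e q n) ns))
      = deriv_in c (\<lambda>q. S c q (map (\<lambda>Y. Y q) (map (\<lambda>n q. e q n) ns))) p X
      - (\<Sum>a<length ns. S c p ((map (\<lambda>Y. Y p) (map (\<lambda>n q. e q n) ns))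
          [a := cov D c (\<lambda>_. X) (map (\<lambda>n q. e q n) ns ! a) p]))"
    using cov_tensor_fields[OF p, of "map (\<lambda>n q. e q n) ns" S D X] assms diff_e by auto
  then show ?thesis
    using assms by (simp add: comp_def slot_cov_e cong: sum.cong_simp)
qed

text \<open>The components of the metric in an orthonormal frame are constant, so parallelism leaves
  only the connection terms.\<close>

lemma w_Dg_antisym: "w Dg X j i = - w Dg X i j"
proof -
  have "cov_tensor Dg g c p X [e p i, e p j] = 0"
    using Dg c p by (simp add: levi_civita_def parallel_def)
  moreover have "deriv_in c (\<lambda>q. g c q [e q i, e q j]) p X = 0"
  proof -
    have "deriv_in c (\<lambda>q. g c q [e q i, e q j]) p = deriv_in c (\<lambda>q. if i = j then 1 else 0 :: real)
        p"
      using V p_V by (intro deriv_in_cong[of V] diff_in_const) (auto simp: orthonormal)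
    then show ?thesis by (simp add: deriv_in_const)
  qed
  ultimately have "(\<Sum>m\<in>UNIV. w Dg X i m * g c p [e p m, e p j]) +
      (\<Sum>m\<in>UNIV. w Dg X j m * g c p [e p i, e p m]) = 0"
    using cov_tensor_frame[of "[i, j]" g Dg X] g_tensorial by (simp add: numeral_2_eq_2)
  then show ?thesis
    by (simp add: orthonormal[OF p_V] if_distrib cong: if_cong)
qed

lemma w_difference: "w Dc X i j = w Dg X i j + difference_tensor g Dc Dg c p [X, e p i, e p j]"
  by (simp add: w_def cov_def difference_eq linear_add[OF g_linear_1[OF p]])

lemma w_antisym: "w Dc X j i = - w Dc X i j"
  using w_difference[of X i j] w_difference[of X j i] w_Dg_antisym[of X i j]
    difference_skew[OF p, of X "e p i" "e p j"] by simp

text \<open>The intrinsic torsion is the \<mm>-part of the Levi-Civita form, and the correction by T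
  and F removes exactly this part; what remains acts on \<open>rho0\<close> as in
  \<open>rho0_invariant\<close>.\<close>

lemma w_invariant:
  "(\<Sum>m\<in>UNIV. w Dc X i m * rc m a b + w Dc X a m * rc i m b + w Dc X b m * rc i a m) = 0"
proof -
  let ?T = "frame_form 3 (e p) (T c p)" and ?F = "frame_form 4 (e p) (F c p)"
  have adapted_p: "adapted_frame g \<rho> c p (e p)" by (rule adapted[OF p_V])
  have inv: "(\<Sum>m\<in>UNIV. w Dc (e p k) i m * rc m a b + w Dc (e p k) a m * rc i m b + w Dc (e p k) b m
      * rc i a m) = 0"
    for k
  proof -
    define \<Omega> where "\<Omega> = connection_form g Dg c e p k"
    have \<Omega>: "\<Omega> = (\<Sum>i\<in>UNIV. \<Sum>j\<in>{i<..}. w Dg (e p k) i j *\<^sub>R axis {i, j} 1)"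
      \<comment> \<open>\<open>cov\<close> depends on its direction field only through the value at
        \<open>p\<close>, so the field \<open>e q k\<close> may be replaced by the constant
        \<open>e p k\<close>.\<close>
      by (simp add: \<Omega>_def connection_form_def w_def cov_def)
    have \<Omega>_Lam: "\<Omega> \<in> Lam 2" and \<Omega>_val2: "val2 \<Omega> i j = w Dg (e p k) i j" for i j
      unfolding \<Omega> by (rule form_of_matrix_Lam val2_form_of_matrix, rule w_Dg_antisym)+
    \<comment> \<open>The connection form of \<open>Dc\<close> in direction \<open>e p k\<close> as
      a 2-form: the Levi-Civita part plus the two terms of the difference tensor.\<close>
    define W where "W = \<Omega> + (1 / 2) *\<^sub>R hook k ?T + sigma 2 (hook k rho0) ?F"
    have val2_W: "val2 W i j = w Dc (e p k) i j" for i j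
      by (simp add: W_def linear_add[OF linear_val2] linear_cmul[OF linear_val2] \<Omega>_val2 w_difference
          difference_frame[OF p adapted_p] val2_hook_frame_form[OF T_alternating[OF p]])
    have "hook k ?T \<in> Lam 2"
      using hook_Lam[of ?T 2] frame_form_Lam[of 3] by simp
    moreover have "sigma 2 (hook k rho0) ?F \<in> Lam 2"
    proof -
      have "hook b (hook a ?F) \<in> Lam 2" for a b
        using hook_Lam[of "hook a ?F" 2] hook_Lam[of ?F 3] frame_form_Lam[of 4] by simp
      then show ?thesis
        unfolding sigma_2_eq[OF hook_rho0_Lam] by (intro subspace_sum subspace_scale subspace_Lam)
    qed
    ultimately have W_Lam: "W \<in> Lam 2"
      unfolding W_def by (intro subspace_add subspace_scale subspace_Lam \<Omega>_Lam)
    have "frame_tform (e p) (\<Gamma> c p) = Theta1 ?T + Theta2 ?F"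
    proof -
      have type: "frame_tform (e p) (\<Gamma> c p) \<in> W1 + W2 + W3 + W4 + W5"
        using \<Gamma>_type c p adapted_p by (simp add: of_type_def)
      obtain \<Gamma>1 \<Gamma>2 \<Gamma>3 \<Gamma>4 \<Gamma>5 \<Gamma>6 where "\<Gamma>6 \<in> W6"
        "frame_tform (e p) (\<Gamma> c p) = \<Gamma>1 + \<Gamma>2 + \<Gamma>3 + \<Gamma>4 + \<Gamma>5 + \<Gamma>6"
        "Theta1 ?T = \<Gamma>1 + \<Gamma>2 + \<Gamma>3" "Theta2 ?F = \<Gamma>4 + \<Gamma>5"
        using TF c p adapted_p unfolding characteristic_forms_def by blast
      with type show ?thesis by (intro torsion_eq_Theta)
    qed
    moreover have "frame_tform (e p) (\<Gamma> c p) $ k = pr_m \<Omega>"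
    proof -
      have "pr_m \<Omega> \<in> Lam 2" using pr_m_Lam2_20 by (simp add: Lam2_20_def)
      then show ?thesis
        by (simp add: frame_tform_def frame_form_2_eqI \<Gamma>_frame \<Omega>_def)
    qed
    ultimately have "pr_m \<Omega> = - (1 / 2) *\<^sub>R pr_m (hook k ?T) - pr_m (sigma 2 (hook k rho0) ?F)"
      by (simp add: Theta1_def Theta2_def)
    \<comment> \<open>The minus signs in \<open>Theta1\<close> and \<open>Theta2\<close> are what
      makes the three projections cancel.\<close>
    then have "pr_m W = 0"
      by (simp add: W_def linear_add[OF linear_pr_m] linear_cmul[OF linear_pr_m])
    then have "orthogonal W \<zeta>" if "\<zeta> \<in> Lam2_20" for \<zeta>
      using pr_m_inner[OF that, of W] by (simp add: orthogonal_def)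
    from rho0_invariant[OF orthogonal_Lam2_20[OF W_Lam this], of i a b] show ?thesis
      by (simp add: val2_W)
  qed
  \<comment> \<open>Linearity in the direction extends the identity from frame vectors to
    \<open>X\<close>.\<close>
  have "(\<Sum>m\<in>UNIV. w Dc X i m * rc m a b + w Dc X a m * rc i m b + w Dc X b m * rc i a m)
      = (\<Sum>m\<in>UNIV. \<Sum>k\<in>UNIV. g c p [X, e p k] * (w Dc (e p k) i m * rc m a b
          + w Dc (e p k) a m * rc i m b + w Dc (e p k) b m * rc i a m))"
    unfolding w_frame_expansion[of Dc X, OF bilinear_D(1)[OF p]]
    by (simp add: sum_distrib_left sum.distrib algebra_simps)
  also have "\<dots> = (\<Sum>k\<in>UNIV. g c p [X, e p k] * (\<Sum>m\<in>UNIV. w Dc (e p k) i m * rc m a b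
          + w Dc (e p k) a m * rc i m b + w Dc (e p k) b m * rc i a m))"
    unfolding sum_distrib_left by (rule sum.swap)
  finally show ?thesis by (simp add: inv)
qed

text \<open>The connection form of \<open>Dc\<close> annihilates \<open>rho0\<close>, so contraction with \<open>rho0\<close> commutes with
  covariant differentiation.\<close>

lemma cov_tensor_difference:
  "cov_tensor Dc (difference_tensor g Dc Dg) c p X [e p i, e p j, e p k]
    = 1 / 2 * cov_tensor Dc T c p X [e p i, e p j, e p k]
      + 1 / 2 * (\<Sum>a\<in>UNIV. \<Sum>b\<in>UNIV. rc i a b * cov_tensor Dc F c p X [e p a, e p b, e p j, e p k])"
proof -
  let ?d = "difference_tensor g Dc Dg"
  let ?w = "w Dc X"
  let ?f = "\<lambda>a b j k. F c p [e p a, e p b, e p j, e p k]"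
  let ?C = "\<lambda>i j k. \<Sum>a\<in>UNIV. \<Sum>b\<in>UNIV. rc i a b * ?f a b j k"
  \<comment> \<open>Valid on all of \<open>V\<close> with coefficients \<open>rc\<close> independent
    of the point; differentiation therefore passes through the contraction.\<close>
  have d: "?d c q [e q i, e q j, e q k] = 1 / 2 * T c q [e q i, e q j, e q k]
      + 1 / 2 * (\<Sum>a\<in>UNIV. \<Sum>b\<in>UNIV. rc i a b * F c q [e q a, e q b, e q j, e q k])" if "q \<in> V" for q
          i j k
  proof -
    have "q \<in> fst c" using that V by blast
    then show ?thesis
      by (simp add: difference_frame[OF _ adapted[OF that]]
          val2_sigma_2_frame_form[OF F_alternating])
  qed
  have diff_T: "diff_in c (\<lambda>q. T c q [e q i, e q j, e q k]) p"
    using diff_frame_components[of "[i, j, k]" T] T_tensorial by (simp add: numeral_3_eq_3)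
  have diff_F: "diff_in c (\<lambda>q. F c q [e q a, e q b, e q j, e q k]) p" for a b
    using diff_frame_components[of "[a, b, j, k]" F] F_tensorial by (simp add: eval_nat_numeral)
  have "deriv_in c (\<lambda>q. ?d c q [e q i, e q j, e q k]) p
      = deriv_in c (\<lambda>q. 1 / 2 * T c q [e q i, e q j, e q k]
      + 1 / 2 * (\<Sum>a\<in>UNIV. \<Sum>b\<in>UNIV. rc i a b * F c q [e q a, e q b, e q j, e q k])) p"
    by (intro deriv_in_cong[OF V p_V] d[symmetric] diff_in_add diff_in_mult diff_in_sum diff_T
        diff_F)
  then have deriv: "deriv_in c (\<lambda>q. ?d c q [e q i, e q j, e q k]) p X
      = 1 / 2 * deriv_in c (\<lambda>q. T c q [e q i, e q j, e q k]) p X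
      + 1 / 2 * (\<Sum>a\<in>UNIV. \<Sum>b\<in>UNIV. rc i a b * deriv_in c (\<lambda>q. F c q [e q a, e q b, e q j, e q k]) p
          X)"
    by (simp only: deriv_in_add deriv_in_mult deriv_in_sum diff_in_add diff_in_mult diff_in_sum
        diff_T diff_F)
  have cov3: "cov_tensor Dc S c p X [e p i, e p j, e p k] = deriv_in c
      (\<lambda>q. S c q [e q i, e q j, e q k]) p X
      - ((\<Sum>m\<in>UNIV. ?w i m * S c p [e p m, e p j, e p k]) +
          (\<Sum>m\<in>UNIV. ?w j m * S c p [e p i, e p m, e p k])
        + (\<Sum>m\<in>UNIV. ?w k m * S c p [e p i, e p j, e p m]))" if "tensorial c 3 S" for S
    using cov_tensor_frame[of "[i, j, k]" S Dc X] that by (simp add: eval_nat_numeral)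
  have cov4: "cov_tensor Dc F c p X [e p a, e p b, e p j, e p k]
      = deriv_in c (\<lambda>q. F c q [e q a, e q b, e q j, e q k]) p X
      - ((\<Sum>m\<in>UNIV. ?w a m * ?f m b j k + ?w b m * ?f a m j k)
        + ((\<Sum>m\<in>UNIV. ?w j m * ?f a b m k) + (\<Sum>m\<in>UNIV. ?w k m * ?f a b j m)))" for a b
    using cov_tensor_frame[of "[a, b, j, k]" F Dc X] F_tensorial by
        (simp add: eval_nat_numeral sum.distrib)
  \<comment> \<open>The first index of the difference tensor is an index of \<open>rc\<close>;
    invariance of \<open>rho0\<close> transfers the connection term to the two contracted slots of
    F.\<close>
  have first: "(\<Sum>m\<in>UNIV. ?w i m * ?C m j k)
      = (\<Sum>a\<in>UNIV. \<Sum>b\<in>UNIV. rc i a b * (\<Sum>m\<in>UNIV. ?w a m * ?f m b j k + ?w b m * ?f a m j k))"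
    by (rule contraction_derivation[OF w_antisym w_invariant])
  \<comment> \<open>The slots \<open>j\<close> and \<open>k\<close> are untouched by the
    contraction, so interchanging sums suffices.\<close>
  have second: "(\<Sum>m\<in>UNIV. ?w j m * ?C i m k) =
      (\<Sum>a\<in>UNIV. \<Sum>b\<in>UNIV. rc i a b * (\<Sum>m\<in>UNIV. ?w j m * ?f a b m k))"
    by (rule sum_swap_contraction)
  have third: "(\<Sum>m\<in>UNIV. ?w k m * ?C i j m) =
      (\<Sum>a\<in>UNIV. \<Sum>b\<in>UNIV. rc i a b * (\<Sum>m\<in>UNIV. ?w k m * ?f a b j m))"
    by (rule sum_swap_contraction)
  have split: "(\<Sum>m\<in>UNIV. v m * (1 / 2 * s m + 1 / 2 * t m))
      = 1 / 2 * (\<Sum>m\<in>UNIV. v m * s m) + 1 / 2 * (\<Sum>m\<in>UNIV. v m * t m)" for v s t :: "8 \<Rightarrow> real"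
    by (simp add: distrib_left sum.distrib sum_distrib_left algebra_simps)
  show ?thesis
    unfolding cov3[OF difference_tensorial] cov3[OF T_tensorial] cov4 deriv d[OF p_V]
    unfolding split first second third
    unfolding right_diff_distrib[of "rc _ _ _"] sum_subtractf distrib_left[of "rc _ _ _"]
        sum.distrib
    by (simp add: algebra_simps)
qed

end

section \<open>Recovering the covariant derivative of F\<close>

lemma alternating_4:
  assumes "alternating 4 f"
  shows "f [y, x, z, u] = - f [x, y, z, u]" "f [x, z, y, u] = - f [x, y, z, u]"
  using alternating_swap[of "[]" "[z, u]" f y x] alternating_swap[of "[x]" "[u]" f z y] assms
  by (simp_all add: eval_nat_numeral)

context atlas_chart
begin

lemma cov_tensor_4:
  "cov_tensor D S c p X [x, y, z, u] = deriv_in c (\<lambda>q. S c q [x, y, z, u]) p X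
    - (S c p [D c p X x, y, z, u] + S c p [x, D c p X y, z, u] + S c p [x, y, D c p X z, u]
      + S c p [x, y, z, D c p X u])"
  by (simp add: cov_tensor_def cov_const eval_nat_numeral)

text \<open>These two exchanges generate the symmetry in the first three slots, as injectivity on
  3-forms requires; the fourth argument stays fixed there.\<close>

lemma cov_tensor_alternating_4:
  assumes p: "p \<in> fst c" and S: "tensorial c 4 S" and alt: "\<And>q. q \<in> fst c \<Longrightarrow> alternating 4 (S c q)"
  shows "cov_tensor D S c p X [y, x, z, u] = - cov_tensor D S c p X [x, y, z, u]"
    and "cov_tensor D S c p X [x, z, y, u] = - cov_tensor D S c p X [x, y, z, u]"
proof -
  have diff: "diff_in c (\<lambda>q. S c q [x, y, z, u]) p"
    using S p by (simp add: tensorial_def)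
  have neg: "deriv_in c (\<lambda>q. S c q Ys) p X = - deriv_in c (\<lambda>q. S c q [x, y, z, u]) p X"
    if "\<And>q. q \<in> fst c \<Longrightarrow> S c q Ys = - S c q [x, y, z, u]" for Ys
  proof -
    have "deriv_in c (\<lambda>q. S c q Ys) p = deriv_in c (\<lambda>q. - 1 * S c q [x, y, z, u]) p"
      using that p chart_open(1) by (intro deriv_in_cong[of "fst c"] diff_in_mult diff) auto
    then show ?thesis using deriv_in_mult[OF diff, of "- 1" X] by simp
  qed
  show "cov_tensor D S c p X [y, x, z, u] = - cov_tensor D S c p X [x, y, z, u]"
    using neg[OF alternating_4(1)[OF alt]] alternating_4(1)[OF alt[OF p], of y "D c p X x" z u]
      alternating_4(1)[OF alt[OF p], of "D c p X y" x z u]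
          alternating_4(1)[OF alt[OF p], of y x "D c p X z" u]
      alternating_4(1)[OF alt[OF p], of y x z "D c p X u"]
    by (simp add: cov_tensor_4)
  show "cov_tensor D S c p X [x, z, y, u] = - cov_tensor D S c p X [x, y, z, u]"
    using neg[OF alternating_4(2)[OF alt]] alternating_4(2)[OF alt[OF p], of "D c p X x" z y u]
      alternating_4(2)[OF alt[OF p], of x "D c p X z" y u]
          alternating_4(2)[OF alt[OF p], of x z "D c p X y" u]
      alternating_4(2)[OF alt[OF p], of x z y "D c p X u"]
    by (simp add: cov_tensor_4)
qed

end

lemma multilinear_zeroI:
  assumes "multilinear k f" "span (range e) = UNIV"
    and "\<And>ns. length ns = k \<Longrightarrow> f (map e ns) = 0" and "length Xs = k"
  shows "f Xs = 0"
proof -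
  have "multilinear k (\<lambda>_. 0)" by (simp add: multilinear_def linear_zero)
  then show ?thesis using multilinear_eqI[OF assms(1) _ assms(2)] assms(3,4) by simp
qed

context psu3_frame
begin

lemma cov_tensor_zeroI:
  assumes "tensorial c k S" "\<And>ns. length ns = k \<Longrightarrow> cov_tensor Dc S c p X (map (e p) ns) = 0" "length
      Ys = k"
  shows "cov_tensor Dc S c p X Ys = 0"
  by (rule multilinear_zeroI[OF multilinear_cov_tensor[where D = Dc, OF p assms(1)
      bilinear_D(1)[OF p]]
        adapted_frame_span[OF adapted[OF p_V]] assms(2,3)])

lemma cov_difference_zero:
  assumes "\<And>Ys. length Ys = 3 \<Longrightarrow> cov_tensor Dc T c p X Ys = 0"
    and "\<And>Ys. length Ys = 4 \<Longrightarrow> cov_tensor Dc F c p X Ys = 0" and "length Ys = 3"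
  shows "cov_tensor Dc (difference_tensor g Dc Dg) c p X Ys = 0"
  by (rule cov_tensor_zeroI[OF difference_tensorial])
    (use assms in \<open>auto simp: length_3_conv cov_tensor_difference\<close>)

text \<open>By \<open>cov_tensor_difference\<close> the contraction of the covariant derivative of F
  vanishes. With its last argument fixed, this derivative is alternating in the other three, so
  \<open>contraction_rc_injective\<close> applies.\<close>

lemma cov_F_zero:
  assumes "\<And>Ys. length Ys = 3 \<Longrightarrow> cov_tensor Dc (difference_tensor g Dc Dg) c p X Ys = 0"
    and "\<And>Ys. length Ys = 3 \<Longrightarrow> cov_tensor Dc T c p X Ys = 0" and "length Ys = 4"
  shows "cov_tensor Dc F c p X Ys = 0"
proof (rule cov_tensor_zeroI[OF F_tensorial _ assms(3)])
  fix ns :: "8 list" assume "length ns = 4"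
  then obtain i j k l where ns: "ns = [i, j, k, l]"
    by (auto simp: eval_nat_numeral length_Suc_conv)
  have "cov_tensor Dc F c p X [e p i, e p j, e p k, e p l] = 0"
  proof (rule contraction_rc_injective[where G = "\<lambda>i j k. cov_tensor Dc F c p X
      [e p i, e p j, e p k, e p l]"])
    show "(\<Sum>a\<in>UNIV. \<Sum>b\<in>UNIV. rc i a b * cov_tensor Dc F c p X [e p a, e p b, e p k, e p l]) = 0"
        for i k
      using cov_tensor_difference[of X i k l] assms(1,2) by simp
  qed (rule cov_tensor_alternating_4[OF p F_tensorial F_alternating], assumption)+
  then show "cov_tensor Dc F c p X (map (e p) ns) = 0" by (simp add: ns)
qed

end

context psu3_chart
begin

lemma psu3_frame_exists:
  assumes "p \<in> fst c"
  shows "\<exists>V e. psu3_frame A g \<rho> \<Gamma> T F Dg Dc c p V e"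
proof -
  obtain V e where "p \<in> V" "adapted_frame_field g \<rho> c V e"
    "\<forall>k i j. \<Gamma> c p [e p k, e p i, e p j] = val2 (pr_m (connection_form g Dg c e p k)) i j"
    using \<Gamma> c assms unfolding intrinsic_torsion_def by blast
  then have "psu3_frame A g \<rho> \<Gamma> T F Dg Dc c p V e"
    by unfold_locales auto
  then show ?thesis by blast
qed

lemma difference_diff: "p \<in> fst c \<Longrightarrow> diff_in c (\<lambda>q. difference_tensor g Dc Dg c q [x, y, z]) p"
  using difference_tensorial by (simp add: tensorial_def)

lemma torsion_diff:
  assumes "p \<in> fst c"
  shows "diff_in c (\<lambda>q. torsion_tensor g Dc c q [x, y, z]) p"
proof (rule diff_in_cong[OF chart_open(1) subset_refl assms])
  show "diff_in c (\<lambda>q. difference_tensor g Dc Dg c q [x, y, z]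
      + - 1 * difference_tensor g Dc Dg c q [y, x, z]) p"
    using assms by (intro diff_in_add diff_in_mult difference_diff)
qed (simp add: torsion_eq_difference)

lemma cov_torsion:
  assumes "p \<in> fst c"
  shows "cov_tensor Dc (torsion_tensor g Dc) c p X [x, y, z]
    = cov_tensor Dc (difference_tensor g Dc Dg) c p X [x, y, z] - cov_tensor Dc
        (difference_tensor g Dc Dg) c p X [y, x, z]"
  using cov_tensor_lincomb[OF assms, of "difference_tensor g Dc Dg" "torsion_tensor g Dc" 1 0 0 "-
      1" Dc X x y z]
    difference_diff[OF assms]
  by (simp add: torsion_eq_difference)

lemma cov_difference:
  assumes "p \<in> fst c"
  shows "cov_tensor Dc (difference_tensor g Dc Dg) c p X [x, y, z]
    = 1 / 2 * cov_tensor Dc (torsion_tensor g Dc) c p X [x, y, z]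
      - 1 / 2 * cov_tensor Dc (torsion_tensor g Dc) c p X [y, z, x]
      + 1 / 2 * cov_tensor Dc (torsion_tensor g Dc) c p X [z, x, y]"
  using cov_tensor_lincomb[OF assms, of "torsion_tensor g Dc" "difference_tensor g Dc Dg" "1 / 2"
      "- 1 / 2" "1 / 2" 0 Dc X x y z]
    torsion_diff[OF assms]
  by (simp add: difference_eq_torsion)

lemma cov_T:
  assumes "p \<in> fst c"
  shows "cov_tensor Dc T c p X [x, y, z] = 2 / 3 * cov_tensor Dc (difference_tensor g Dc Dg) c p X
      [x, y, z]
      + 2 / 3 * cov_tensor Dc (difference_tensor g Dc Dg) c p X [y, z, x]
      + 2 / 3 * cov_tensor Dc (difference_tensor g Dc Dg) c p X [z, x, y]"
  using cov_tensor_lincomb[OF assms, of "difference_tensor g Dc Dg" T "2 / 3" "2 / 3" "2 / 3" 0 Dc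
      X x y z]
    difference_diff[OF assms]
  by (simp add: T_eq_difference)

end

section \<open>Equivalence of the parallelism conditions\<close>

context psu3_connection
begin

lemma psu3_chart: "c \<in> A \<Longrightarrow> psu3_chart A g \<rho> \<Gamma> T F Dg Dc c"
  by unfold_locales

lemma parallel_3:
  "parallel A D 3 S \<longleftrightarrow> (\<forall>c\<in>A. \<forall>p\<in>fst c. \<forall>X x y z. cov_tensor D S c p X [x, y, z] = 0)"
  by (auto simp: parallel_def length_3_conv)

lemma parallel_torsion_iff:
  "parallel A Dc 3 (torsion_tensor g Dc) \<longleftrightarrow> parallel A Dc 3 (difference_tensor g Dc Dg)"
proof
  assume "parallel A Dc 3 (torsion_tensor g Dc)"
  then show "parallel A Dc 3 (difference_tensor g Dc Dg)"
    unfolding parallel_3 by (simp add: psu3_chart.cov_difference[OF psu3_chart])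
next
  assume "parallel A Dc 3 (difference_tensor g Dc Dg)"
  then show "parallel A Dc 3 (torsion_tensor g Dc)"
    unfolding parallel_3 by (simp add: psu3_chart.cov_torsion[OF psu3_chart])
qed

lemma parallel_difference_iff:
  "parallel A Dc 3 (difference_tensor g Dc Dg) \<longleftrightarrow> parallel A Dc 3 T \<and> parallel A Dc 4 F"
proof (intro iffI conjI)
  assume d: "parallel A Dc 3 (difference_tensor g Dc Dg)"
  \<comment> \<open>T comes first: solving for the contraction of the covariant derivative of F uses
    that T is parallel.\<close>
  show T: "parallel A Dc 3 T"
    using d unfolding parallel_3 by (simp add: psu3_chart.cov_T[OF psu3_chart])
  show "parallel A Dc 4 F"
    unfolding parallel_def
  proof (intro ballI allI impI)
    fix c p X and Ys :: "(real ^ 8) list" assume c: "c \<in> A" and p: "p \<in> fst c" and len: "length Ys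
        = 4"
    obtain V e where "psu3_frame A g \<rho> \<Gamma> T F Dg Dc c p V e"
      using psu3_chart.psu3_frame_exists[OF psu3_chart[OF c] p] by blast
    then show "cov_tensor Dc F c p X Ys = 0"
      by (rule psu3_frame.cov_F_zero) (use d T c p len in \<open>simp_all add: parallel_def\<close>)
  qed
next
  assume TF: "parallel A Dc 3 T \<and> parallel A Dc 4 F"
  show "parallel A Dc 3 (difference_tensor g Dc Dg)"
    unfolding parallel_def
  proof (intro ballI allI impI)
    fix c p X and Ys :: "(real ^ 8) list" assume c: "c \<in> A" and p: "p \<in> fst c" and len: "length Ys
        = 3"
    obtain V e where "psu3_frame A g \<rho> \<Gamma> T F Dg Dc c p V e"
      using psu3_chart.psu3_frame_exists[OF psu3_chart[OF c] p] by blast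
    then show "cov_tensor Dc (difference_tensor g Dc Dg) c p X Ys = 0"
      by (rule psu3_frame.cov_difference_zero) (use TF c p len in \<open>simp_all add: parallel_def\<close>)
  qed
qed

end

theorem proposition5p1:
  fixes A :: "'m::{t2_space, second_countable_topology} chart set"
    and g \<rho> \<Gamma> T F :: "'m tensor"
    and Dg Dc :: "'m conn"
  assumes "psu3_structure A g \<rho>"
    and "levi_civita A g Dg"
    and "intrinsic_torsion A g \<rho> Dg \<Gamma>"
    and "of_type A g \<rho> \<Gamma> (W1 + W2 + W3 + W4 + W5)"
    and "characteristic_forms A g \<rho> \<Gamma> T F"
    and "characteristic_connection A g \<rho> Dg T F Dc"
  shows "(parallel A Dc 3 (torsion_tensor g Dc) \<longleftrightarrow> parallel A Dc 3 (difference_tensor g Dc Dg))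
    \<and> (parallel A Dc 3 (difference_tensor g Dc Dg) \<longleftrightarrow> parallel A Dc 3 T \<and> parallel A Dc 4 F)"
proof -
  interpret psu3_connection A g \<rho> \<Gamma> T F Dg Dc
    using assms by unfold_locales
  show ?thesis
    using parallel_torsion_iff parallel_difference_iff by blast
qed

end
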